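(* An ideal $I$ of $B(H)$ is am-closed if and only if it is diagonally invariant, that is, $E(I)\subset I$.
   Context: $H$ is a separable infinite-dimensional Hilbert space with a fixed orthonormal basis $\{e_n\}_{n\ge1}$. $E$ is the conditional expectation of $B(H)$ onto the algebra of operators diagonal in this basis, i.e. $E(A)$ is the main diagonal of $A$; $E(I)=\{E(A):A\in I\}$. $c_0^*$ is the cone of nonincreasing sequences of nonnegative reals converging to $0$ (not a dual space). An ideal is a (proper) two-sided ideal of $B(H)$, hence consists of compact operators; its characteristic set is $\Sigma(I)=\{s(X): X\in I\}\subset c_0^*$, where $s(X)$ is the singular number sequence of $X$ (eigenvalues of $|X|$ in decreasing order, repeated with multiplicity). $I\mapsto\Sigma(I)$ is a bijection onto the hereditary (solid) subcones of $c_0^*$ invariant under all ampliations $\xi\mapsto\langle\xi_1,\dots,\xi_1,\xi_2,\dots,\xi_2,\dots\rangle$ (each entry repeated $m$ times). For $\xi\in c_0^*$, $\xi_a:=\langle\frac1n\sum_{j=1}^n\xi_j\rangle_n$. The ideals ${}_aI$ and $I_a$ are defined by $\Sigma({}_aI)=\{\xi\in c_0^*:\xi_a\in\Sigma(I)\}$ and $\Sigma(I_a)=\{\xi\in c_0^*:\xi=O(\eta_a)\text{ for some }\eta\in\Sigma(I)\}$. The am-closure (arithmetic mean closure) of $I$ is $I^-:={}_a(I_a)$, and $I$ is am-closed if $I=I^-$. *)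

theory Defs
  imports "HOL-Analysis.Analysis"
begin

section \<open>Complex Hilbert spaces\<close>

text \<open>The inner product \<open>cinner\<close> is linear in the first argument. Its real part is the inner
  product of \<^class>\<open>real_inner\<close>, so norm and topology are the ones induced by \<open>cinner\<close>;
  completeness comes from \<^class>\<open>banach\<close>.\<close>

class complex_hilbert_space = real_inner + banach +
  fixes scaleC :: "complex \<Rightarrow> 'a \<Rightarrow> 'a"  (infixr "*\<^sub>C" 75)
    and cinner :: "'a \<Rightarrow> 'a \<Rightarrow> complex"
  assumes scaleC_add_right: "a *\<^sub>C (x + y) = a *\<^sub>C x + a *\<^sub>C y"
    and scaleC_add_left: "(a + b) *\<^sub>C x = a *\<^sub>C x + b *\<^sub>C x"
    and scaleC_scaleC: "a *\<^sub>C b *\<^sub>C x = (a * b) *\<^sub>C x"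
    and scaleR_scaleC: "r *\<^sub>R x = complex_of_real r *\<^sub>C x"
    and cinner_commute: "cinner x y = cnj (cinner y x)"
    and cinner_add_left: "cinner (x + y) z = cinner x z + cinner y z"
    and cinner_scaleC_left: "cinner (a *\<^sub>C x) y = a * cinner x y"
    and inner_eq_Re_cinner: "inner x y = Re (cinner x y)"

global_interpretation complex_vector:
  vector_space "scaleC :: complex \<Rightarrow> 'a \<Rightarrow> 'a::complex_hilbert_space"
proof
  fix a b :: complex and x y :: 'a
  show "a *\<^sub>C (x + y) = a *\<^sub>C x + a *\<^sub>C y" by (rule scaleC_add_right)
  show "(a + b) *\<^sub>C x = a *\<^sub>C x + b *\<^sub>C x" by (rule scaleC_add_left)
  show "a *\<^sub>C b *\<^sub>C x = (a * b) *\<^sub>C x" by (rule scaleC_scaleC)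
  show "1 *\<^sub>C x = x" using scaleR_scaleC[of 1 x] by simp
qed

text \<open>A sequence that is an orthonormal basis; its existence makes the space separable and
  infinite-dimensional. Sequences are indexed from 0 throughout.\<close>

definition orthonormal_basis :: "(nat \<Rightarrow> 'a::complex_hilbert_space) \<Rightarrow> bool" where
  "orthonormal_basis e \<longleftrightarrow>
     (\<forall>m n. cinner (e m) (e n) = (if m = n then 1 else 0)) \<and>
     (\<forall>x. (\<lambda>n. cinner x (e n) *\<^sub>C e n) sums x)"

section \<open>Bounded operators and ideals\<close>

definition bounded_ops :: "('a::complex_hilbert_space \<Rightarrow> 'a) set" where
  "bounded_ops = {A. bounded_linear A \<and> (\<forall>c x. A (c *\<^sub>C x) = c *\<^sub>C A x)}"

definition adjoint_op :: "('a::complex_hilbert_space \<Rightarrow> 'a) \<Rightarrow> 'a \<Rightarrow> 'a" where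
  "adjoint_op A = (THE B. \<forall>x y. cinner (A x) y = cinner x (B y))"

definition positive_op :: "('a::complex_hilbert_space \<Rightarrow> 'a) \<Rightarrow> bool" where
  "positive_op P \<longleftrightarrow> P \<in> bounded_ops \<and> (\<forall>x. cinner (P x) x \<in> \<real>\<^sub>\<ge>\<^sub>0)"

definition abs_op :: "('a::complex_hilbert_space \<Rightarrow> 'a) \<Rightarrow> 'a \<Rightarrow> 'a" where
  "abs_op X = (THE P. positive_op P \<and> P \<circ> P = adjoint_op X \<circ> X)"

text \<open>Proper two-sided ideals of the algebra of bounded operators. Closure under complex
  scalars is composition with multiples of the identity. The zero ideal is included.\<close>

definition proper_ideal :: "('a::complex_hilbert_space \<Rightarrow> 'a) set \<Rightarrow> bool" where
  "proper_ideal I \<longleftrightarrow>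
     I \<subset> bounded_ops \<and>
     (\<lambda>x. 0) \<in> I \<and>
     (\<forall>A\<in>I. \<forall>B\<in>I. (\<lambda>x. A x + B x) \<in> I) \<and>
     (\<forall>A\<in>I. \<forall>B\<in>bounded_ops. A \<circ> B \<in> I \<and> B \<circ> A \<in> I)"

text \<open>The conditional expectation onto the operators diagonal in the basis \<open>e\<close>.\<close>

definition diag_expectation ::
    "(nat \<Rightarrow> 'a::complex_hilbert_space) \<Rightarrow> ('a \<Rightarrow> 'a) \<Rightarrow> 'a \<Rightarrow> 'a" where
  "diag_expectation e A = (\<lambda>x. \<Sum>n. (cinner (A (e n)) (e n) * cinner x (e n)) *\<^sub>C e n)"

section \<open>Singular numbers and characteristic sets\<close>

definition c0_star :: "(nat \<Rightarrow> real) set" where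
  "c0_star = {\<xi>. decseq \<xi> \<and> (\<forall>n. 0 \<le> \<xi> n) \<and> \<xi> \<longlonglongrightarrow> 0}"

text \<open>For compact \<open>X\<close>: the nonincreasing null sequence in which each eigenvalue \<open>t > 0\<close> of
  \<open>|X|\<close> occurs as often as its multiplicity (the dimension of its eigenspace), followed by
  zeros if \<open>X\<close> has finite rank. The value is only meaningful for compact \<open>X\<close>; every element
  of a proper ideal is compact.\<close>

definition singular_numbers :: "('a::complex_hilbert_space \<Rightarrow> 'a) \<Rightarrow> nat \<Rightarrow> real" where
  "singular_numbers X = (THE \<xi>. \<xi> \<in> c0_star \<and>
     (\<forall>t>0. card {n. \<xi> n = t} = complex_vector.dim {x. abs_op X x = complex_of_real t *\<^sub>C x}))"

definition char_set :: "('a::complex_hilbert_space \<Rightarrow> 'a) set \<Rightarrow> (nat \<Rightarrow> real) set" where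
  "char_set I = singular_numbers ` I"

text \<open>The inverse of \<^const>\<open>char_set\<close> on proper ideals; meaningful for \<open>S\<close> a hereditary,
  ampliation invariant subcone of \<^const>\<open>c0_star\<close>.\<close>

definition ideal_of_char_set :: "(nat \<Rightarrow> real) set \<Rightarrow> ('a::complex_hilbert_space \<Rightarrow> 'a) set" where
  "ideal_of_char_set S = (THE J. proper_ideal J \<and> char_set J = S)"

section \<open>Arithmetic mean ideals\<close>

definition arith_mean :: "(nat \<Rightarrow> real) \<Rightarrow> nat \<Rightarrow> real" where
  "arith_mean \<xi> n = (\<Sum>j\<le>n. \<xi> j) / real (n + 1)"

definition pre_am_ideal :: "('a::complex_hilbert_space \<Rightarrow> 'a) set \<Rightarrow> ('a \<Rightarrow> 'a) set" where
  "pre_am_ideal I = ideal_of_char_set {\<xi> \<in> c0_star. arith_mean \<xi> \<in> char_set I}"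

text \<open>The O-bound is required at every index rather than eventually. This only matters for the
  zero ideal, where an eventual bound would admit all finitely supported sequences.\<close>

definition am_ideal :: "('a::complex_hilbert_space \<Rightarrow> 'a) set \<Rightarrow> ('a \<Rightarrow> 'a) set" where
  "am_ideal I = ideal_of_char_set
     {\<xi> \<in> c0_star. \<exists>\<eta>\<in>char_set I. \<exists>C. \<forall>n. \<xi> n \<le> C * arith_mean \<eta> n}"

definition am_closure :: "('a::complex_hilbert_space \<Rightarrow> 'a) set \<Rightarrow> ('a \<Rightarrow> 'a) set" where
  "am_closure I = pre_am_ideal (am_ideal I)"

definition am_closed :: "('a::complex_hilbert_space \<Rightarrow> 'a) set \<Rightarrow> bool" where
  "am_closed I \<longleftrightarrow> I = am_closure I"

end

theory Submission
  imports Defs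
begin

text \<open>An ideal consists of compact operators and is determined by the singular numbers of its
  elements, so both sides are statements about sequences. If \<open>D\<close> is the diagonal of \<open>X\<close>, then the
  partial sums of the singular numbers of \<open>D\<close> are dominated by those of \<open>X\<close>; hence \<open>D\<close> always lies
  in the am-closure, and diagonal invariance follows if \<open>I\<close> is am-closed.

  Conversely, let the partial sums of \<open>\<xi>\<close> be dominated by those of \<open>\<eta>\<close>, with \<open>\<eta>\<close> in the
  characteristic set of a diagonally invariant ideal \<open>I\<close>. Up to the factor 2, \<open>\<xi>\<close> may be averaged
  over dyadic blocks. The mass of \<open>\<xi>\<close> on a block of length \<open>2 ^ k\<close> is transported from the
  first \<open>2 ^ k\<close> terms of \<open>\<eta>\<close> by weights \<open>p m k\<close> with \<open>\<Sum>k. p m k \<le> 1\<close>, and a contraction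
  \<open>V\<close> built from the Fourier matrices of order \<open>2 ^ k\<close> spreads it evenly, so that the diagonal of
  \<open>V\<^sup>* diag(\<eta>) V\<close> dominates \<open>\<xi> / 2\<close>. This takes the place of an infinite Schur--Horn theorem.\<close>

text \<open>\<open>adjoint_op\<close>, \<open>abs_op\<close>, \<open>singular_numbers\<close> and
  \<open>ideal_of_char_set\<close> are definite descriptions, of no use until existence and
  uniqueness are known; the singular value decomposition is the source of both. Bounds on subspaces
  of finite codimension then replace manipulations of eigenvalues. For the converse an exact
  diagonal would be too much to ask. Characteristic sets absorb constant factors, and diagonal
  operators compare entry by entry without sorting, so a diagonal that is at least \<xi> / 2 at
  every index is enough. Dyadic blocks are a matter of matching sizes: the Fourier matrix of order
  2^k has entries of equal modulus, so it spreads any weighted part of the first 2^k terms of \<eta>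
  into a constant diagonal on 2^k positions. The mass sent to block k is that of the indices 2^(k-1)
  \<le> j < 2^k (for k = 0, of the index 0), none of which exceeds an index of block k. Majorization
  then has to be invoked at 2^k only, and the interval being half as long as the block is what costs
  the factor 2.\<close>

lemma norm_sq_cinner: "cinner x x = complex_of_real ((norm x)\<^sup>2)"
  for x :: "'a::complex_hilbert_space"
proof (rule complex_eqI)
  show "Re (cinner x x) = Re (complex_of_real ((norm x)\<^sup>2))"
    by (simp add: inner_eq_Re_cinner[symmetric] dot_square_norm)
  have "Im (cinner x x) = - Im (cinner x x)"
    using arg_cong[OF cinner_commute[of x x], of Im] by simp
  then show "Im (cinner x x) = Im (complex_of_real ((norm x)\<^sup>2))" by simp
qed

lemma cinner_scaleC_right: "cinner x (a *\<^sub>C y) = cnj a * cinner x y"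
  by (subst (1 2) cinner_commute) (simp add: cinner_scaleC_left)

lemma cinner_add_right: "cinner x (y + z) = cinner x y + cinner x z"
  by (subst (1 2 3) cinner_commute) (simp add: cinner_add_left)

lemma cinner_scaleR_left: "cinner (r *\<^sub>R x) y = r *\<^sub>R cinner x y"
  by (simp add: scaleR_scaleC cinner_scaleC_left scaleR_conv_of_real)

lemma cinner_scaleR_right: "cinner x (r *\<^sub>R y) = r *\<^sub>R cinner x y"
  by (simp add: scaleR_scaleC cinner_scaleC_right scaleR_conv_of_real)

lemma norm_scaleC: "norm (a *\<^sub>C x) = cmod a * norm x"
proof -
  have "cinner (a *\<^sub>C x) (a *\<^sub>C x) = (a * cnj a) * cinner x x"
    by (simp add: cinner_scaleC_left cinner_scaleC_right)
  also have "\<dots> = complex_of_real ((cmod a * norm x)\<^sup>2)"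
    by (simp add: norm_sq_cinner power_mult_distrib complex_norm_square[symmetric])
  finally have "complex_of_real ((norm (a *\<^sub>C x))\<^sup>2) = complex_of_real ((cmod a * norm x)\<^sup>2)"
    unfolding norm_sq_cinner .
  then have "(norm (a *\<^sub>C x))\<^sup>2 = (cmod a * norm x)\<^sup>2" using of_real_eq_iff by blast
  then show ?thesis by (simp add: power2_eq_iff_nonneg)
qed

lemma cinner_cauchy_schwarz: "cmod (cinner x y) \<le> norm x * norm y"
proof (cases "cinner x y = 0")
  case False
  \<comment> \<open>Multiplication by the phase \<open>c\<close> turns the inner product onto the
    nonnegative real axis, which leaves the real Cauchy--Schwarz inequality.\<close>
  define c where "c = cnj (cinner x y) / cmod (cinner x y)"
  have c: "cmod c = 1" using False by (simp add: c_def norm_divide)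
  have "c * cinner x y = complex_of_real (cmod (cinner x y))"
    using False complex_norm_square[of "cinner x y"]
    by (simp add: c_def field_simps power2_eq_square)
  then have "cmod (cinner x y) = inner (c *\<^sub>C x) y"
    by (simp add: inner_eq_Re_cinner cinner_scaleC_left)
  also have "\<dots> \<le> norm (c *\<^sub>C x) * norm y" by (rule norm_cauchy_schwarz)
  finally show ?thesis by (simp add: norm_scaleC c)
qed simp

lemma bounded_bilinear_cinner:
  "bounded_bilinear (cinner :: 'a::complex_hilbert_space \<Rightarrow> 'a \<Rightarrow> complex)"
  by (rule bounded_bilinear.intro)
    (auto simp: cinner_add_left cinner_add_right cinner_scaleR_left cinner_scaleR_right
      intro!: exI[of _ 1] cinner_cauchy_schwarz)

lemma bounded_bilinear_scaleC:
  "bounded_bilinear (scaleC :: complex \<Rightarrow> 'a::complex_hilbert_space \<Rightarrow> 'a)"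
  by (rule bounded_bilinear.intro)
    (auto simp: scaleC_add_left scaleC_add_right scaleR_scaleC scaleC_scaleC norm_scaleC
      scaleR_conv_of_real mult.commute intro!: exI[of _ 1])

global_interpretation cinner: bounded_bilinear
  "cinner :: 'a::complex_hilbert_space \<Rightarrow> 'a \<Rightarrow> complex"
  by (rule bounded_bilinear_cinner)

global_interpretation scaleC: bounded_bilinear
  "scaleC :: complex \<Rightarrow> 'a::complex_hilbert_space \<Rightarrow> 'a"
  by (rule bounded_bilinear_scaleC)

lemma cinner_eq_zero_commute: "cinner x y = 0 \<longleftrightarrow> cinner y x = 0"
  by (subst cinner_commute) simp

lemma cmod_cinner_commute: "cmod (cinner x y) = cmod (cinner y x)"
  by (subst cinner_commute) simp

lemma cinner_ext: "(\<And>z. cinner x z = cinner y z) \<Longrightarrow> x = y"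
proof -
  assume "\<And>z. cinner x z = cinner y z"
  then have "cinner (x - y) (x - y) = 0" by (simp add: cinner.diff_left)
  then show ?thesis by (simp add: norm_sq_cinner)
qed

lemma norm_add_sq:
  "(norm (x + y))\<^sup>2 = (norm x)\<^sup>2 + (norm y)\<^sup>2 + 2 * Re (cinner x y)"
  for x y :: "'a::complex_hilbert_space"
  unfolding dot_square_norm[symmetric]
  by (simp add: inner_add_left inner_add_right inner_commute) (simp add: inner_eq_Re_cinner)

section \<open>The algebra of bounded operators\<close>

lemma bounded_opsD:
  assumes "A \<in> bounded_ops"
  shows "bounded_linear A" "A (c *\<^sub>C x) = c *\<^sub>C A x" "A (x + y) = A x + A y" "A (x - y) = A x - A y"
    "A 0 = 0" "A (- x) = - A x" "A (\<Sum>i\<in>F. h i) = (\<Sum>i\<in>F. A (h i))"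
proof -
  show b: "bounded_linear A" and "A (c *\<^sub>C x) = c *\<^sub>C A x"
    using assms by (auto simp: bounded_ops_def)
  interpret bounded_linear A by (rule b)
  show "A (x + y) = A x + A y" "A (x - y) = A x - A y" "A 0 = 0" "A (- x) = - A x"
    "A (\<Sum>i\<in>F. h i) = (\<Sum>i\<in>F. A (h i))"
    by (simp_all add: add diff zero neg sum)
qed

lemma bounded_opsI:
  assumes "\<And>x y. A (x + y) = A x + A y" "\<And>c x. A (c *\<^sub>C x) = c *\<^sub>C A x"
    "\<And>x. norm (A x) \<le> K * norm x"
  shows "A \<in> bounded_ops"
  unfolding bounded_ops_def mem_Collect_eq
  using assms by (auto intro!: bounded_linear_intro[of _ K] simp: scaleR_scaleC mult.commute)

lemma bounded_ops_bound:
  assumes "A \<in> bounded_ops"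
  obtains K where "K > 0" "\<And>x. norm (A x) \<le> K * norm x"
  using bounded_linear.pos_bounded[OF bounded_opsD(1)[OF assms]] by (metis mult.commute)

lemma bounded_ops_add:
  assumes "A \<in> bounded_ops" "B \<in> bounded_ops"
  shows "(\<lambda>x. A x + B x) \<in> bounded_ops"
  using assms by (auto simp: bounded_ops_def bounded_linear_add scaleC_add_right)

lemma bounded_ops_comp:
  assumes "A \<in> bounded_ops" "B \<in> bounded_ops"
  shows "A \<circ> B \<in> bounded_ops"
  using assms by (auto simp: bounded_ops_def o_def bounded_linear_compose)

lemma bounded_ops_scaleC: "(\<lambda>x. c *\<^sub>C x) \<in> bounded_ops"
  by (rule bounded_opsI[of _ "cmod c"])
    (auto simp: scaleC_add_right scaleC_scaleC norm_scaleC mult.commute)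

lemma bounded_ops_id: "(\<lambda>x. x) \<in> bounded_ops"
  using bounded_ops_scaleC[of 1] by simp

section \<open>Bessel families\<close>

text \<open>Bessel's inequality replaces orthogonality because convergence and boundedness of
  \<open>weighted_op\<close> need no more, and because \<open>block_vector\<close> is in general not
  orthogonal.\<close>

definition bessel :: "(nat \<Rightarrow> 'a::complex_hilbert_space) \<Rightarrow> bool" where
  "bessel f \<longleftrightarrow> (\<forall>x F. finite F \<longrightarrow> (\<Sum>n\<in>F. (cmod (cinner x (f n)))\<^sup>2) \<le> (norm x)\<^sup>2)"

lemma besselD: "bessel f \<Longrightarrow> finite F \<Longrightarrow> (\<Sum>n\<in>F. (cmod (cinner x (f n)))\<^sup>2) \<le> (norm x)\<^sup>2"
  unfolding bessel_def by blast

lemma bessel_norm_le: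
  assumes "bessel f" shows "norm (f n) \<le> 1"
proof -
  have "(cmod (cinner (f n) (f n)))\<^sup>2 \<le> (norm (f n))\<^sup>2"
    using besselD[OF assms, of "{n}" "f n"] by simp
  then have "((norm (f n))\<^sup>2)\<^sup>2 \<le> (norm (f n))\<^sup>2 * 1"
    unfolding norm_sq_cinner norm_of_real by simp
  then have "(norm (f n))\<^sup>2 \<le> 1"
    by (cases "(norm (f n))\<^sup>2 = 0") (simp, simp add: power2_eq_square)
  then show ?thesis by (simp add: power_le_one_iff)
qed

text \<open>Pair the sum with itself and apply the Cauchy--Schwarz inequality; no orthogonality is needed.\<close>

lemma bessel_norm_sum_le:
  assumes f: "bessel f" and F: "finite F"
  shows "(norm (\<Sum>n\<in>F. b n *\<^sub>C f n))\<^sup>2 \<le> (\<Sum>n\<in>F. (cmod (b n))\<^sup>2)"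
proof -
  define y where "y = (\<Sum>n\<in>F. b n *\<^sub>C f n)"
  define s where "s = (\<Sum>n\<in>F. (cmod (b n))\<^sup>2)"
  have s: "s \<ge> 0" unfolding s_def by (simp add: sum_nonneg)
  have "(norm y)\<^sup>2 = cmod (cinner y y)" unfolding norm_sq_cinner norm_of_real by simp
  also have "cinner y y = (\<Sum>n\<in>F. b n * cinner (f n) y)"
    by (subst y_def) (simp add: cinner.sum_left cinner_scaleC_left)
  also have "cmod \<dots> \<le> (\<Sum>n\<in>F. cmod (b n) * cmod (cinner y (f n)))"
    by (rule order_trans[OF norm_sum]) (simp add: norm_mult cmod_cinner_commute)
  also have "\<dots> \<le> L2_set (\<lambda>n. cmod (b n)) F * L2_set (\<lambda>n. cmod (cinner y (f n))) F"
    using L2_set_mult_ineq[of "\<lambda>n. cmod (b n)" "\<lambda>n. cmod (cinner y (f n))" F] by simp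
  also have "\<dots> \<le> sqrt s * norm y"
    unfolding s_def L2_set_def using besselD[OF f F, of y]
    by (intro mult_left_mono real_le_lsqrt) (auto intro: sum_nonneg)
  finally have "norm y * norm y \<le> sqrt s * norm y" by (simp add: power2_eq_square)
  then have "norm y \<le> sqrt s" using s
    by (cases "norm y = 0") auto
  then have "(norm y)\<^sup>2 \<le> (sqrt s)\<^sup>2" by (intro power_mono) auto
  then show ?thesis using s by (simp add: y_def s_def)
qed

lemma bessel_summable:
  assumes f: "bessel f" and b: "summable (\<lambda>n. (cmod (b n))\<^sup>2)"
  shows "summable (\<lambda>n. b n *\<^sub>C f n)"
  unfolding summable_Cauchy
proof (intro allI impI)
  fix r :: real assume r: "r > 0"
  then have "r\<^sup>2 > 0" by simp
  then obtain N where N: "\<And>m n. m \<ge> N \<Longrightarrow> norm (\<Sum>k=m..<n. (cmod (b k))\<^sup>2) < r\<^sup>2"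
    using b unfolding summable_Cauchy by blast
  show "\<exists>N. \<forall>m\<ge>N. \<forall>n. norm (\<Sum>k=m..<n. b k *\<^sub>C f k) < r"
  proof (intro exI allI impI)
    fix m n assume "m \<ge> N"
    have "(norm (\<Sum>k=m..<n. b k *\<^sub>C f k))\<^sup>2 \<le> (\<Sum>k=m..<n. (cmod (b k))\<^sup>2)"
      by (rule bessel_norm_sum_le[OF f]) simp
    also have "\<dots> < r\<^sup>2" using N[OF \<open>m \<ge> N\<close>, of n] by simp
    finally show "norm (\<Sum>k=m..<n. b k *\<^sub>C f k) < r" by (rule power2_less_imp_less) (use r in simp)
  qed
qed

lemma bessel_coeff_summable:
  assumes "bessel f" shows "summable (\<lambda>n. (cmod (cinner x (f n)))\<^sup>2)"
  by (rule summableI_nonneg_bounded[where x = "(norm x)\<^sup>2"]) (auto intro: besselD[OF assms])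

text \<open>One form for diagonal operators, partial isometries, singular value decompositions and
  the conditional expectation, so that bounds, adjoints and products are computed once.\<close>

definition weighted_op ::
    "(nat \<Rightarrow> complex) \<Rightarrow> (nat \<Rightarrow> 'a) \<Rightarrow> (nat \<Rightarrow> 'a) \<Rightarrow> 'a \<Rightarrow> 'a::complex_hilbert_space" where
  "weighted_op a f g = (\<lambda>x. \<Sum>n. (a n * cinner x (f n)) *\<^sub>C g n)"

lemma weighted_op_sums:
  assumes f: "bessel f" and g: "bessel g" and a: "\<forall>n. cmod (a n) \<le> K"
  shows "(\<lambda>n. (a n * cinner x (f n)) *\<^sub>C g n) sums weighted_op a f g x"
  unfolding weighted_op_def
proof (rule summable_sums, rule bessel_summable[OF g])
  have "summable (\<lambda>n. K\<^sup>2 * (cmod (cinner x (f n)))\<^sup>2)"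
    by (intro summable_mult bessel_coeff_summable f)
  then show "summable (\<lambda>n. (cmod (a n * cinner x (f n)))\<^sup>2)"
    by (rule summable_comparison_test[rotated])
      (auto simp: norm_mult power_mult_distrib intro!: exI[of _ 0] mult_right_mono power_mono a[rule_format])
qed

lemma weighted_op_norm_le:
  assumes f: "bessel f" and g: "bessel g" and a: "\<forall>n. cmod (a n) \<le> K"
  shows "norm (weighted_op a f g x) \<le> K * norm x"
proof (rule Lim_bounded[where M = 0])
  show "(\<lambda>N. norm (\<Sum>n<N. (a n * cinner x (f n)) *\<^sub>C g n)) \<longlonglongrightarrow> norm (weighted_op a f g x)"
    by (intro tendsto_norm) (use weighted_op_sums[OF f g a] in \<open>simp add: sums_def\<close>)
  have K: "K \<ge> 0" using a norm_ge_zero order_trans by blast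
  show "\<forall>N\<ge>0. norm (\<Sum>n<N. (a n * cinner x (f n)) *\<^sub>C g n) \<le> K * norm x"
  proof (intro allI impI)
    fix N
    have "(norm (\<Sum>n<N. (a n * cinner x (f n)) *\<^sub>C g n))\<^sup>2
        \<le> (\<Sum>n<N. (cmod (a n * cinner x (f n)))\<^sup>2)"
      by (rule bessel_norm_sum_le[OF g]) simp
    also have "\<dots> \<le> (\<Sum>n<N. K\<^sup>2 * (cmod (cinner x (f n)))\<^sup>2)"
      by (intro sum_mono) (auto simp: norm_mult power_mult_distrib intro!: mult_right_mono power_mono a[rule_format])
    also have "\<dots> \<le> K\<^sup>2 * (norm x)\<^sup>2"
      unfolding sum_distrib_left[symmetric] by (rule mult_left_mono[OF besselD[OF f]]) simp_all
    finally show "norm (\<Sum>n<N. (a n * cinner x (f n)) *\<^sub>C g n) \<le> K * norm x"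
      by (intro power2_le_imp_le[OF _ mult_nonneg_nonneg[OF K norm_ge_zero]]) (simp only: power_mult_distrib)
  qed
qed

lemma weighted_op_bounded:
  assumes f: "bessel f" and g: "bessel g" and a: "\<forall>n. cmod (a n) \<le> K"
  shows "weighted_op a f g \<in> bounded_ops"
proof (rule bounded_opsI[of _ K])
  note s = weighted_op_sums[OF f g a]
  show "weighted_op a f g (x + y) = weighted_op a f g x + weighted_op a f g y" for x y
    using sums_unique2[OF s[of "x + y"]] sums_add[OF s[of x] s[of y]]
    by (simp add: cinner_add_left distrib_left scaleC_add_left)
  show "weighted_op a f g (c *\<^sub>C x) = c *\<^sub>C weighted_op a f g x" for c x
    using sums_unique2[OF s[of "c *\<^sub>C x"]] bounded_linear.sums[OF scaleC.bounded_linear_right s[of x], of c]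
    by (simp add: cinner_scaleC_left scaleC_scaleC mult.left_commute)
  show "norm (weighted_op a f g x) \<le> K * norm x" for x
    by (rule weighted_op_norm_le[OF f g a])
qed

lemma cinner_weighted_op_sums:
  assumes f: "bessel f" and g: "bessel g" and a: "\<forall>n. cmod (a n) \<le> K"
  shows "(\<lambda>n. a n * cinner x (f n) * cinner (g n) y) sums cinner (weighted_op a f g x) y"
  using bounded_linear.sums[OF cinner.bounded_linear_left weighted_op_sums[OF f g a], of x y]
  by (simp add: cinner_scaleC_left)

lemma weighted_op_adjoint:
  assumes f: "bessel f" and g: "bessel g" and a: "\<forall>n. cmod (a n) \<le> K"
  shows "cinner (weighted_op a f g x) y = cinner x (weighted_op (\<lambda>n. cnj (a n)) g f y)"
proof -
  have "(\<lambda>n. cnj (cnj (a n) * cinner y (g n) * cinner (f n) x))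
      sums cnj (cinner (weighted_op (\<lambda>n. cnj (a n)) g f y) x)"
    by (intro bounded_linear.sums[OF bounded_linear_cnj] cinner_weighted_op_sums[OF g f, of _ K])
      (simp add: a)
  then have "(\<lambda>n. a n * cinner x (f n) * cinner (g n) y)
      sums cinner x (weighted_op (\<lambda>n. cnj (a n)) g f y)"
    unfolding cinner_commute[of x "weighted_op _ _ _ _"]
    by (simp add: cinner_commute[symmetric] ac_simps)
  then show ?thesis
    using sums_unique2[OF cinner_weighted_op_sums[OF f g a]] by blast
qed

section \<open>Orthonormal families\<close>

text \<open>Zero vectors are admitted, so that the singular value decomposition of an operator of finite
  rank needs no special treatment.\<close>

definition orthonormal_or_zero :: "('i \<Rightarrow> 'a::complex_hilbert_space) \<Rightarrow> bool" where
  "orthonormal_or_zero f \<longleftrightarrow>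
     (\<forall>m n. m \<noteq> n \<longrightarrow> cinner (f m) (f n) = 0) \<and> (\<forall>n. f n = 0 \<or> norm (f n) = 1)"

lemma orthonormal_or_zeroD:
  assumes "orthonormal_or_zero f"
  shows "m \<noteq> n \<Longrightarrow> cinner (f m) (f n) = 0" "cinner (f n) (f n) *\<^sub>C f n = f n"
    "cinner (f n) (f n) * cinner x (f n) = cinner x (f n)"
    "cinner (f n) (f n) * cinner (f n) x = cinner (f n) x"
proof -
  show "m \<noteq> n \<Longrightarrow> cinner (f m) (f n) = 0" using assms by (simp add: orthonormal_or_zero_def)
  have "f n = 0 \<or> cinner (f n) (f n) = 1"
    using assms by (auto simp: orthonormal_or_zero_def norm_sq_cinner)
  then show "cinner (f n) (f n) *\<^sub>C f n = f n"
    "cinner (f n) (f n) * cinner x (f n) = cinner x (f n)"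
    "cinner (f n) (f n) * cinner (f n) x = cinner (f n) x"
    by (auto simp: cinner.zero_left cinner.zero_right scaleC.zero_left)
qed

lemma orthonormal_pythagoras:
  assumes f: "orthonormal_or_zero f" and F: "finite F"
  shows "(norm (x - (\<Sum>n\<in>F. cinner x (f n) *\<^sub>C f n)))\<^sup>2
    = (norm x)\<^sup>2 - (\<Sum>n\<in>F. (cmod (cinner x (f n)))\<^sup>2)"
proof -
  define y where "y = (\<Sum>n\<in>F. cinner x (f n) *\<^sub>C f n)"
  define S where "S = (\<Sum>n\<in>F. (cmod (cinner x (f n)))\<^sup>2)"
  have xy: "cinner x y = complex_of_real S"
    unfolding y_def S_def of_real_sum complex_norm_square
    by (simp add: cinner.sum_right cinner_scaleC_right mult.commute)
  have yf: "cinner y (f n) = cinner x (f n)" if "n \<in> F" for n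
  proof -
    have "cinner y (f n) = (\<Sum>m\<in>F. if m = n then cinner x (f n) else 0)"
      unfolding y_def cinner.sum_left cinner_scaleC_left
      using orthonormal_or_zeroD[OF f] by (intro sum.cong) (auto simp: mult.commute)
    then show ?thesis using that F by simp
  qed
  have yy: "cinner y y = complex_of_real S"
    unfolding S_def of_real_sum complex_norm_square
    by (subst (2) y_def) (simp add: cinner.sum_right cinner_scaleC_right yf mult.commute)
  have "cinner (x - y) (x - y) = complex_of_real ((norm x)\<^sup>2 - S)"
    using cinner_commute[of y x]
    by (simp add: cinner.diff_left cinner.diff_right xy yy norm_sq_cinner[of x])
  then show ?thesis unfolding norm_sq_cinner y_def[symmetric] S_def[symmetric]
    using of_real_eq_iff by blast
qed

lemma orthonormal_sum_bessel:
  assumes f: "orthonormal_or_zero f" and F: "finite F"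
  shows "(\<Sum>n\<in>F. (cmod (cinner x (f n)))\<^sup>2) \<le> (norm x)\<^sup>2"
  using orthonormal_pythagoras[OF f F, of x]
    zero_le_power2[of "norm (x - (\<Sum>n\<in>F. cinner x (f n) *\<^sub>C f n))"] by linarith

lemma orthonormal_bessel: "orthonormal_or_zero f \<Longrightarrow> bessel f"
  unfolding bessel_def using orthonormal_sum_bessel by blast

lemma cinner_weighted_op:
  assumes f: "bessel f" and g: "orthonormal_or_zero g" and a: "\<forall>n. cmod (a n) \<le> K"
  shows "cinner (weighted_op a f g x) (g m) = a m * cinner x (f m) * cinner (g m) (g m)"
proof -
  have "(\<lambda>n. a n * cinner x (f n) * cinner (g n) (g m)) sums cinner (weighted_op a f g x) (g m)"
    by (rule cinner_weighted_op_sums[OF f orthonormal_bessel[OF g] a])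
  also have "(\<lambda>n. a n * cinner x (f n) * cinner (g n) (g m))
      = (\<lambda>n. if n = m then a n * cinner x (f n) * cinner (g n) (g m) else 0)"
    using orthonormal_or_zeroD(1)[OF g] by auto
  finally have s: "(\<lambda>n. if n = m then a n * cinner x (f n) * cinner (g n) (g m) else 0)
      sums cinner (weighted_op a f g x) (g m)" .
  show ?thesis
    by (rule sums_unique2[OF s sums_single[of m "\<lambda>n. a n * cinner x (f n) * cinner (g n) (g m)"]])
qed

text \<open>The factor \<open>cinner (g n) (g n)\<close> is 0 or 1: a zero vector in
  \<open>g\<close> kills its term. It disappears as soon as the weights vanish there too, as in
  \<open>svdD\<close>.\<close>

lemma weighted_op_comp:
  assumes f: "bessel f" and g: "orthonormal_or_zero g" and h: "bessel h"
    and a: "\<forall>n. cmod (a n) \<le> K"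
  shows "weighted_op b g h \<circ> weighted_op a f g = weighted_op (\<lambda>n. b n * a n * cinner (g n) (g n)) f h"
proof
  fix x
  have "(weighted_op b g h \<circ> weighted_op a f g) x
      = (\<Sum>n. (b n * cinner (weighted_op a f g x) (g n)) *\<^sub>C h n)"
    by (simp add: weighted_op_def[of b])
  also have "\<dots> = (\<Sum>n. (b n * a n * cinner (g n) (g n) * cinner x (f n)) *\<^sub>C h n)"
    by (simp add: cinner_weighted_op[OF f g a] ac_simps)
  finally show "(weighted_op b g h \<circ> weighted_op a f g) x
      = weighted_op (\<lambda>n. b n * a n * cinner (g n) (g n)) f h x"
    unfolding weighted_op_def[of "\<lambda>n. b n * a n * cinner (g n) (g n)"] .
qed

lemma weighted_op_apply:
  assumes "orthonormal_or_zero f"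
  shows "weighted_op a f g (f m) = (a m * cinner (f m) (f m)) *\<^sub>C g m"
proof -
  have "(\<lambda>n. (a n * cinner (f m) (f n)) *\<^sub>C g n) = (\<lambda>n. if n = m then (a m * cinner (f m) (f m)) *\<^sub>C g m else 0)"
    using orthonormal_or_zeroD(1)[OF assms] by auto
  then show ?thesis
    unfolding weighted_op_def
    using sums_unique[OF sums_single[of m "\<lambda>n. (a m * cinner (f m) (f m)) *\<^sub>C g m"]] by simp
qed

lemma weighted_op_diff:
  assumes f: "bessel f" and g: "bessel g" and a: "\<forall>n. cmod (a n) \<le> K" and b: "\<forall>n. cmod (b n) \<le> L"
  shows "weighted_op (\<lambda>n. a n - b n) f g x = weighted_op a f g x - weighted_op b f g x"
proof -
  have "(\<lambda>n. ((a n - b n) * cinner x (f n)) *\<^sub>C g n) sums (weighted_op a f g x - weighted_op b f g x)"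
    using sums_diff[OF weighted_op_sums[OF f g a, of x] weighted_op_sums[OF f g b, of x]]
    by (simp add: scaleC.diff_left left_diff_distrib)
  from sums_unique[OF this] show ?thesis unfolding weighted_op_def[of "\<lambda>n. a n - b n"] by simp
qed

lemma weighted_op_add:
  assumes f: "bessel f" and g: "bessel g" and a: "\<forall>n. cmod (a n) \<le> K" and b: "\<forall>n. cmod (b n) \<le> L"
  shows "weighted_op (\<lambda>n. a n + b n) f g x = weighted_op a f g x + weighted_op b f g x"
proof -
  have "(\<lambda>n. ((a n + b n) * cinner x (f n)) *\<^sub>C g n) sums (weighted_op a f g x + weighted_op b f g x)"
    using sums_add[OF weighted_op_sums[OF f g a, of x] weighted_op_sums[OF f g b, of x]]
    by (simp add: scaleC_add_left distrib_right)
  from sums_unique[OF this] show ?thesis unfolding weighted_op_def[of "\<lambda>n. a n + b n"] by simp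
qed

lemma weighted_op_finite:
  assumes "finite F" "\<And>n. n \<notin> F \<Longrightarrow> a n = 0"
  shows "weighted_op a f g x = (\<Sum>n\<in>F. (a n * cinner x (f n)) *\<^sub>C g n)"
  unfolding weighted_op_def using assms by (intro suminf_finite) auto

lemma orthonormal_basisD:
  assumes "orthonormal_basis e"
  shows "cinner (e m) (e n) = (if m = n then 1 else 0)"
    and "(\<lambda>n. cinner x (e n) *\<^sub>C e n) sums x"
    and "norm (e n) = 1" and "orthonormal_or_zero e" and "bessel e"
    and "weighted_op (\<lambda>_. 1) e e = (\<lambda>x. x)"
proof -
  show i: "cinner (e m) (e n) = (if m = n then 1 else 0)" for m n
    using assms by (simp add: orthonormal_basis_def)
  show s: "(\<lambda>n. cinner x (e n) *\<^sub>C e n) sums x" for x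
    using assms by (simp add: orthonormal_basis_def)
  show u: "norm (e n) = 1" for n
  proof -
    have "complex_of_real ((norm (e n))\<^sup>2) = complex_of_real 1"
      unfolding norm_sq_cinner[symmetric] by (simp add: i)
    then have "(norm (e n))\<^sup>2 = 1" using of_real_eq_iff by blast
    then show ?thesis by (simp add: power2_eq_1_iff) (use norm_ge_zero[of "e n"] in linarith)
  qed
  show o: "orthonormal_or_zero e" by (simp add: orthonormal_or_zero_def i u)
  show "bessel e" by (rule orthonormal_bessel[OF o])
  show "weighted_op (\<lambda>_. 1) e e = (\<lambda>x. x)"
    unfolding weighted_op_def using sums_unique[OF s] by simp
qed

section \<open>Operators determined on a basis, and adjoints\<close>

lemma bounded_ops_eqI:
  assumes "orthonormal_basis e" "A \<in> bounded_ops" "B \<in> bounded_ops" "\<And>n. A (e n) = B (e n)"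
  shows "A = B"
proof
  fix x
  have "(\<lambda>n. C (cinner x (e n) *\<^sub>C e n)) sums C x" if "C \<in> bounded_ops" for C
    by (rule bounded_linear.sums[OF bounded_opsD(1)[OF that] orthonormal_basisD(2)[OF assms(1)]])
  from this[OF assms(2)] this[OF assms(3)] show "A x = B x"
    unfolding bounded_opsD(2)[OF assms(2)] bounded_opsD(2)[OF assms(3)] assms(4)
    by (rule sums_unique2)
qed

text \<open>The sum S of squares equals \<open>cinner y (A z)\<close> for a vector z with
  \<open>norm z \<le> sqrt S\<close>, whence \<open>S \<le> K * norm y * sqrt S\<close>. The
  argument avoids the adjoint of \<open>A\<close>, whose construction rests on this lemma.\<close>

lemma bounded_image_bessel:
  fixes A :: "'a::complex_hilbert_space \<Rightarrow> 'a" and e :: "nat \<Rightarrow> 'a"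
  assumes e: "bessel e" and A: "A \<in> bounded_ops" and K: "K > 0" "\<And>x. norm (A x) \<le> K * norm x"
  shows "bessel (\<lambda>n. (1 / complex_of_real K) *\<^sub>C A (e n))"
  unfolding bessel_def
proof (intro allI impI)
  fix y :: 'a and F :: "nat set" assume F: "finite F"
  define S where "S = (\<Sum>n\<in>F. (cmod (cinner y (A (e n))))\<^sup>2)"
  define z where "z = (\<Sum>n\<in>F. cinner y (A (e n)) *\<^sub>C e n)"
  have S0: "S \<ge> 0" unfolding S_def by (simp add: sum_nonneg)
  have "(norm z)\<^sup>2 \<le> S" unfolding z_def S_def by (rule bessel_norm_sum_le[OF e F])
  then have z: "norm z \<le> sqrt S" by (rule real_le_rsqrt)
  have "complex_of_real S = cinner y (A z)"
    unfolding z_def S_def of_real_sum complex_norm_square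
    by (simp add: bounded_opsD[OF A] cinner.sum_right cinner_scaleC_right mult.commute)
  then have "S = cmod (cinner y (A z))" using S0 by (metis abs_of_nonneg norm_of_real)
  also have "\<dots> \<le> norm y * (K * norm z)"
    by (rule order_trans[OF cinner_cauchy_schwarz]) (intro mult_left_mono K(2) norm_ge_zero)
  also have "\<dots> \<le> norm y * (K * sqrt S)" using K(1) z by (intro mult_left_mono) auto
  finally have "sqrt S * sqrt S \<le> (K * norm y) * sqrt S" using S0 by (simp add: ac_simps)
  then have "sqrt S \<le> K * norm y"
    using K(1) S0 by (cases "S = 0") (simp, simp only: mult_le_cancel_right, auto)
  then have "(sqrt S)\<^sup>2 \<le> (K * norm y)\<^sup>2" using S0 by (intro power_mono) auto
  then have S: "S \<le> K\<^sup>2 * (norm y)\<^sup>2" using S0 by (simp add: power_mult_distrib)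
  have eq: "(\<Sum>n\<in>F. (cmod (cinner y ((1 / complex_of_real K) *\<^sub>C A (e n))))\<^sup>2) = S / K\<^sup>2"
    using K(1) unfolding S_def sum_divide_distrib
    by (intro sum.cong) (auto simp: cinner_scaleC_right norm_mult norm_divide power_divide)
  show "(\<Sum>n\<in>F. (cmod (cinner y ((1 / complex_of_real K) *\<^sub>C A (e n))))\<^sup>2) \<le> (norm y)\<^sup>2"
    unfolding eq using K(1) S by (simp add: pos_divide_le_eq mult.commute)
qed

text \<open>Since the rescaled images of the basis form a Bessel family, \<open>A\<close> is itself
  a \<open>weighted_op\<close> with constant weight K; exchanging its two families gives the
  adjoint.\<close>

lemma adjoint_exists:
  fixes A :: "'a::complex_hilbert_space \<Rightarrow> 'a" and e :: "nat \<Rightarrow> 'a"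
  assumes e: "orthonormal_basis e" and A: "A \<in> bounded_ops"
  shows "\<exists>B\<in>bounded_ops. \<forall>x y. cinner (A x) y = cinner x (B y)"
proof -
  obtain K where K: "K > 0" "\<And>x. norm (A x) \<le> K * norm x" using bounded_ops_bound[OF A] by blast
  define h where "h = (\<lambda>n. (1 / complex_of_real K) *\<^sub>C A (e n))"
  note be = orthonormal_basisD(5)[OF e]
  have h: "bessel h" unfolding h_def by (rule bounded_image_bessel[OF be A K])
  have K': "\<forall>n::nat. cmod (complex_of_real K) \<le> K" "\<forall>n::nat. cmod (cnj (complex_of_real K)) \<le> K"
    using K(1) by auto
  have "A = weighted_op (\<lambda>_. complex_of_real K) e h"
    using K(1) weighted_op_apply[OF orthonormal_basisD(4)[OF e], of "\<lambda>_. complex_of_real K" h]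
    by (intro bounded_ops_eqI[OF e A weighted_op_bounded[OF be h K'(1)]])
      (simp add: orthonormal_basisD(1)[OF e] h_def scaleC_scaleC)
  then have "cinner (A x) y = cinner x (weighted_op (\<lambda>_. cnj (complex_of_real K)) h e y)" for x y
    using weighted_op_adjoint[OF be h K'(1)] by simp
  then show ?thesis using weighted_op_bounded[OF h be K'(2)] by blast
qed

lemma adjoint_op_eq:
  assumes "\<And>x y. cinner (A x) y = cinner x (B y)"
  shows "adjoint_op A = B"
  unfolding adjoint_op_def
proof (rule the_equality)
  fix B' assume B': "\<forall>x y. cinner (A x) y = cinner x (B' y)"
  show "B' = B"
  proof
    fix y
    have "cinner x (B' y) = cinner x (B y)" for x using assms B' by metis
    then show "B' y = B y" by (intro cinner_ext) (metis cinner_commute)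
  qed
qed (use assms in blast)

text \<open>Gaussian elimination, one equation at a time, the new one being solved for the unknown
  at a pivot \<open>p\<close>. This is the dimension count behind \<open>codim_bound_ge\<close>: the
  span of more than n orthonormal vectors meets every subspace cut out by n conditions.\<close>

lemma homogeneous_system_solution:
  fixes A :: "'j \<Rightarrow> 'i \<Rightarrow> 'f::field"
  assumes "finite J" "finite T" "card J < card T"
  shows "\<exists>a. (\<exists>i\<in>T. a i \<noteq> 0) \<and> (\<forall>j\<in>J. (\<Sum>i\<in>T. a i * A j i) = 0)"
  using assms
proof (induction J arbitrary: T A rule: finite_induct)
  case empty
  then have "T \<noteq> {}" by auto
  then show ?case by (auto intro!: exI[of _ "\<lambda>_. 1"])
next
  case (insert k J)
  show ?case
  proof (cases "\<forall>i\<in>T. A k i = 0")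
    case True
    then show ?thesis using insert.IH[of T A] insert.prems insert.hyps by auto
  next
    case False
    then obtain p where p: "p \<in> T" "A k p \<noteq> 0" by blast
    have T': "finite (T - {p})" "card J < card (T - {p})"
      using insert.prems insert.hyps p by auto
    obtain a where a: "\<exists>i\<in>T - {p}. a i \<noteq> 0"
      "\<And>j. j \<in> J \<Longrightarrow> (\<Sum>i\<in>T - {p}. a i * (A j i - A j p * A k i / A k p)) = 0"
      using insert.IH[OF T', of "\<lambda>j i. A j i - A j p * A k i / A k p"] by blast
    define S where "S = (\<Sum>i\<in>T - {p}. a i * A k i)"
    define b where "b = a(p := - S / A k p)"
    have b: "(\<Sum>i\<in>T. b i * A j i) = - S / A k p * A j p + (\<Sum>i\<in>T - {p}. a i * A j i)" for j
    proof -
      have "(\<Sum>i\<in>T - {p}. b i * A j i) = (\<Sum>i\<in>T - {p}. a i * A j i)"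
        by (intro sum.cong) (auto simp: b_def)
      then show ?thesis using sum.remove[OF insert.prems(1) p(1), of "\<lambda>i. b i * A j i"]
        by (simp add: b_def)
    qed
    have "(\<Sum>i\<in>T. b i * A j i) = 0" if "j \<in> insert k J" for j
    proof (cases "j = k")
      case True
      then show ?thesis unfolding b using p(2) by (simp add: S_def)
    next
      case False
      then have "(\<Sum>i\<in>T - {p}. a i * (A j i - A j p * A k i / A k p)) = 0" using that a(2) by blast
      then have "(\<Sum>i\<in>T - {p}. a i * A j i) - A j p / A k p * S = 0"
        by (simp add: S_def sum_distrib_left algebra_simps sum_subtractf)
      then show ?thesis unfolding b by (simp add: algebra_simps)
    qed
    moreover have "\<exists>i\<in>T. b i \<noteq> 0" using a(1) by (auto simp: b_def)
    ultimately show ?thesis by blast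
  qed
qed

lemma norm_sum_orthogonal:
  fixes v :: "'i \<Rightarrow> 'a::complex_hilbert_space"
  assumes "finite T" "\<And>i j. i \<in> T \<Longrightarrow> j \<in> T \<Longrightarrow> i \<noteq> j \<Longrightarrow> cinner (v i) (v j) = 0"
  shows "(norm (\<Sum>i\<in>T. v i))\<^sup>2 = (\<Sum>i\<in>T. (norm (v i))\<^sup>2)"
  using assms
proof (induction T rule: finite_induct)
  case (insert k T)
  have "cinner (v k) (\<Sum>i\<in>T. v i) = 0"
    unfolding cinner.sum_right using insert.hyps(2) by (intro sum.neutral ballI insert.prems) auto
  then show ?case using insert by (simp add: norm_add_sq)
qed simp

lemma cinner_residual:
  assumes f: "orthonormal_or_zero f" and F: "finite F" "n \<in> F"
  shows "cinner (x - (\<Sum>m\<in>F. cinner x (f m) *\<^sub>C f m)) (f n) = 0"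
proof -
  have "cinner (\<Sum>m\<in>F. cinner x (f m) *\<^sub>C f m) (f n) = (\<Sum>m\<in>F. if m = n then cinner x (f n) else 0)"
    unfolding cinner.sum_left cinner_scaleC_left
    using orthonormal_or_zeroD[OF f] by (intro sum.cong) (auto simp: mult.commute)
  then show ?thesis using F by (simp add: cinner.diff_left)
qed

section \<open>Compact operators\<close>

text \<open>For a compact operator \<open>X\<close> the least \<open>c \<ge> 0\<close> with \<open>codim_bound X n c\<close> is the singular number
  of index \<open>n\<close>.\<close>

definition codim_bound :: "('a::complex_hilbert_space \<Rightarrow> 'a) \<Rightarrow> nat \<Rightarrow> real \<Rightarrow> bool" where
  "codim_bound X n c \<longleftrightarrow>
     (\<exists>V. finite V \<and> card V \<le> n \<and> (\<forall>x. (\<forall>v\<in>V. cinner x v = 0) \<longrightarrow> norm (X x) \<le> c * norm x))"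

text \<open>Smallness on subspaces of finite codimension is equivalent to compactness and compares
  directly with singular numbers; \<open>compact_op_totally_bounded\<close> gives the topological
  form.\<close>

definition compact_op :: "('a::complex_hilbert_space \<Rightarrow> 'a) \<Rightarrow> bool" where
  "compact_op X \<longleftrightarrow> X \<in> bounded_ops \<and> (\<forall>c>0. \<exists>n. codim_bound X n c)"

text \<open>Half of the minimax principle: some nonzero combination of the \<open>f i\<close> is
  orthogonal to all of V, and there \<open>X\<close> expands by at least t, because both the
  \<open>f i\<close> and their images are orthogonal.\<close>

lemma codim_bound_ge:
  assumes X: "X \<in> bounded_ops" "codim_bound X n c"
    and T: "finite T" "n < card T"
    and f: "\<And>i j. i \<in> T \<Longrightarrow> j \<in> T \<Longrightarrow> i \<noteq> j \<Longrightarrow> cinner (f i) (f j) = 0"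
      "\<And>i. i \<in> T \<Longrightarrow> norm (f i) = 1"
    and Xf: "\<And>i j. i \<in> T \<Longrightarrow> j \<in> T \<Longrightarrow> i \<noteq> j \<Longrightarrow> cinner (X (f i)) (X (f j)) = 0"
      "\<And>i. i \<in> T \<Longrightarrow> t \<le> norm (X (f i))"
    and t: "0 \<le> t"
  shows "t \<le> c"
proof -
  obtain V where V: "finite V" "card V \<le> n"
    "\<And>x. (\<And>v. v \<in> V \<Longrightarrow> cinner x v = 0) \<Longrightarrow> norm (X x) \<le> c * norm x"
    using X(2) unfolding codim_bound_def by blast
  obtain a where a: "\<exists>i\<in>T. a i \<noteq> 0" "\<And>v. v \<in> V \<Longrightarrow> (\<Sum>i\<in>T. a i * cinner (f i) v) = 0"
    using homogeneous_system_solution[OF V(1) T(1), of "\<lambda>v i. cinner (f i) v"] V(2) T(2) by fastforce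
  define x where "x = (\<Sum>i\<in>T. a i *\<^sub>C f i)"
  have nx: "(norm x)\<^sup>2 = (\<Sum>i\<in>T. (cmod (a i))\<^sup>2)"
    unfolding x_def
    by (subst norm_sum_orthogonal[OF T(1)])
      (auto simp: cinner_scaleC_left cinner_scaleC_right norm_scaleC f intro!: sum.cong)
  have "(t * norm x)\<^sup>2 = (\<Sum>i\<in>T. (cmod (a i) * t)\<^sup>2)"
    by (simp add: power_mult_distrib nx sum_distrib_left mult.commute)
  also have "\<dots> \<le> (\<Sum>i\<in>T. (norm (a i *\<^sub>C X (f i)))\<^sup>2)"
    using t by (intro sum_mono power_mono) (auto simp: norm_scaleC intro!: mult_left_mono Xf(2))
  also have "\<dots> = (norm (X x))\<^sup>2"
    unfolding x_def bounded_opsD[OF X(1)]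
    by (subst norm_sum_orthogonal[OF T(1)])
      (auto simp: cinner_scaleC_left cinner_scaleC_right Xf)
  finally have "t * norm x \<le> norm (X x)" by (rule power2_le_imp_le) simp
  also have "\<dots> \<le> c * norm x"
    by (rule V(3)) (simp add: x_def cinner.sum_left cinner_scaleC_left a(2))
  finally have "t * norm x \<le> c * norm x" .
  moreover have "norm x > 0"
  proof -
    obtain i where i: "i \<in> T" "a i \<noteq> 0" using a(1) by blast
    then have "0 < (cmod (a i))\<^sup>2" by simp
    also have "\<dots> \<le> (norm x)\<^sup>2" unfolding nx using T(1) i by (intro member_le_sum) auto
    finally show ?thesis by simp
  qed
  ultimately show ?thesis by simp
qed

lemma proper_idealD:
  assumes "proper_ideal I"
  shows "X \<in> I \<Longrightarrow> X \<in> bounded_ops" "(\<lambda>x. 0) \<in> I"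
    "A \<in> I \<Longrightarrow> B \<in> I \<Longrightarrow> (\<lambda>x. A x + B x) \<in> I"
    "A \<in> I \<Longrightarrow> B \<in> bounded_ops \<Longrightarrow> A \<circ> B \<in> I"
    "A \<in> I \<Longrightarrow> B \<in> bounded_ops \<Longrightarrow> B \<circ> A \<in> I"
    "(\<lambda>x. x) \<notin> I"
proof -
  note I = assms[unfolded proper_ideal_def]
  show "X \<in> I \<Longrightarrow> X \<in> bounded_ops" "(\<lambda>x. 0) \<in> I"
    "A \<in> I \<Longrightarrow> B \<in> I \<Longrightarrow> (\<lambda>x. A x + B x) \<in> I"
    "A \<in> I \<Longrightarrow> B \<in> bounded_ops \<Longrightarrow> B \<circ> A \<in> I"
    using I by blast+
  show ab: "A \<in> I \<Longrightarrow> B \<in> bounded_ops \<Longrightarrow> A \<circ> B \<in> I" for A B using I by blast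
  show "(\<lambda>x. x) \<notin> I"
  proof
    assume "(\<lambda>x. x) \<in> I"
    from ab[OF this] have "B \<in> I" if "B \<in> bounded_ops" for B using that by (simp add: o_def)
    then show False using I by blast
  qed
qed

text \<open>Builds sequences whose n-th term must be orthogonal to, or extremal against, all earlier
  terms. The first hypothesis hides the values of \<open>f\<close> from n on, so that well-founded
  recursion applies.\<close>

lemma nat_history_choice:
  fixes P :: "(nat \<Rightarrow> 'b) \<Rightarrow> nat \<Rightarrow> 'b \<Rightarrow> bool"
  assumes "\<And>f g n r. (\<And>i. i < n \<Longrightarrow> f i = g i) \<Longrightarrow> P f n r = P g n r"
    and "\<And>f n. \<exists>r. P f n r"
  shows "\<exists>f. \<forall>n. P f n (f n)"
proof (rule dependent_wf_choice[of "{(x, y). x < y}" P])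
  fix f g :: "nat \<Rightarrow> 'b" and n r
  assume "\<And>i. (i, n) \<in> {(x, y). x < y} \<Longrightarrow> f i = g i"
  then show "P f n r = P g n r" by (intro assms(1)) simp
qed (rule wf_less, rule assms(2))

text \<open>A non-compact operator is bounded below along some orthonormal sequence with orthogonal
  images, so that the identity factors through it.\<close>

lemma proper_ideal_compact:
  fixes e :: "nat \<Rightarrow> 'a::complex_hilbert_space" and I :: "('a \<Rightarrow> 'a) set"
  assumes e: "orthonormal_basis e" and I: "proper_ideal I" and X: "X \<in> I"
  shows "compact_op X"
proof (rule ccontr)
  have Xb: "X \<in> bounded_ops" using proper_idealD(1)[OF I X] .
  assume "\<not> compact_op X"
  then obtain c where c: "c > 0" "\<And>n. \<not> codim_bound X n c"
    using Xb unfolding compact_op_def by blast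
  obtain B where B: "\<forall>x y. cinner (X x) y = cinner x (B y)" using adjoint_exists[OF e Xb] by blast
  have ex: "\<exists>x. norm x = 1 \<and> (\<forall>v\<in>V. cinner x v = 0) \<and> c \<le> norm (X x)" if V: "finite V" for V
  proof -
    obtain x where x: "\<forall>v\<in>V. cinner x v = 0" "\<not> norm (X x) \<le> c * norm x"
      using c(2)[of "card V"] V unfolding codim_bound_def by blast
    have x0: "norm x > 0" using x(2) bounded_opsD(5)[OF Xb] by auto
    define y where "y = (1 / complex_of_real (norm x)) *\<^sub>C x"
    have "norm y = 1" using x0 by (simp add: y_def norm_scaleC norm_divide)
    moreover have "\<forall>v\<in>V. cinner y v = 0" using x(1) by (simp add: y_def cinner_scaleC_left)
    moreover have "norm (X y) = norm (X x) / norm x"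
      using x0 by (simp add: y_def bounded_opsD[OF Xb] norm_scaleC norm_divide)
    then have "c \<le> norm (X y)" using x(2) x0 by (simp add: pos_le_divide_eq)
    ultimately show ?thesis by blast
  qed
  \<comment> \<open>As \<open>B\<close> is the adjoint of \<open>X\<close>, orthogonality to
    \<open>B (X (f i))\<close> is what makes the images \<open>X (f n)\<close> orthogonal to each
    other.\<close>
  define P where "P = (\<lambda>(f :: nat \<Rightarrow> 'a) (n :: nat) x. norm x = 1 \<and> (\<forall>v\<in>(\<Union>i<n. {f i, B (X (f i))}). cinner x v = 0)
      \<and> c \<le> norm (X x))"
  have "\<exists>f. \<forall>n. P f n (f n)"
  proof (rule nat_history_choice)
    show "\<exists>r. P f n r" for f n unfolding P_def by (rule ex) simp
  qed (auto simp: P_def)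
  then obtain f where Pf: "\<And>n. P f n (f n)" by blast
  have f: "norm (f n) = 1" "c \<le> norm (X (f n))" for n using Pf[of n] by (simp_all add: P_def)
  have fi: "cinner (f n) (f i) = 0" "cinner (f n) (B (X (f i))) = 0" if "i < n" for i n
    using Pf[of n] that by (auto simp: P_def)
  have fo: "orthonormal_or_zero f"
    unfolding orthonormal_or_zero_def using f(1) fi(1) by (metis cinner_eq_zero_commute nat_neq_iff)
  have Xf0: "norm (X (f n)) > 0" for n using f(2)[of n] c(1) by linarith
  define r where "r = (\<lambda>n. 1 / complex_of_real (norm (X (f n))))"
  define g where "g = (\<lambda>n. r n *\<^sub>C X (f n))"
  have "cinner (X (f m)) (X (f n)) = 0" if "m \<noteq> n" for m n
    using fi(2)[of m n] fi(2)[of n m] that B cinner_eq_zero_commute by (metis nat_neq_iff)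
  then have go: "orthonormal_or_zero g"
    unfolding orthonormal_or_zero_def
    by (auto simp: g_def r_def cinner_scaleC_left cinner_scaleC_right norm_scaleC norm_divide)
  have g1: "cinner (g n) (g n) = 1" for n
    using Xf0[of n] by (simp add: norm_sq_cinner g_def r_def norm_scaleC norm_divide)
  \<comment> \<open>The lower bound \<open>c\<close> keeps the inverse weights bounded; hence
    \<open>A\<close>, which sends each \<open>X (f n)\<close> to \<open>e n\<close>, is a bounded
    operator.\<close>
  have rb: "\<forall>n. cmod (r n) \<le> 1 / c"
    using f(2) c(1) by (auto simp: r_def norm_divide intro!: divide_left_mono mult_pos_pos Xf0)
  note be = orthonormal_basisD(4,5)[OF e]
  define V where "V = weighted_op (\<lambda>_. 1) e f"
  define A where "A = weighted_op r g e"
  have Vb: "V \<in> bounded_ops"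
    unfolding V_def by (rule weighted_op_bounded[OF be(2) orthonormal_bessel[OF fo], of _ 1]) simp
  have Ab: "A \<in> bounded_ops"
    unfolding A_def by (rule weighted_op_bounded[OF orthonormal_bessel[OF go] be(2) rb])
  have "A \<circ> (X \<circ> V) = (\<lambda>x. x)"
  proof (rule bounded_ops_eqI[OF e])
    fix n
    have "V (e n) = f n"
      unfolding V_def by (simp add: weighted_op_apply[OF be(1)] orthonormal_basisD(1)[OF e])
    moreover have "X (f n) = complex_of_real (norm (X (f n))) *\<^sub>C g n"
      using Xf0[of n] by (simp add: g_def r_def scaleC_scaleC)
    moreover have "A (g n) = r n *\<^sub>C e n"
      unfolding A_def by (simp add: weighted_op_apply[OF go] g1)
    ultimately have "A (X (V (e n))) = complex_of_real (norm (X (f n))) *\<^sub>C r n *\<^sub>C e n"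
      by (metis bounded_opsD(2)[OF Ab])
    then show "(A \<circ> (X \<circ> V)) (e n) = e n" using Xf0[of n] by (simp add: r_def scaleC_scaleC)
  qed (intro bounded_ops_comp Ab Xb Vb bounded_ops_id)+
  then have "(\<lambda>x. x) \<in> I" using proper_idealD(5)[OF I proper_idealD(4)[OF I X Vb] Ab] by simp
  then show False using proper_idealD(6)[OF I] by blast
qed

text \<open>Gram--Schmidt. A vector already in the span leaves the residual 0, whose normalization
  is 0 by division by zero; \<open>orthonormal_or_zero\<close> admits it, so linear dependence does
  no harm.\<close>

lemma orthonormal_system_spanning:
  assumes "finite V"
  shows "\<exists>(f :: nat \<Rightarrow> 'a::complex_hilbert_space) n. orthonormal_or_zero f \<and>
    (\<forall>x. (\<forall>i<n. cinner x (f i) = 0) \<longrightarrow> (\<forall>v\<in>V. cinner x v = 0)) \<and> (\<forall>i\<ge>n. f i = 0)"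
  using assms
proof (induction V rule: finite_induct)
  case empty
  then show ?case
    by (intro exI[of _ "\<lambda>_. 0"] exI[of _ 0]) (simp add: orthonormal_or_zero_def cinner.zero_left)
next
  case (insert v V)
  then obtain f :: "nat \<Rightarrow> 'a" and n where f: "orthonormal_or_zero f"
    "\<forall>x. (\<forall>i<n. cinner x (f i) = 0) \<longrightarrow> (\<forall>v\<in>V. cinner x v = 0)" "\<forall>i\<ge>n. f i = 0"
    by blast
  define p where "p = (\<Sum>i<n. cinner v (f i) *\<^sub>C f i)"
  define w where "w = v - p"
  define u where "u = (1 / complex_of_real (norm w)) *\<^sub>C w"
  define g where "g = f(n := u)"
  have wu: "w = complex_of_real (norm w) *\<^sub>C u"
    by (cases "w = 0") (simp_all add: u_def scaleC_scaleC scaleC.zero_right)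
  have "cinner w (f i) = 0" for i
  proof (cases "i < n")
    case True
    then show ?thesis unfolding w_def p_def by (intro cinner_residual[OF f(1)]) auto
  next
    case False
    then show ?thesis using f(3) by (simp add: cinner.zero_right)
  qed
  then have uf: "cinner u (f i) = 0" "cinner (f i) u = 0" for i
    using cinner_eq_zero_commute[of u "f i"] by (simp_all add: u_def cinner_scaleC_left)
  have "u = 0 \<or> norm u = 1"
    by (cases "w = 0") (simp_all add: u_def norm_scaleC norm_divide scaleC.zero_right)
  then have "orthonormal_or_zero g"
    using f(1) uf unfolding orthonormal_or_zero_def g_def by auto
  moreover have "\<forall>v\<in>insert v V. cinner x v = 0" if x: "\<forall>i<Suc n. cinner x (g i) = 0" for x
  proof -
    have xf: "cinner x (f i) = 0" if "i < n" for i using x[rule_format, of i] that by (simp add: g_def)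
    have "cinner x u = 0" using x[rule_format, of n] by (simp add: g_def)
    then have "cinner x w = 0" by (subst wu) (simp add: cinner_scaleC_right)
    moreover have "cinner x p = 0"
      unfolding p_def by (simp add: cinner.sum_right cinner_scaleC_right xf)
    ultimately have "cinner x v = 0" unfolding w_def by (simp add: cinner.diff_right)
    then show ?thesis using xf f(2) by blast
  qed
  moreover have "\<forall>i\<ge>Suc n. g i = 0" using f(3) by (simp add: g_def)
  ultimately show ?case by blast
qed

text \<open>The compact set is a continuous image of a product of closed discs, built one disc at a
  time; it takes care of the finite-rank part in \<open>compact_op_totally_bounded\<close>.\<close>

lemma bounded_combinations_in_compact:
  fixes u :: "nat \<Rightarrow> 'a::complex_hilbert_space"
  shows "\<exists>K. compact K \<and> (\<forall>a. (\<forall>i<n. cmod (a i) \<le> 1) \<longrightarrow> (\<Sum>i<n. a i *\<^sub>C u i) \<in> K)"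
proof (induction n)
  case 0
  then show ?case by (intro exI[of _ "{0}"]) simp
next
  case (Suc n)
  then obtain K where K: "compact K" "\<And>a. (\<And>i. i < n \<Longrightarrow> cmod (a i) \<le> 1) \<Longrightarrow> (\<Sum>i<n. a i *\<^sub>C u i) \<in> K"
    by blast
  define L where "L = (\<lambda>(k, b). k + b *\<^sub>C u n) ` (K \<times> cball (0::complex) 1)"
  have "compact L"
    unfolding L_def case_prod_unfold
    by (intro compact_continuous_image continuous_intros compact_Times K compact_cball
        bounded_linear.continuous_on[OF scaleC.bounded_linear_left])
  moreover have "(\<Sum>i<Suc n. a i *\<^sub>C u i) \<in> L" if a: "\<forall>i<Suc n. cmod (a i) \<le> 1" for a
  proof -
    have "((\<Sum>i<n. a i *\<^sub>C u i), a n) \<in> K \<times> cball 0 1" using a by (auto intro!: K(2))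
    then show ?thesis unfolding L_def by force
  qed
  ultimately show ?case by blast
qed

text \<open>Split x into its projection p on a finite orthonormal system and the rest:
  \<open>X p\<close> stays in a compact set, which has a finite net of radius r / 3, and
  \<open>X (x - p)\<close> has norm at most r / 3.\<close>

lemma compact_op_totally_bounded:
  fixes X :: "'a::complex_hilbert_space \<Rightarrow> 'a"
  assumes X: "compact_op X" and r: "r > 0"
  shows "\<exists>F. finite F \<and> X ` cball 0 1 \<subseteq> (\<Union>y\<in>F. ball y r)"
proof -
  have Xb: "X \<in> bounded_ops" using X by (simp add: compact_op_def)
  obtain n where "codim_bound X n (r / 3)" using X r unfolding compact_op_def by (meson zero_less_divide_iff zero_less_numeral)
  then obtain V where V: "finite V" "\<And>x. (\<forall>v\<in>V. cinner x v = 0) \<Longrightarrow> norm (X x) \<le> r / 3 * norm x"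
    unfolding codim_bound_def by blast
  obtain f :: "nat \<Rightarrow> 'a" and m where f: "orthonormal_or_zero f"
    "\<And>x. (\<forall>i<m. cinner x (f i) = 0) \<Longrightarrow> (\<forall>v\<in>V. cinner x v = 0)"
    using orthonormal_system_spanning[OF V(1)] by blast
  obtain K where K: "compact K"
    "\<And>a. (\<forall>i<m. cmod (a i) \<le> 1) \<Longrightarrow> (\<Sum>i<m. a i *\<^sub>C X (f i)) \<in> K"
    using bounded_combinations_in_compact[of m "\<lambda>i. X (f i)"] by blast
  have "\<forall>e>0. \<exists>F. finite F \<and> K \<subseteq> (\<Union>y\<in>F. ball y e)"
    using K(1) unfolding compact_eq_totally_bounded by blast
  then obtain F where F: "finite F" "K \<subseteq> (\<Union>y\<in>F. ball y (r / 3))" using r by (meson zero_less_divide_iff zero_less_numeral)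
  have "X x \<in> (\<Union>y\<in>F. ball y r)" if "norm x \<le> 1" for x
  proof -
    define p where "p = (\<Sum>i<m. cinner x (f i) *\<^sub>C f i)"
    have "cmod (cinner x (f i)) \<le> 1" for i
      using mult_mono[OF that bessel_norm_le[OF orthonormal_bessel[OF f(1)], of i]]
        cinner_cauchy_schwarz[of x "f i"] by (auto intro: order_trans)
    then have "X p \<in> K" using K(2) by (simp add: p_def bounded_opsD[OF Xb])
    then obtain y where y: "y \<in> F" "dist y (X p) < r / 3" using F(2) by auto
    have "(norm (x - p))\<^sup>2 \<le> (norm x)\<^sup>2"
      unfolding p_def using orthonormal_pythagoras[OF f(1), of "{..<m}" x]
      by (simp add: sum_nonneg)
    then have "norm (x - p) \<le> 1" using that power2_le_imp_le[of "norm (x - p)" "norm x"] by simp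
    moreover have "\<forall>i<m. cinner (x - p) (f i) = 0"
      unfolding p_def using cinner_residual[OF f(1)] by auto
    then have "norm (X (x - p)) \<le> r / 3 * norm (x - p)" by (intro V(2) f(2))
    ultimately have "norm (X (x - p)) \<le> r / 3"
      using r mult_left_mono[of "norm (x - p)" 1 "r / 3"] by linarith
    then have "dist (X p) (X x) \<le> r / 3"
      by (simp add: dist_norm bounded_opsD[OF Xb] norm_minus_commute)
    then have "dist y (X x) < r" using y(2) dist_triangle[of y "X x" "X p"] r by linarith
    then show ?thesis using y(1) by auto
  qed
  then show ?thesis using F(1) by (intro exI[of _ F]) auto
qed

lemma compact_op_subsequence:
  fixes X :: "'a::complex_hilbert_space \<Rightarrow> 'a" and x :: "nat \<Rightarrow> 'a"
  assumes X: "compact_op X" and x: "\<And>n. norm (x n) \<le> 1"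
  shows "\<exists>r y. strict_mono (r :: nat \<Rightarrow> nat) \<and> (\<lambda>n. X (x (r n))) \<longlonglongrightarrow> y"
proof -
  define S where "S = closure (X ` cball 0 1)"
  have "complete S" unfolding S_def by (simp add: complete_eq_closed)
  moreover have "\<exists>F. finite F \<and> S \<subseteq> (\<Union>y\<in>F. ball y e)" if e: "e > 0" for e
  proof -
    obtain F where F: "finite F" "X ` cball 0 1 \<subseteq> (\<Union>y\<in>F. ball y (e / 2))"
      using compact_op_totally_bounded[OF X, of "e / 2"] e by auto
    have "S \<subseteq> (\<Union>y\<in>F. cball y (e / 2))"
      unfolding S_def
    proof (rule closure_minimal)
      show "X ` cball 0 1 \<subseteq> (\<Union>y\<in>F. cball y (e / 2))"
        using F(2) by (rule order_trans) (intro UN_mono ball_subset_cball order_refl)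
      show "closed (\<Union>y\<in>F. cball y (e / 2))" using F(1) by (intro closed_UN) auto
    qed
    also have "\<dots> \<subseteq> (\<Union>y\<in>F. ball y e)" using e by auto
    finally show ?thesis using F(1) by blast
  qed
  ultimately have "compact S" unfolding compact_eq_totally_bounded by blast
  then have "seq_compact S" by (simp add: compact_eq_seq_compact_metric)
  moreover have "\<forall>n. X (x n) \<in> S"
    unfolding S_def using x by (auto intro!: subsetD[OF closure_subset])
  ultimately obtain l r where "strict_mono r" "((\<lambda>n. X (x n)) \<circ> r) \<longlonglongrightarrow> l"
    using seq_compactE[of S "\<lambda>n. X (x n)"] by metis
  then show ?thesis by (auto simp: o_def)
qed

text \<open>If the images of an almost maximizing sequence of unit vectors converge, the parallelogram
  law makes the sequence itself Cauchy.\<close>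

lemma compact_op_attains_norm:
  fixes e :: "nat \<Rightarrow> 'a::complex_hilbert_space" and X :: "'a \<Rightarrow> 'a"
  assumes e: "orthonormal_basis e" and X: "compact_op X" and V: "finite V"
  shows "\<exists>u. norm u = 1 \<and> (\<forall>v\<in>V. cinner u v = 0) \<and>
    (\<forall>x. (\<forall>v\<in>V. cinner x v = 0) \<longrightarrow> norm (X x) \<le> norm (X u) * norm x)"
proof -
  have Xb: "X \<in> bounded_ops" using X by (simp add: compact_op_def)
  note Xl = bounded_opsD(1)[OF Xb]
  define M where "M = {x. \<forall>v\<in>V. cinner x v = 0}"
  have Mscale: "c *\<^sub>C x \<in> M" if "x \<in> M" for c x using that by (simp add: M_def cinner_scaleC_left)
  have Madd: "x + y \<in> M" if "x \<in> M" "y \<in> M" for x y using that by (simp add: M_def cinner_add_left)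
  have normalize: "(1 / complex_of_real (norm x)) *\<^sub>C x \<in> M \<inter> sphere 0 1" if "x \<in> M" "x \<noteq> 0" for x
    using that by (simp add: Mscale norm_scaleC norm_divide)
  \<comment> \<open>The conditions given by V are outnumbered by \<open>card V + 1\<close> basis
    vectors, so the complement of V contains a unit vector.\<close>
  obtain u0 where u0: "u0 \<in> M" "norm u0 = 1"
  proof -
    obtain a where a: "\<exists>i\<in>{..card V}. a i \<noteq> 0"
      "\<And>v. v \<in> V \<Longrightarrow> (\<Sum>i\<le>card V. a i * cinner (e i) v) = 0"
      using homogeneous_system_solution[OF V, of "{..card V}" "\<lambda>v i. cinner (e i) v"] by auto
    define x where "x = (\<Sum>i\<le>card V. a i *\<^sub>C e i)"
    obtain i where i: "i \<le> card V" "a i \<noteq> 0" using a(1) by auto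
    have "cinner x (e i) = (\<Sum>j\<le>card V. if j = i then a i else 0)"
      unfolding x_def cinner.sum_left cinner_scaleC_left
      by (intro sum.cong) (auto simp: orthonormal_basisD(1)[OF e])
    then have "x \<noteq> 0" using i by (auto simp: cinner.zero_left)
    moreover have "x \<in> M" by (simp add: M_def x_def cinner.sum_left cinner_scaleC_left a(2))
    ultimately show ?thesis using normalize[of x] that by auto
  qed
  obtain K where K: "K > 0" "\<And>x. norm (X x) \<le> K * norm x" using bounded_ops_bound[OF Xb] by blast
  define N where "N = (\<lambda>x. norm (X x)) ` (M \<inter> sphere 0 1)"
  define S where "S = Sup N"
  have bdd: "bdd_above N" unfolding N_def by (rule bdd_aboveI2[of _ _ K]) (metis IntD2 K(2) mem_sphere_0 mult.right_neutral)
  have ne: "N \<noteq> {}" unfolding N_def using u0 by auto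
  have S: "norm (X x) \<le> S * norm x" if x: "x \<in> M" for x
  proof (cases "x = 0")
    case False
    have "norm (X ((1 / complex_of_real (norm x)) *\<^sub>C x)) \<le> S"
      unfolding S_def by (rule cSup_upper[OF _ bdd]) (use normalize[OF x False] in \<open>simp add: N_def\<close>)
    then show ?thesis using False
      by (simp add: bounded_opsD[OF Xb] norm_scaleC norm_divide pos_divide_le_eq)
  qed (simp add: bounded_opsD[OF Xb])
  have "norm (X u0) \<le> S" using S[OF u0(1)] u0(2) by simp
  then have S0: "S \<ge> 0" using norm_ge_zero order_trans by blast
  have "\<exists>u. u \<in> M \<and> norm u = 1 \<and> norm (X u) = S"
  proof (cases "S = 0")
    case True
    then show ?thesis using u0 \<open>norm (X u0) \<le> S\<close> by (metis norm_le_zero_iff norm_zero)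
  next
    case False
    then have Sp: "S > 0" using S0 by simp
    have "\<exists>x. x \<in> M \<and> norm x = 1 \<and> norm (X x) > S - 1 / real (Suc k)" for k
    proof -
      have "S - 1 / real (Suc k) < Sup N" by (simp add: S_def)
      then obtain t where "t \<in> N" "S - 1 / real (Suc k) < t" using less_cSupE[OF _ ne] by blast
      then show ?thesis by (auto simp: N_def)
    qed
    then obtain x where x: "\<And>k. x k \<in> M" "\<And>k. norm (x k) = 1"
      "\<And>k. norm (X (x k)) > S - 1 / real (Suc k)" by metis
    obtain r y where r: "strict_mono r" "(\<lambda>n. X (x (r n))) \<longlonglongrightarrow> y"
      using compact_op_subsequence[OF X, of x] x(2) by auto
    define z where "z = (\<lambda>n. x (r n))"
    have z: "z n \<in> M" "norm (z n) = 1" for n by (simp_all add: z_def x)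
    have zy: "(\<lambda>n. X (z n)) \<longlonglongrightarrow> y" using r(2) by (simp add: z_def)
    have ny: "norm y = S"
    proof (rule LIMSEQ_unique[OF tendsto_norm[OF zy]])
      show "(\<lambda>n. norm (X (z n))) \<longlonglongrightarrow> S"
      proof (rule real_tendsto_sandwich[where h = "\<lambda>_. S" and f = "\<lambda>n. S - 1 / real (Suc n)"])
        show "\<forall>\<^sub>F n in sequentially. S - 1 / real (Suc n) \<le> norm (X (z n))"
        proof (intro always_eventually allI)
          fix n
          have "1 / real (Suc (r n)) \<le> 1 / real (Suc n)"
            using seq_suble[OF r(1), of n] by (intro divide_left_mono) auto
          then show "S - 1 / real (Suc n) \<le> norm (X (z n))" using x(3)[of "r n"] by (simp add: z_def)
        qed
        show "\<forall>\<^sub>F n in sequentially. norm (X (z n)) \<le> S" using S[OF z(1)] z(2) by simp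
        show "(\<lambda>n. S - 1 / real (Suc n)) \<longlonglongrightarrow> S"
          using tendsto_diff[OF tendsto_const LIMSEQ_Suc[OF lim_1_over_n], of S] by simp
      qed simp
    qed
    have "Cauchy z"
      unfolding Cauchy_def
    proof (intro allI impI)
      fix \<epsilon> :: real assume \<epsilon>: "\<epsilon> > 0"
      \<comment> \<open>The estimate below ends in the bound 8 * S * \<delta>, so dividing by 9
        yields a strict inequality; \<delta> \<le> S keeps S - \<delta> nonnegative for
        squaring.\<close>
      define \<delta> where "\<delta> = min S (S * \<epsilon>\<^sup>2 / 9)"
      have \<delta>: "\<delta> > 0" "\<delta> \<le> S" "\<delta> \<le> S * \<epsilon>\<^sup>2 / 9" using Sp \<epsilon> by (simp_all add: \<delta>_def)
      obtain n0 where n0: "\<And>n. n \<ge> n0 \<Longrightarrow> norm (X (z n) - y) < \<delta>"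
        using LIMSEQ_D[OF zy \<delta>(1)] by blast
      have "dist (z m) (z n) < \<epsilon>" if mn: "m \<ge> n0" "n \<ge> n0" for m n
      proof -
        have "2 * S = norm ((X (z m) + X (z n)) - ((X (z m) - y) + (X (z n) - y)))"
          by (simp add: ny[symmetric] scaleR_2[symmetric])
        also have "\<dots> \<le> norm (X (z m) + X (z n)) + (norm (X (z m) - y) + norm (X (z n) - y))"
          by (rule order_trans[OF norm_triangle_ineq4]) (intro add_left_mono norm_triangle_ineq)
        also have "\<dots> \<le> norm (X (z m + z n)) + (\<delta> + \<delta>)"
          using n0[OF mn(1)] n0[OF mn(2)] by (simp add: bounded_opsD[OF Xb])
        also have "\<dots> \<le> S * norm (z m + z n) + (\<delta> + \<delta>)"
          using S[OF Madd[OF z(1) z(1)]] by simp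
        finally have "2 * (S - \<delta>) \<le> S * norm (z m + z n)" by simp
        then have "(2 * (S - \<delta>))\<^sup>2 \<le> (S * norm (z m + z n))\<^sup>2"
          using \<delta>(2) by (intro power_mono) auto
        moreover have "4 * S\<^sup>2 - 8 * S * \<delta> \<le> (2 * (S - \<delta>))\<^sup>2"
          by (simp add: power2_eq_square algebra_simps)
        ultimately have 1: "4 * S\<^sup>2 - 8 * S * \<delta> \<le> S\<^sup>2 * (norm (z m + z n))\<^sup>2"
          by (simp add: power_mult_distrib)
        have "(norm (z m + z n))\<^sup>2 + (norm (z m - z n))\<^sup>2 = 4"
          using norm_add_sq[of "z m" "z n"] norm_add_sq[of "z m" "- z n"] z(2)
          by (simp add: cinner.minus_right)
        then have "S\<^sup>2 * (norm (z m + z n))\<^sup>2 + S\<^sup>2 * (norm (z m - z n))\<^sup>2 = 4 * S\<^sup>2"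
          unfolding distrib_left[symmetric] by simp
        then have "S\<^sup>2 * (norm (z m - z n))\<^sup>2 \<le> 8 * S * \<delta>" using 1 by linarith
        also have "\<dots> \<le> 8 * S * (S * \<epsilon>\<^sup>2 / 9)" using \<delta>(3) Sp by (intro mult_left_mono) auto
        also have "\<dots> < S\<^sup>2 * \<epsilon>\<^sup>2" using Sp \<epsilon> by (simp add: power2_eq_square)
        finally have "(norm (z m - z n))\<^sup>2 < \<epsilon>\<^sup>2" using Sp by simp
        then show ?thesis
          unfolding dist_norm by (rule power2_less_imp_less) (use \<epsilon> in simp)
      qed
      then show "\<exists>M. \<forall>m\<ge>M. \<forall>n\<ge>M. dist (z m) (z n) < \<epsilon>" by blast
    qed
    then obtain u where u: "z \<longlonglongrightarrow> u" using Cauchy_convergent_iff convergent_def by blast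
    have "norm u = 1" using LIMSEQ_unique[OF tendsto_norm[OF u]] z(2) by simp
    moreover have "u \<in> M"
      unfolding M_def
    proof (intro CollectI ballI)
      fix v assume "v \<in> V"
      then have "(\<lambda>n. cinner (z n) v) = (\<lambda>_. 0)" using z(1) by (auto simp: M_def)
      then show "cinner u v = 0"
        using LIMSEQ_unique[OF bounded_linear.tendsto[OF cinner.bounded_linear_left u, of v]] by simp
    qed
    moreover have "X u = y" using LIMSEQ_unique[OF bounded_linear.tendsto[OF Xl u] zy] .
    ultimately show ?thesis using ny by blast
  qed
  then show ?thesis using S by (auto simp: M_def)
qed

section \<open>Singular value decomposition\<close>

definition svd :: "('a::complex_hilbert_space \<Rightarrow> 'a) \<Rightarrow> (nat \<Rightarrow> real) \<Rightarrow> (nat \<Rightarrow> 'a) \<Rightarrow> (nat \<Rightarrow> 'a) \<Rightarrow> bool" where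
  "svd X s f g \<longleftrightarrow> s \<in> c0_star \<and> orthonormal_or_zero f \<and> orthonormal_or_zero g \<and>
     (\<forall>n. s n > 0 \<longrightarrow> norm (f n) = 1 \<and> norm (g n) = 1) \<and>
     X = weighted_op (\<lambda>n. complex_of_real (s n)) f g"

text \<open>Each \<open>f n\<close> is a unit vector maximizing \<open>norm (X x)\<close> on the
  orthogonal complement of its predecessors. Maximality makes the images orthogonal, and by
  \<open>codim_bound_ge\<close> the maxima tend to 0, so the remainders of the series
  vanish.\<close>

lemma compact_op_svd:
  fixes e :: "nat \<Rightarrow> 'a::complex_hilbert_space" and X :: "'a \<Rightarrow> 'a"
  assumes e: "orthonormal_basis e" and X: "compact_op X"
  shows "\<exists>s f g. svd X s f g"
proof -
  have Xb: "X \<in> bounded_ops" using X by (simp add: compact_op_def)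
  define P where "P = (\<lambda>(f :: nat \<Rightarrow> 'a) (n :: nat) u. norm u = 1 \<and> (\<forall>v\<in>f ` {..<n}. cinner u v = 0)
      \<and> (\<forall>x. (\<forall>v\<in>f ` {..<n}. cinner x v = 0) \<longrightarrow> norm (X x) \<le> norm (X u) * norm x))"
  have "\<exists>f. \<forall>n. P f n (f n)"
  proof (rule nat_history_choice)
    fix f g :: "nat \<Rightarrow> 'a" and n r
    assume "\<And>i. i < n \<Longrightarrow> f i = g i"
    then have "f ` {..<n} = g ` {..<n}" by auto
    then show "P f n r = P g n r" by (simp only: P_def)
  next
    show "\<exists>r. P f n r" for f n unfolding P_def by (rule compact_op_attains_norm[OF e X]) simp
  qed
  then obtain f where Pf: "\<And>n. P f n (f n)" by blast
  have f1: "norm (f n) = 1" for n using Pf[of n] by (simp add: P_def)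
  have flt: "cinner (f n) (f i) = 0" if "i < n" for i n using Pf[of n] that by (auto simp: P_def)
  have max: "norm (X x) \<le> norm (X (f n)) * norm x" if "\<And>i. i < n \<Longrightarrow> cinner x (f i) = 0" for x n
    using Pf[of n] that by (auto simp: P_def)
  have fne: "cinner (f m) (f n) = 0" if "m \<noteq> n" for m n
    using flt that cinner_eq_zero_commute by (metis nat_neq_iff)
  have fo: "orthonormal_or_zero f" unfolding orthonormal_or_zero_def using fne f1 by blast
  define s where "s = (\<lambda>n. norm (X (f n)))"
  define g where "g = (\<lambda>n. (1 / complex_of_real (s n)) *\<^sub>C X (f n))"
  \<comment> \<open>Moving \<open>f m\<close> by a multiple \<open>z\<close> of \<open>f n\<close>
    in the direction of the inner product \<open>c\<close> would lengthen the image to first order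
    but the vector only to second order. The step t is small enough since (s m)^2 * t \<le> 1 <
    2.\<close>
  have Xlt: "cinner (X (f m)) (X (f n)) = 0" if mn: "m < n" for m n
  proof (rule ccontr)
    define c where "c = cinner (X (f m)) (X (f n))"
    assume "cinner (X (f m)) (X (f n)) \<noteq> 0"
    then have c: "(cmod c)\<^sup>2 > 0" by (simp add: c_def)
    define t where "t = 1 / ((s m)\<^sup>2 + 1)"
    have sp: "(s m)\<^sup>2 + 1 > 0" by (simp add: add_nonneg_pos)
    have t: "t > 0" using sp by (simp add: t_def)
    define z where "z = complex_of_real t * c"
    have cz: "(cmod z)\<^sup>2 = t\<^sup>2 * (cmod c)\<^sup>2" by (simp add: z_def norm_mult power_mult_distrib)
    have n1: "(norm (f m + z *\<^sub>C f n))\<^sup>2 = 1 + (cmod z)\<^sup>2"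
      by (simp add: norm_add_sq f1 cinner_scaleC_right fne[OF less_imp_neq[OF mn]] norm_scaleC)
    have "cinner (X (f m)) (X (z *\<^sub>C f n)) = complex_of_real (t * (cmod c)\<^sup>2)"
      unfolding bounded_opsD[OF Xb] cinner_scaleC_right c_def[symmetric] z_def
      by (simp only: complex_cnj_mult complex_cnj_complex_of_real of_real_mult complex_norm_square ac_simps)
    then have n2: "(norm (X (f m + z *\<^sub>C f n)))\<^sup>2 = (s m)\<^sup>2 + (norm (X (z *\<^sub>C f n)))\<^sup>2 + 2 * (t * (cmod c)\<^sup>2)"
      unfolding bounded_opsD(3)[OF Xb] norm_add_sq s_def by simp
    have "norm (X (f m + z *\<^sub>C f n)) \<le> s m * norm (f m + z *\<^sub>C f n)"
      unfolding s_def using mn by (intro max) (simp add: cinner_add_left cinner_scaleC_left flt)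
    then have "(norm (X (f m + z *\<^sub>C f n)))\<^sup>2 \<le> (s m * norm (f m + z *\<^sub>C f n))\<^sup>2"
      by (intro power_mono) auto
    also have "\<dots> = (s m)\<^sup>2 * (1 + (cmod z)\<^sup>2)" by (simp only: power_mult_distrib n1)
    finally have "(s m)\<^sup>2 + (norm (X (z *\<^sub>C f n)))\<^sup>2 + 2 * (t * (cmod c)\<^sup>2)
        \<le> (s m)\<^sup>2 + (s m)\<^sup>2 * (cmod z)\<^sup>2"
      unfolding n2 by (simp add: distrib_left)
    then have "2 * (t * (cmod c)\<^sup>2) \<le> (s m)\<^sup>2 * (cmod z)\<^sup>2"
      using zero_le_power2[of "norm (X (z *\<^sub>C f n))"] by linarith
    also have "\<dots> = ((s m)\<^sup>2 * t) * (t * (cmod c)\<^sup>2)" unfolding cz by (simp add: power2_eq_square)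
    also have "\<dots> \<le> 1 * (t * (cmod c)\<^sup>2)"
      using t by (intro mult_right_mono) (auto simp: t_def divide_le_eq_1 sp)
    finally show False using t c by simp
  qed
  then have Xne: "cinner (X (f m)) (X (f n)) = 0" if "m \<noteq> n" for m n
    using that cinner_eq_zero_commute by (metis nat_neq_iff)
  have go: "orthonormal_or_zero g"
    unfolding orthonormal_or_zero_def
    by (auto simp: g_def s_def cinner_scaleC_left cinner_scaleC_right Xne norm_scaleC norm_divide
        scaleC.zero_left)
  have sg: "complex_of_real (s n) *\<^sub>C g n = X (f n)" for n
    by (cases "s n = 0") (simp_all add: g_def scaleC_scaleC scaleC.zero_left, simp add: s_def)
  have s_dec: "decseq s"
    unfolding decseq_Suc_iff
  proof
    show "s (Suc n) \<le> s n" for n using max[of n "f (Suc n)"] flt f1 by (simp add: s_def)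
  qed
  have s0: "s n \<ge> 0" for n by (simp add: s_def)
  have sle: "s n \<le> c" if "codim_bound X n c" for n c
  proof (rule codim_bound_ge[OF Xb that, of "{..n}" f])
    show "s n \<le> norm (X (f i))" if "i \<in> {..n}" for i
      using decseqD[OF s_dec] that by (simp add: s_def)
  qed (use fne f1 Xne s0 in auto)
  have "s \<longlonglongrightarrow> 0"
  proof (rule LIMSEQ_I)
    fix r :: real assume r: "r > 0"
    obtain n where "codim_bound X n (r / 2)" using X r unfolding compact_op_def by (meson half_gt_zero)
    then have "s n \<le> r / 2" by (rule sle)
    then have "\<forall>k\<ge>n. norm (s k - 0) < r" using r s0 decseqD[OF s_dec, of n] by fastforce
    then show "\<exists>n. \<forall>k\<ge>n. norm (s k - 0) < r" by blast
  qed
  then have s: "s \<in> c0_star" using s_dec s0 by (simp add: c0_star_def)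
  have "(\<lambda>n. (complex_of_real (s n) * cinner x (f n)) *\<^sub>C g n) sums X x" for x
  proof -
    have "(\<lambda>N. X x - (\<Sum>n<N. (complex_of_real (s n) * cinner x (f n)) *\<^sub>C g n)) \<longlonglongrightarrow> 0"
    proof (rule Lim_null_comparison[of _ "\<lambda>N. s N * norm x"])
      have "norm (X x - (\<Sum>n<N. (complex_of_real (s n) * cinner x (f n)) *\<^sub>C g n)) \<le> s N * norm x" for N
      proof -
        define p where "p = (\<Sum>n<N. cinner x (f n) *\<^sub>C f n)"
        have "(\<Sum>n<N. (complex_of_real (s n) * cinner x (f n)) *\<^sub>C g n)
            = (\<Sum>n<N. cinner x (f n) *\<^sub>C complex_of_real (s n) *\<^sub>C g n)"
          by (simp add: scaleC_scaleC mult.commute)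
        then have "X x - (\<Sum>n<N. (complex_of_real (s n) * cinner x (f n)) *\<^sub>C g n) = X (x - p)"
          by (simp add: sg p_def bounded_opsD[OF Xb])
        moreover have "norm (X (x - p)) \<le> s N * norm (x - p)"
          unfolding s_def p_def using cinner_residual[OF fo] by (intro max) auto
        moreover have "(norm (x - p))\<^sup>2 \<le> (norm x)\<^sup>2"
          unfolding p_def using orthonormal_pythagoras[OF fo, of "{..<N}" x] by (simp add: sum_nonneg)
        then have "s N * norm (x - p) \<le> s N * norm x"
          by (intro mult_left_mono s0 power2_le_imp_le[OF _ norm_ge_zero])
        ultimately show ?thesis by simp
      qed
      then show "\<forall>\<^sub>F N in sequentially.
          norm (X x - (\<Sum>n<N. (complex_of_real (s n) * cinner x (f n)) *\<^sub>C g n)) \<le> s N * norm x"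
        by simp
      show "(\<lambda>N. s N * norm x) \<longlonglongrightarrow> 0" using \<open>s \<longlonglongrightarrow> 0\<close> by (rule tendsto_mult_left_zero)
    qed
    from tendsto_diff[OF tendsto_const[of "X x"] this] show ?thesis by (simp add: sums_def)
  qed
  then have "X = weighted_op (\<lambda>n. complex_of_real (s n)) f g"
    unfolding weighted_op_def using sums_unique by (intro ext) blast
  moreover have "norm (g n) = 1" if "s n > 0" for n
    using that by (simp add: g_def s_def norm_scaleC norm_divide)
  ultimately show ?thesis unfolding svd_def using s fo go f1 by blast
qed

section \<open>Null sequences and the counting of their values\<close>

lemma c0_starD:
  assumes "\<xi> \<in> c0_star"
  shows "0 \<le> \<xi> n" "m \<le> n \<Longrightarrow> \<xi> n \<le> \<xi> m" "\<xi> \<longlonglongrightarrow> 0" "\<forall>n. cmod (complex_of_real (\<xi> n)) \<le> \<xi> 0"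
    and "t > 0 \<Longrightarrow> finite {n. t \<le> \<xi> n}"
proof -
  show n: "0 \<le> \<xi> n" and l: "\<xi> \<longlonglongrightarrow> 0" for n using assms by (simp_all add: c0_star_def)
  show d: "\<xi> n \<le> \<xi> m" if "m \<le> n" for m n using assms that by (simp add: c0_star_def decseqD)
  show "\<forall>n. cmod (complex_of_real (\<xi> n)) \<le> \<xi> 0" using n d by simp
  assume "t > 0"
  then obtain N where N: "\<And>k. k \<ge> N \<Longrightarrow> norm (\<xi> k - 0) < t" using LIMSEQ_D[OF l] by blast
  have "{n. t \<le> \<xi> n} \<subseteq> {..<N}"
  proof
    fix k assume "k \<in> {n. t \<le> \<xi> n}"
    then show "k \<in> {..<N}" using N[of k] by (cases "N \<le> k") auto
  qed
  then show "finite {n. t \<le> \<xi> n}" using finite_subset by blast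
qed

text \<open>For t > 0 the indices with values at least t split into finitely many finite level sets,
  one for each value attained.\<close>

lemma c0_star_card_above:
  assumes x: "\<xi> \<in> c0_star" and y: "\<eta> \<in> c0_star" and t: "t > 0"
    and eq: "\<And>u. u > 0 \<Longrightarrow> card {n. \<xi> n = u} = card {n. \<eta> n = u}"
  shows "card {n. t \<le> \<xi> n} = card {n. t \<le> \<eta> n}"
proof -
  have fin: "finite {n. \<zeta> n = u}" if "\<zeta> \<in> c0_star" "u > 0" for \<zeta> :: "nat \<Rightarrow> real" and u
    by (rule finite_subset[OF _ c0_starD(5)[OF that]]) auto
  have count: "card {n. t \<le> \<zeta> n} = (\<Sum>u\<in>\<zeta> ` {n. t \<le> \<zeta> n}. card {n. \<zeta> n = u})"
    if z: "\<zeta> \<in> c0_star" for \<zeta> :: "nat \<Rightarrow> real"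
  proof -
    have "{n. t \<le> \<zeta> n} = (\<Union>u\<in>\<zeta> ` {n. t \<le> \<zeta> n}. {n. \<zeta> n = u})" by auto
    also have "card \<dots> = (\<Sum>u\<in>\<zeta> ` {n. t \<le> \<zeta> n}. card {n. \<zeta> n = u})"
      using t by (intro card_UN_disjoint finite_imageI c0_starD(5)[OF z t] ballI fin[OF z]) auto
    finally show ?thesis .
  qed
  have sub: "\<zeta> ` {n. t \<le> \<zeta> n} \<subseteq> \<theta> ` {n. t \<le> \<theta> n}"
    if z: "\<zeta> \<in> c0_star" and eq: "\<And>u. u > 0 \<Longrightarrow> card {n. \<zeta> n = u} = card {n. \<theta> n = u}"
    for \<zeta> \<theta> :: "nat \<Rightarrow> real"
  proof
    fix u assume u: "u \<in> \<zeta> ` {n. t \<le> \<zeta> n}"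
    then have tu: "t \<le> u" by auto
    then have "card {n. \<zeta> n = u} \<noteq> 0" using fin[OF z, of u] t u by auto
    then have "{n. \<theta> n = u} \<noteq> {}" using eq[of u] t tu by (metis card.empty order_less_le_trans)
    then show "u \<in> \<theta> ` {n. t \<le> \<theta> n}" using tu by auto
  qed
  have "\<xi> ` {n. t \<le> \<xi> n} = \<eta> ` {n. t \<le> \<eta> n}"
  proof (rule equalityI)
    show "\<xi> ` {n. t \<le> \<xi> n} \<subseteq> \<eta> ` {n. t \<le> \<eta> n}" by (rule sub[OF x]) (rule eq)
    show "\<eta> ` {n. t \<le> \<eta> n} \<subseteq> \<xi> ` {n. t \<le> \<xi> n}" by (rule sub[OF y]) (simp add: eq)
  qed
  then show ?thesis unfolding count[OF x] count[OF y]
    by (intro sum.cong) (use t in \<open>auto intro!: eq\<close>)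
qed

text \<open>A nonincreasing sequence is recovered from its counting function:
  \<open>\<xi> n \<ge> t\<close> as soon as more than n terms are at least t. This is the uniqueness
  behind \<open>singular_numbers\<close>.\<close>

lemma c0_star_eqI:
  assumes x: "\<xi> \<in> c0_star" and y: "\<eta> \<in> c0_star"
    and eq: "\<And>u. u > 0 \<Longrightarrow> card {n. \<xi> n = u} = card {n. \<eta> n = u}"
  shows "\<xi> = \<eta>"
proof -
  have le: "\<zeta> n \<le> \<theta> n" if z: "\<zeta> \<in> c0_star" and th: "\<theta> \<in> c0_star"
    and eq: "\<And>u. u > 0 \<Longrightarrow> card {n. \<zeta> n = u} = card {n. \<theta> n = u}" for \<zeta> \<theta> n
  proof (rule ccontr)
    assume n: "\<not> \<zeta> n \<le> \<theta> n"
    have t: "\<zeta> n > 0" using n c0_starD(1)[OF th, of n] by linarith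
    have "{..n} \<subseteq> {k. \<zeta> n \<le> \<zeta> k}" using c0_starD(2)[OF z] by auto
    then have "Suc n \<le> card {k. \<zeta> n \<le> \<zeta> k}" using card_mono[OF c0_starD(5)[OF z t], of "{..n}"] by simp
    also have "\<dots> = card {k. \<zeta> n \<le> \<theta> k}" by (rule c0_star_card_above[OF z th t]) (rule eq)
    also have "\<dots> \<le> card {..<n}"
    proof (rule card_mono)
      show "{k. \<zeta> n \<le> \<theta> k} \<subseteq> {..<n}"
      proof
        fix k assume "k \<in> {k. \<zeta> n \<le> \<theta> k}"
        then show "k \<in> {..<n}" using n c0_starD(2)[OF th, of n k] by (cases "n \<le> k") auto
      qed
    qed simp
    finally show False by simp
  qed
  show ?thesis
  proof (intro ext antisym)
    show "\<xi> n \<le> \<eta> n" for n by (rule le[OF x y]) (rule eq)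
    show "\<eta> n \<le> \<xi> n" for n by (rule le[OF y x]) (simp add: eq)
  qed
qed

text \<open>Polarization: the form is real at x + y and at x + \<i> y, which fixes the imaginary and
  the real part of \<open>cinner (P x) y\<close>.\<close>

lemma positive_op_selfadjoint:
  assumes "positive_op P"
  shows "cinner (P x) y = cinner x (P y)"
proof -
  have Pb: "P \<in> bounded_ops" and pos: "\<And>x. Im (cinner (P x) x) = 0"
    using assms by (auto simp: positive_op_def complex_nonneg_Reals_iff)
  have "Im (cinner (P x) y) + Im (cinner (P y) x) = 0" for x y
    using pos[of "x + y"] pos[of x] pos[of y]
    by (simp add: bounded_opsD[OF Pb] cinner_add_left cinner_add_right)
  from this[of x y] this[of x "\<i> *\<^sub>C y"] have "cinner (P x) y = cnj (cinner (P y) x)"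
    by (simp add: complex_eq_iff bounded_opsD[OF Pb] cinner_scaleC_left cinner_scaleC_right)
  then show ?thesis using cinner_commute[of x "P y"] by simp
qed

lemma svdD:
  assumes "svd X s f g"
  shows "s \<in> c0_star" "orthonormal_or_zero f" "orthonormal_or_zero g" "bessel f" "bessel g"
    "s n > 0 \<Longrightarrow> norm (f n) = 1" "s n > 0 \<Longrightarrow> norm (g n) = 1"
    "X = weighted_op (\<lambda>n. complex_of_real (s n)) f g" "X \<in> bounded_ops"
    "complex_of_real (s n) * cinner (f n) (f n) = complex_of_real (s n)"
    "complex_of_real (s n) * cinner (g n) (g n) = complex_of_real (s n)"
proof -
  show s: "s \<in> c0_star" and "orthonormal_or_zero f" "orthonormal_or_zero g"
    and X: "X = weighted_op (\<lambda>n. complex_of_real (s n)) f g"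
    and n: "s n > 0 \<Longrightarrow> norm (f n) = 1" "s n > 0 \<Longrightarrow> norm (g n) = 1" for n
    using assms by (simp_all add: svd_def)
  then show f: "bessel f" and g: "bessel g" by (simp_all add: orthonormal_bessel)
  show "X \<in> bounded_ops" unfolding X by (rule weighted_op_bounded[OF f g c0_starD(4)[OF s]])
  show "complex_of_real (s n) * cinner (f n) (f n) = complex_of_real (s n)"
    "complex_of_real (s n) * cinner (g n) (g n) = complex_of_real (s n)"
    using n[of n] c0_starD(1)[OF s, of n] by (cases "s n = 0"; simp add: norm_sq_cinner)+
qed

lemma weighted_op_positive:
  assumes f: "bessel f" and s: "\<And>n. 0 \<le> s n" "\<And>n. s n \<le> K"
  shows "positive_op (weighted_op (\<lambda>n. complex_of_real (s n)) f f)"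
proof -
  have K: "\<forall>n. cmod (complex_of_real (s n)) \<le> K" using s by simp
  have "cinner (weighted_op (\<lambda>n. complex_of_real (s n)) f f x) x \<in> \<real>\<^sub>\<ge>\<^sub>0" for x
  proof -
    have "(\<lambda>n. complex_of_real (s n) * cinner x (f n) * cinner (f n) x)
        = (\<lambda>n. complex_of_real (s n * (cmod (cinner x (f n)))\<^sup>2))"
      unfolding of_real_mult complex_norm_square by (simp add: cinner_commute[symmetric] mult.assoc)
    then have sm: "(\<lambda>n. complex_of_real (s n * (cmod (cinner x (f n)))\<^sup>2))
        sums cinner (weighted_op (\<lambda>n. complex_of_real (s n)) f f x) x"
      using cinner_weighted_op_sums[OF f f K, of x x] by simp
    have "Im (cinner (weighted_op (\<lambda>n. complex_of_real (s n)) f f x) x) = 0"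
      using sums_Im[OF sm] sums_unique2[OF sums_zero] by simp
    moreover have "0 \<le> Re (cinner (weighted_op (\<lambda>n. complex_of_real (s n)) f f x) x)"
      by (rule sums_le[OF _ sums_zero sums_Re[OF sm]]) (simp add: s)
    ultimately show ?thesis by (simp add: complex_nonneg_Reals_iff)
  qed
  then show ?thesis unfolding positive_op_def using weighted_op_bounded[OF f f K] by blast
qed

text \<open>A positive square root of \<open>adjoint_op X \<circ> X\<close> is determined on each \<open>f n\<close>, because
  \<open>P + s n\<close> is injective if \<open>s n > 0\<close>, and vanishes on the kernel of \<open>X\<close>.\<close>

lemma abs_op_svd:
  assumes svd: "svd X s f g"
  shows "abs_op X = weighted_op (\<lambda>n. complex_of_real (s n)) f f"
proof -
  note D = svdD[OF svd] and s0 = c0_starD(1)[OF svdD(1)[OF svd]]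
    and sb = c0_starD(4)[OF svdD(1)[OF svd]]
  let ?s = "\<lambda>n. complex_of_real (s n)"
  define T where "T = weighted_op (\<lambda>n. ?s n * ?s n) f f"
  define Q where "Q = weighted_op ?s f f"
  have Qp: "positive_op Q"
    unfolding Q_def by (rule weighted_op_positive[OF D(4), of s "s 0"]) (simp_all add: s0 c0_starD(2)[OF D(1)])
  then have Qb: "Q \<in> bounded_ops" by (simp add: positive_op_def)
  have "adjoint_op X = weighted_op ?s g f"
    by (rule adjoint_op_eq) (simp add: D(8) weighted_op_adjoint[OF D(4,5) sb])
  then have XX: "adjoint_op X \<circ> X = T"
    by (simp add: D(8) T_def weighted_op_comp[OF D(4,3,4) sb] mult.assoc D(11))
  have QQ: "Q \<circ> Q = T"
    by (simp add: Q_def T_def weighted_op_comp[OF D(4,2,4) sb] mult.assoc D(10))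
  have Tf: "T (f n) = (?s n * ?s n) *\<^sub>C f n" for n
    unfolding T_def weighted_op_apply[OF D(2)] mult.assoc D(10) ..
  show ?thesis
    unfolding abs_op_def Q_def[symmetric]
  proof (rule the_equality)
    show "positive_op Q \<and> Q \<circ> Q = adjoint_op X \<circ> X" using Qp QQ XX by simp
  next
    fix P assume P: "positive_op P \<and> P \<circ> P = adjoint_op X \<circ> X"
    then have Pp: "positive_op P" and Pb: "P \<in> bounded_ops" and PP: "P (P x) = T x" for x
      using XX by (auto simp: positive_op_def fun_eq_iff)
    have ker: "P x = 0" if "T x = 0" for x
    proof -
      have "cinner (P x) (P x) = cinner (P (P x)) x" using positive_op_selfadjoint[OF Pp] by simp
      then show ?thesis by (simp add: PP that cinner.zero_left norm_sq_cinner)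
    qed
    have Pf: "P (f n) = ?s n *\<^sub>C f n" for n
    proof (cases "s n = 0")
      case True
      then show ?thesis using ker[of "f n"] by (simp add: Tf scaleC.zero_left)
    next
      case False
      then have sn: "s n > 0" using s0[of n] by simp
      define y where "y = P (f n) - ?s n *\<^sub>C f n"
      have "P y = - (?s n *\<^sub>C y)"
        by (simp add: y_def bounded_opsD[OF Pb] PP Tf scaleC.diff_right scaleC_scaleC)
      then have "cinner (P y) y = - complex_of_real (s n * (norm y)\<^sup>2)"
        by (simp add: cinner.minus_left cinner_scaleC_left norm_sq_cinner)
      moreover have "0 \<le> Re (cinner (P y) y)"
        using Pp by (auto simp: positive_op_def complex_nonneg_Reals_iff)
      ultimately have "s n * (norm y)\<^sup>2 \<le> 0" by simp
      then show ?thesis using sn by (simp add: y_def mult_le_0_iff)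
    qed
    show "P = Q"
    proof
      fix x
      have 1: "\<forall>n::nat. cmod (1::complex) \<le> 1" by simp
      \<comment> \<open>\<open>p\<close> is the projection of \<open>x\<close> onto the closed span
        of \<open>f\<close>. The rest lies in the kernel of \<open>T\<close>, hence of
        \<open>P\<close>, so the values \<open>P (f n)\<close> determine \<open>P x\<close>.\<close>
      define p where "p = weighted_op (\<lambda>_. 1) f f x"
      have sp: "(\<lambda>n. cinner x (f n) *\<^sub>C f n) sums p"
        using weighted_op_sums[OF D(4,4) 1, of x] by (simp add: p_def)
      have "cinner (x - p) (f n) = 0" for n
        unfolding p_def cinner.diff_left cinner_weighted_op[OF D(4,2) 1]
        using orthonormal_or_zeroD(3)[OF D(2), of n x] by (simp add: mult.commute)
      then have "T (x - p) = 0" by (simp add: T_def weighted_op_def scaleC.zero_left)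
      then have "P (x - p) = 0" by (rule ker)
      then have "P x = P p" by (simp add: bounded_opsD[OF Pb])
      moreover have "(\<lambda>n. (?s n * cinner x (f n)) *\<^sub>C f n) sums P p"
        using bounded_linear.sums[OF bounded_opsD(1)[OF Pb] sp]
        by (simp add: bounded_opsD(2)[OF Pb] Pf scaleC_scaleC mult.commute)
      then have "P p = Q x" unfolding Q_def weighted_op_def by (rule sums_unique)
      ultimately show "P x = Q x" by simp
    qed
  qed
qed

text \<open>Because t > 0, an eigenvector is a multiple of its image and so lies in the closed span
  of \<open>f\<close>; comparing coefficients leaves only the finitely many indices with
  \<open>s n = t\<close>.\<close>

lemma dim_eigenspace_svd:
  assumes svd: "svd X s f g" and t: "t > 0"
  shows "complex_vector.dim {x. abs_op X x = complex_of_real t *\<^sub>C x} = card {n. s n = t}"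
proof -
  note D = svdD[OF svd] and sb = c0_starD(4)[OF svdD(1)[OF svd]]
  let ?s = "\<lambda>n. complex_of_real (s n)"
  define N where "N = {n. s n = t}"
  define E where "E = {x. abs_op X x = complex_of_real t *\<^sub>C x}"
  have fin: "finite N"
    unfolding N_def by (rule finite_subset[OF _ c0_starD(5)[OF D(1) t]]) auto
  have f1: "cinner (f n) (f n) = 1" if "n \<in> N" for n
    using D(6)[of n] t that by (simp add: N_def norm_sq_cinner)
  have inj: "inj_on f N"
  proof (rule inj_onI, rule ccontr)
    fix m n assume "m \<in> N" "n \<in> N" "f m = f n" "m \<noteq> n"
    then show False using f1[of n] orthonormal_or_zeroD(1)[OF D(2), of m n] by simp
  qed
  have "f ` N \<subseteq> E"
  proof (rule image_subsetI)
    fix n assume n: "n \<in> N"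
    then have "weighted_op ?s f f (f n) = complex_of_real t *\<^sub>C f n"
      by (simp add: weighted_op_apply[OF D(2)] f1) (simp add: N_def)
    then show "f n \<in> E" by (simp add: E_def abs_op_svd[OF svd])
  qed
  moreover have "E \<subseteq> complex_vector.span (f ` N)"
  proof
    fix x assume "x \<in> E"
    then have x: "weighted_op ?s f f x = complex_of_real t *\<^sub>C x"
      by (simp add: E_def abs_op_svd[OF svd])
    have "cinner x (f n) = 0" if "s n \<noteq> t" for n
    proof -
      have "complex_of_real t * cinner x (f n) = ?s n * cinner x (f n)"
        using arg_cong[OF x, of "\<lambda>z. cinner z (f n)"] orthonormal_or_zeroD(3)[OF D(2), of n x]
        by (simp only: cinner_weighted_op[OF D(4,2) sb] cinner_scaleC_left mult.assoc mult.commute[of "cinner x (f n)"])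
      then show ?thesis using that by auto
    qed
    then have "weighted_op ?s f f x = (\<Sum>n\<in>N. (?s n * cinner x (f n)) *\<^sub>C f n)"
      unfolding weighted_op_def using fin by (intro suminf_finite) (auto simp: N_def scaleC.zero_left)
    also have "\<dots> = complex_of_real t *\<^sub>C (\<Sum>n\<in>N. cinner x (f n) *\<^sub>C f n)"
      by (simp add: scaleC.sum_right scaleC_scaleC N_def)
    finally have "complex_of_real t *\<^sub>C x = complex_of_real t *\<^sub>C (\<Sum>n\<in>N. cinner x (f n) *\<^sub>C f n)"
      using x by simp
    then have "x = (\<Sum>n\<in>N. cinner x (f n) *\<^sub>C f n)"
      using t by (simp add: complex_vector.scale_cancel_left)
    also have "\<dots> \<in> complex_vector.span (f ` N)"
      by (intro complex_vector.span_sum complex_vector.span_scale complex_vector.span_base) auto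
    finally show "x \<in> complex_vector.span (f ` N)" .
  qed
  moreover have "complex_vector.independent (f ` N)"
  proof
    assume "complex_vector.dependent (f ` N)"
    then obtain u where u: "\<exists>v\<in>f ` N. u v \<noteq> 0" "(\<Sum>v\<in>f ` N. u v *\<^sub>C v) = 0"
      using fin by (auto simp: complex_vector.dependent_finite)
    then obtain m where m: "m \<in> N" "u (f m) \<noteq> 0" by auto
    have "0 = cinner (\<Sum>n\<in>N. u (f n) *\<^sub>C f n) (f m)"
      using u(2) by (simp add: sum.reindex[OF inj] cinner.zero_left)
    also have "\<dots> = (\<Sum>n\<in>N. if n = m then u (f m) else 0)"
      unfolding cinner.sum_left cinner_scaleC_left
      using m(1) orthonormal_or_zeroD(1)[OF D(2)] by (intro sum.cong) (auto simp: f1)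
    also have "\<dots> = u (f m)" using fin m(1) by simp
    finally show False using m(2) by simp
  qed
  ultimately have "complex_vector.dim E = card (f ` N)"
    by (metis complex_vector.dim_unique)
  then show ?thesis by (simp add: E_def N_def[symmetric] card_image[OF inj])
qed

lemma singular_numbers_svd:
  assumes svd: "svd X s f g"
  shows "singular_numbers X = s"
  unfolding singular_numbers_def
proof (rule the_equality)
  show "s \<in> c0_star \<and> (\<forall>t>0. card {n. s n = t} = complex_vector.dim {x. abs_op X x = complex_of_real t *\<^sub>C x})"
    using svdD(1)[OF svd] dim_eigenspace_svd[OF svd] by simp
next
  fix \<xi> assume "\<xi> \<in> c0_star \<and> (\<forall>t>0. card {n. \<xi> n = t} = complex_vector.dim {x. abs_op X x = complex_of_real t *\<^sub>C x})"
  then show "\<xi> = s" using svdD(1)[OF svd] dim_eigenspace_svd[OF svd] by (intro c0_star_eqI) auto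
qed

section \<open>Singular numbers as optimal bounds in finite codimension\<close>

lemma codim_bound_svd:
  assumes svd: "svd X s f g"
  shows "codim_bound X n (s n)"
  unfolding codim_bound_def
proof (intro exI conjI allI impI)
  note D = svdD[OF svd]
  show "finite (f ` {..<n})" "card (f ` {..<n}) \<le> n"
    using card_image_le[of "{..<n}" f] by simp_all
  fix x assume "\<forall>v\<in>f ` {..<n}. cinner x v = 0"
  then have "X x = weighted_op (\<lambda>k. if k < n then 0 else complex_of_real (s k)) f g x"
    unfolding D(8) weighted_op_def by (intro suminf_cong) auto
  also have "norm \<dots> \<le> s n * norm x"
    using c0_starD(1,2)[OF D(1)] by (intro weighted_op_norm_le[OF D(4,5)]) auto
  finally show "norm (X x) \<le> s n * norm x" .
qed

lemma codim_bound_svd_ge: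
  assumes svd: "svd X s f g" and c: "codim_bound X n c" "0 \<le> c"
  shows "s n \<le> c"
proof (cases "s n = 0")
  case True
  then show ?thesis using c(2) by simp
next
  case False
  note D = svdD[OF svd]
  have pos: "s i > 0" if "i \<le> n" for i
    using False c0_starD(1)[OF D(1), of n] c0_starD(2)[OF D(1) that] by linarith
  have Xf: "X (f i) = complex_of_real (s i) *\<^sub>C g i" for i
    unfolding D(8) weighted_op_apply[OF D(2)] D(10) ..
  show ?thesis
  proof (rule codim_bound_ge[OF D(9) c(1), of "{..n}" f])
    show "cinner (X (f i)) (X (f j)) = 0" if "i \<noteq> j" for i j
      using orthonormal_or_zeroD(1)[OF D(3) that]
      by (simp add: Xf cinner_scaleC_left cinner_scaleC_right)
    show "s n \<le> norm (X (f i))" if "i \<in> {..n}" for i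
      using that D(7)[OF pos, of i] c0_starD(1,2)[OF D(1)] by (simp add: Xf norm_scaleC)
  qed (use D(6)[OF pos] orthonormal_or_zeroD(1)[OF D(2)] c0_starD(1)[OF D(1)] in auto)
qed

lemma svd_compact_op:
  assumes svd: "svd X s f g"
  shows "compact_op X"
  unfolding compact_op_def
proof (intro conjI allI impI)
  note D = svdD[OF svd]
  show "X \<in> bounded_ops" by (rule D(9))
  fix c :: real assume c: "c > 0"
  obtain n where n: "norm (s n - 0) < c" using LIMSEQ_D[OF c0_starD(3)[OF D(1)] c] by blast
  then have "s n \<le> c" by (simp add: abs_less_iff)
  then have "norm (X x) \<le> c * norm x" if "norm (X x) \<le> s n * norm x" for x
    by (rule order_trans[OF that mult_right_mono[OF _ norm_ge_zero]])
  then show "\<exists>n. codim_bound X n c"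
    using codim_bound_svd[OF svd, of n] unfolding codim_bound_def by blast
qed

text \<open>Imposing both sets of orthogonality conditions at once adds the codimensions and the
  bounds; for singular numbers this is Weyl's inequality.\<close>

lemma codim_bound_add:
  assumes "codim_bound X m c" "codim_bound Y n d"
  shows "codim_bound (\<lambda>x. X x + Y x) (m + n) (c + d)"
proof -
  obtain V W where V: "finite V" "card V \<le> m" "\<And>x. \<forall>v\<in>V. cinner x v = 0 \<Longrightarrow> norm (X x) \<le> c * norm x"
    and W: "finite W" "card W \<le> n" "\<And>x. \<forall>v\<in>W. cinner x v = 0 \<Longrightarrow> norm (Y x) \<le> d * norm x"
    using assms unfolding codim_bound_def by blast
  have "norm (X x + Y x) \<le> (c + d) * norm x" if "\<forall>v\<in>V \<union> W. cinner x v = 0" for x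
    using norm_triangle_mono[OF V(3) W(3), of x x] that by (simp add: distrib_right)
  moreover have "card (V \<union> W) \<le> m + n" using card_Un_le[of V W] V(2) W(2) by linarith
  ultimately show ?thesis
    unfolding codim_bound_def using V(1) W(1) by (intro exI[of _ "V \<union> W"]) auto
qed

lemma codim_bound_comp_left:
  assumes X: "codim_bound X n c" and A: "\<And>x. norm (A x) \<le> K * norm x" and K: "0 \<le> K"
  shows "codim_bound (A \<circ> X) n (K * c)"
proof -
  have "norm (A (X x)) \<le> K * c * norm x" if "norm (X x) \<le> c * norm x" for x
    using A[of "X x"] mult_left_mono[OF that K] by simp
  then show ?thesis using X unfolding codim_bound_def by (metis comp_apply)
qed

text \<open>Conditions on \<open>A x\<close> become conditions on \<open>x\<close> through the
  adjoint of \<open>A\<close>, without increasing their number.\<close>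

lemma codim_bound_comp_right:
  fixes e :: "nat \<Rightarrow> 'a::complex_hilbert_space" and A :: "'a \<Rightarrow> 'a"
  assumes e: "orthonormal_basis e" and A: "A \<in> bounded_ops" and X: "codim_bound X n c" and c: "0 \<le> c"
    and K: "\<And>x. norm (A x) \<le> K * norm x"
  shows "codim_bound (X \<circ> A) n (K * c)"
proof -
  obtain B where B: "\<forall>x y. cinner (A x) y = cinner x (B y)" using adjoint_exists[OF e A] by blast
  obtain V where V: "finite V" "card V \<le> n" "\<And>x. \<forall>v\<in>V. cinner x v = 0 \<Longrightarrow> norm (X x) \<le> c * norm x"
    using X unfolding codim_bound_def by blast
  have "norm (X (A x)) \<le> K * c * norm x" if x: "\<forall>v\<in>B ` V. cinner x v = 0" for x
  proof -
    have "\<forall>v\<in>V. cinner (A x) v = 0" using x B by simp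
    then have "norm (X (A x)) \<le> c * norm (A x)" by (rule V(3))
    also have "\<dots> \<le> c * (K * norm x)" by (rule mult_left_mono[OF K c])
    finally show ?thesis by (simp add: ac_simps)
  qed
  moreover have "card (B ` V) \<le> n" using card_image_le[OF V(1), of B] V(2) by linarith
  ultimately show ?thesis
    unfolding codim_bound_def using V(1) by (intro exI[of _ "B ` V"]) auto
qed

lemma codim_bound_mono:
  assumes "codim_bound X m c" "m \<le> n"
  shows "codim_bound X n c"
  using assms unfolding codim_bound_def by (meson order_trans)

definition diag_op :: "(nat \<Rightarrow> 'a::complex_hilbert_space) \<Rightarrow> (nat \<Rightarrow> real) \<Rightarrow> 'a \<Rightarrow> 'a" where
  "diag_op e \<xi> = weighted_op (\<lambda>n. complex_of_real (\<xi> n)) e e"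

text \<open>The partial isometries carry one pair of singular systems to the other while the common
  weights stay put. An ideal therefore cannot distinguish operators with equal singular
  numbers.\<close>

lemma svd_factorization:
  assumes X: "svd X s f g" and Y: "svd Y s f' g'"
  shows "\<exists>U\<in>bounded_ops. \<exists>V\<in>bounded_ops. X = U \<circ> Y \<circ> V"
proof -
  note D = svdD[OF X] and D' = svdD[OF Y]
  let ?s = "\<lambda>n. complex_of_real (s n)"
  have 1: "\<forall>n::nat. cmod (1::complex) \<le> 1" by simp
  define U where "U = weighted_op (\<lambda>_. 1) g' g"
  define V where "V = weighted_op (\<lambda>_. 1) f f'"
  have b: "\<forall>n. cmod (?s n) \<le> s 0" by (rule c0_starD(4)[OF D(1)])
  have "Y \<circ> V = weighted_op ?s f g'"
    unfolding D'(8) V_def by (simp add: weighted_op_comp[OF D(4) D'(2) D'(5) 1] D'(10))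
  then have "U \<circ> (Y \<circ> V) = weighted_op ?s f g"
    unfolding U_def by (simp add: weighted_op_comp[OF D(4) D'(3) D(5) b] D'(11))
  then have "X = U \<circ> Y \<circ> V" by (simp add: D(8) comp_assoc)
  moreover have "U \<in> bounded_ops" "V \<in> bounded_ops"
    unfolding U_def V_def by (rule weighted_op_bounded[OF D'(5) D(5) 1], rule weighted_op_bounded[OF D(4) D'(4) 1])
  ultimately show ?thesis by blast
qed

lemma c0_star_add:
  assumes "\<xi> \<in> c0_star" "\<eta> \<in> c0_star"
  shows "(\<lambda>n. \<xi> n + \<eta> n) \<in> c0_star"
  using assms tendsto_add[of \<xi> 0 sequentially \<eta> 0]
  by (auto simp: c0_star_def decseq_def intro: add_mono)

section \<open>The Calkin correspondence\<close>

text \<open>The map \<open>n div 2\<close> is the ampliation with m = 2; iterating it and applying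
  heredity gives all others. The constant C lets heredity include nonnegative multiples.\<close>

definition characteristic_cone :: "(nat \<Rightarrow> real) set \<Rightarrow> bool" where
  "characteristic_cone S \<longleftrightarrow> S \<subseteq> c0_star \<and> (\<lambda>_. 0) \<in> S \<and>
     (\<forall>\<xi>\<in>S. \<forall>\<eta>\<in>S. (\<lambda>n. \<xi> n + \<eta> n) \<in> S) \<and>
     (\<forall>\<eta>\<in>S. \<forall>\<xi>\<in>c0_star. \<forall>C. (\<forall>n. \<xi> n \<le> C * \<eta> n) \<longrightarrow> \<xi> \<in> S) \<and>
     (\<forall>\<xi>\<in>S. (\<lambda>n. \<xi> (n div 2)) \<in> S)"

context
  fixes e :: "nat \<Rightarrow> 'a::complex_hilbert_space"
  assumes e: "orthonormal_basis e"
begin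

lemma svd_diag_op: "\<xi> \<in> c0_star \<Longrightarrow> svd (diag_op e \<xi>) \<xi> e e"
  unfolding svd_def diag_op_def using orthonormal_basisD(3,4)[OF e] by blast

lemma singular_numbers_diag_op: "\<xi> \<in> c0_star \<Longrightarrow> singular_numbers (diag_op e \<xi>) = \<xi>"
  using singular_numbers_svd[OF svd_diag_op] .

lemma compact_op_svd_obtain:
  assumes "compact_op (X :: 'a \<Rightarrow> 'a)"
  shows "\<exists>f g. svd X (singular_numbers X) f g"
proof -
  obtain s f g where "svd X s f g" using compact_op_svd[OF e assms] by blast
  moreover from this have "singular_numbers X = s" by (rule singular_numbers_svd)
  ultimately show ?thesis by blast
qed

lemma singular_numbers_c0_star: "compact_op (X :: 'a \<Rightarrow> 'a) \<Longrightarrow> singular_numbers X \<in> c0_star"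
  using compact_op_svd_obtain svdD(1) by blast

lemma codim_bound_singular_numbers:
  "compact_op (X :: 'a \<Rightarrow> 'a) \<Longrightarrow> codim_bound X n (singular_numbers X n)"
  using compact_op_svd_obtain codim_bound_svd by blast

lemma singular_numbers_le:
  assumes "compact_op (X :: 'a \<Rightarrow> 'a)" "codim_bound X n c" "0 \<le> c"
  shows "singular_numbers X n \<le> c"
  using compact_op_svd_obtain[OF assms(1)] codim_bound_svd_ge[OF _ assms(2,3)] by blast

lemma proper_ideal_iff_singular_numbers:
  fixes I :: "('a \<Rightarrow> 'a) set"
  assumes I: "proper_ideal I"
  shows "X \<in> I \<longleftrightarrow> compact_op X \<and> singular_numbers X \<in> char_set I"
proof
  assume "X \<in> I"
  then show "compact_op X \<and> singular_numbers X \<in> char_set I"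
    using proper_ideal_compact[OF e I] by (simp add: char_set_def)
next
  assume X: "compact_op X \<and> singular_numbers X \<in> char_set I"
  then obtain Y where Y: "Y \<in> I" "singular_numbers X = singular_numbers Y" by (auto simp: char_set_def)
  obtain f g where 1: "svd X (singular_numbers X) f g" using compact_op_svd_obtain X by blast
  obtain f' g' where 2: "svd Y (singular_numbers X) f' g'"
    using compact_op_svd_obtain[OF proper_ideal_compact[OF e I Y(1)]] Y(2) by auto
  obtain U V where "U \<in> bounded_ops" "V \<in> bounded_ops" "X = U \<circ> Y \<circ> V"
    using svd_factorization[OF 1 2] by blast
  then show "X \<in> I" using Y(1) proper_idealD(4,5)[OF I] by blast
qed

lemma char_set_iff:
  fixes I :: "('a \<Rightarrow> 'a) set"
  assumes I: "proper_ideal I"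
  shows "\<xi> \<in> char_set I \<longleftrightarrow> \<xi> \<in> c0_star \<and> diag_op e \<xi> \<in> I"
proof
  assume x: "\<xi> \<in> char_set I"
  then obtain X where X: "X \<in> I" "\<xi> = singular_numbers X" by (auto simp: char_set_def)
  have c: "\<xi> \<in> c0_star" unfolding X(2) by (rule singular_numbers_c0_star[OF proper_ideal_compact[OF e I X(1)]])
  then show "\<xi> \<in> c0_star \<and> diag_op e \<xi> \<in> I"
    using x unfolding proper_ideal_iff_singular_numbers[OF I]
    by (simp add: singular_numbers_diag_op svd_compact_op[OF svd_diag_op])
next
  assume "\<xi> \<in> c0_star \<and> diag_op e \<xi> \<in> I"
  then show "\<xi> \<in> char_set I" unfolding char_set_def using singular_numbers_diag_op by (metis imageI)
qed

text \<open>Multiply by the diagonal operator with entries \<open>b n / a n\<close>; where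
  \<open>a n = 0\<close>, also \<open>b n = 0\<close>, and the default quotient 0 is right. The
  entries may be complex and in any order, so computed diagonals need no rearrangement.\<close>

lemma diag_ideal_hereditary:
  assumes I: "proper_ideal I" and a: "\<forall>n. cmod (a n) \<le> K" "weighted_op a e e \<in> I"
    and b: "\<And>n. cmod (b n) \<le> C * cmod (a n)"
  shows "weighted_op b e e \<in> I"
proof -
  note be = orthonormal_basisD(4,5)[OF e]
  have "b n / a n * a n = b n" for n using b[of n] by (cases "a n = 0") auto
  then have "weighted_op (\<lambda>n. b n / a n) e e \<circ> weighted_op a e e = weighted_op b e e"
    by (simp add: weighted_op_comp[OF be(2,1,2) a(1)] orthonormal_basisD(1)[OF e])
  moreover have "cmod (b n / a n) \<le> \<bar>C\<bar>" for n
  proof (cases "a n = 0")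
    case False
    have "cmod (b n) \<le> \<bar>C\<bar> * cmod (a n)"
      using b[of n] mult_right_mono[OF abs_ge_self[of C] norm_ge_zero[of "a n"]] by linarith
    then show ?thesis using False by (simp add: norm_divide pos_divide_le_eq)
  qed simp
  then have "weighted_op (\<lambda>n. b n / a n) e e \<in> bounded_ops"
    by (intro weighted_op_bounded[OF be(2,2), of _ "\<bar>C\<bar>"]) simp
  ultimately show ?thesis using proper_idealD(5)[OF I a(2)] by metis
qed

lemma char_set_hereditary:
  fixes I :: "('a \<Rightarrow> 'a) set"
  assumes I: "proper_ideal I" and "\<eta> \<in> char_set I" "\<xi> \<in> c0_star" "\<And>n. \<xi> n \<le> C * \<eta> n"
  shows "\<xi> \<in> char_set I"
proof -
  have x: "\<eta> \<in> c0_star" "weighted_op (\<lambda>n. complex_of_real (\<eta> n)) e e \<in> I"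
    using assms(2) unfolding char_set_iff[OF I] diag_op_def by auto
  have "weighted_op (\<lambda>n. complex_of_real (\<xi> n)) e e \<in> I"
    by (rule diag_ideal_hereditary[OF I c0_starD(4)[OF x(1)] x(2), of _ C])
      (simp add: c0_starD(1)[OF x(1)] c0_starD(1)[OF assms(3)] assms(4))
  then show ?thesis unfolding char_set_iff[OF I] diag_op_def using assms(3) by simp
qed

lemma char_set_add:
  fixes I :: "('a \<Rightarrow> 'a) set"
  assumes I: "proper_ideal I" and "\<xi> \<in> char_set I" "\<eta> \<in> char_set I"
  shows "(\<lambda>n. \<xi> n + \<eta> n) \<in> char_set I"
proof -
  note be = orthonormal_basisD(5)[OF e]
  have x: "\<xi> \<in> c0_star" "diag_op e \<xi> \<in> I" and y: "\<eta> \<in> c0_star" "diag_op e \<eta> \<in> I"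
    using assms(2,3) unfolding char_set_iff[OF I] by auto
  have "diag_op e (\<lambda>n. \<xi> n + \<eta> n) = (\<lambda>z. diag_op e \<xi> z + diag_op e \<eta> z)"
    unfolding diag_op_def of_real_add
    by (rule ext) (rule weighted_op_add[OF be be c0_starD(4)[OF x(1)] c0_starD(4)[OF y(1)]])
  then show ?thesis
    unfolding char_set_iff[OF I] using c0_star_add[OF x(1) y(1)] proper_idealD(3)[OF I x(2) y(2)] by simp
qed

lemma char_set_zero:
  fixes I :: "('a \<Rightarrow> 'a) set"
  assumes I: "proper_ideal I"
  shows "(\<lambda>_. 0) \<in> char_set I"
  unfolding char_set_iff[OF I]
  using proper_idealD(2)[OF I] by (simp add: c0_star_def diag_op_def weighted_op_def scaleC.zero_left)

lemma compact_op_add: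
  fixes X Y :: "'a \<Rightarrow> 'a"
  assumes X: "compact_op X" and Y: "compact_op Y"
  shows "compact_op (\<lambda>x. X x + Y x)"
  unfolding compact_op_def
proof (intro conjI allI impI)
  show "(\<lambda>x. X x + Y x) \<in> bounded_ops"
    using assms by (simp add: compact_op_def bounded_ops_add)
  fix c :: real assume "c > 0"
  then obtain m n where "codim_bound X m (c / 2)" "codim_bound Y n (c / 2)"
    using X Y unfolding compact_op_def by (meson half_gt_zero)
  from codim_bound_add[OF this] show "\<exists>n. codim_bound (\<lambda>x. X x + Y x) n c" by auto
qed

text \<open>The halved index is the reason why a characteristic cone has to be closed under
  \<open>n div 2\<close>: this closure makes the corresponding set of operators additive.\<close>

lemma singular_numbers_add_le:
  fixes X Y :: "'a \<Rightarrow> 'a"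
  assumes X: "compact_op X" and Y: "compact_op Y"
  shows "singular_numbers (\<lambda>x. X x + Y x) n \<le> singular_numbers X (n div 2) + singular_numbers Y (n div 2)"
proof (rule singular_numbers_le[OF compact_op_add[OF X Y]])
  have "n div 2 + n div 2 \<le> n" by linarith
  then show "codim_bound (\<lambda>x. X x + Y x) n (singular_numbers X (n div 2) + singular_numbers Y (n div 2))"
    by (rule codim_bound_mono[OF codim_bound_add[OF codim_bound_singular_numbers[OF X]
            codim_bound_singular_numbers[OF Y]]])
  show "0 \<le> singular_numbers X (n div 2) + singular_numbers Y (n div 2)"
    using singular_numbers_c0_star[OF X] singular_numbers_c0_star[OF Y] by (simp add: c0_starD(1))
qed

lemma compact_op_comp:
  fixes X A :: "'a \<Rightarrow> 'a"
  assumes X: "compact_op X" and A: "A \<in> bounded_ops"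
  shows "compact_op (A \<circ> X)" "compact_op (X \<circ> A)"
    "\<exists>K. \<forall>n. singular_numbers (A \<circ> X) n \<le> K * singular_numbers X n"
    "\<exists>K. \<forall>n. singular_numbers (X \<circ> A) n \<le> K * singular_numbers X n"
proof -
  have Xb: "X \<in> bounded_ops" using X by (simp add: compact_op_def)
  obtain K where K: "K > 0" "\<And>x. norm (A x) \<le> K * norm x" using bounded_ops_bound[OF A] by blast
  have b: "codim_bound (A \<circ> X) n (K * c)" "codim_bound (X \<circ> A) n (K * c)"
    if "codim_bound X n c" "0 \<le> c" for n c
    using codim_bound_comp_left[OF that(1) K(2)] codim_bound_comp_right[OF e A that K(2)] K(1) by simp_all
  have "\<exists>n. codim_bound (A \<circ> X) n c" "\<exists>n. codim_bound (X \<circ> A) n c" if c: "c > 0" for c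
  proof -
    have "c / K > 0" using c K(1) by simp
    then obtain n where n: "codim_bound X n (c / K)" using X unfolding compact_op_def by blast
    show "\<exists>n. codim_bound (A \<circ> X) n c" "\<exists>n. codim_bound (X \<circ> A) n c"
      using b[OF n] \<open>c / K > 0\<close> K(1) by auto
  qed
  then show 1: "compact_op (A \<circ> X)" and 2: "compact_op (X \<circ> A)"
    unfolding compact_op_def using bounded_ops_comp[OF A Xb] bounded_ops_comp[OF Xb A] by blast+
  have s0: "0 \<le> singular_numbers X n" for n using singular_numbers_c0_star[OF X] c0_starD(1) by blast
  have "singular_numbers (A \<circ> X) n \<le> K * singular_numbers X n" for n
    using K(1) s0 by (intro singular_numbers_le[OF 1] b codim_bound_singular_numbers[OF X]) auto
  then show "\<exists>K. \<forall>n. singular_numbers (A \<circ> X) n \<le> K * singular_numbers X n" by blast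
  have "singular_numbers (X \<circ> A) n \<le> K * singular_numbers X n" for n
    using K(1) s0 by (intro singular_numbers_le[OF 2] b codim_bound_singular_numbers[OF X]) auto
  then show "\<exists>K. \<forall>n. singular_numbers (X \<circ> A) n \<le> K * singular_numbers X n" by blast
qed

lemma not_compact_op_id: "\<not> compact_op (\<lambda>x::'a. x)"
proof
  assume "compact_op (\<lambda>x::'a. x)"
  then obtain n where n: "codim_bound (\<lambda>x::'a. x) n (1 / 2)" unfolding compact_op_def by force
  have "1 \<le> (1 / 2 :: real)"
    by (rule codim_bound_ge[OF bounded_ops_id n, of "{..n}" e]) (simp_all add: orthonormal_basisD(1,3)[OF e])
  then show False by simp
qed

section \<open>The ideal belonging to a characteristic cone\<close>

context
  fixes S :: "(nat \<Rightarrow> real) set" and J :: "('a \<Rightarrow> 'a) set"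
  assumes S: "characteristic_cone S" and J_def: "J = {X. compact_op X \<and> singular_numbers X \<in> S}"
begin

lemma proper_ideal_compact_ideal: "proper_ideal J"
proof -
  have Sher: "\<xi> \<in> S" if "\<eta> \<in> S" "\<xi> \<in> c0_star" "\<And>n. \<xi> n \<le> C * \<eta> n" for \<xi> \<eta> C
    using S that unfolding characteristic_cone_def by blast
  have zero: "(\<lambda>x. 0) \<in> J"
  proof -
    have z: "(\<lambda>_. 0 :: real) \<in> S" "(\<lambda>_. 0 :: real) \<in> c0_star" using S unfolding characteristic_cone_def by blast+
    have "diag_op e (\<lambda>_. 0) = (\<lambda>x. 0)" by (simp add: diag_op_def weighted_op_def scaleC.zero_left)
    then show ?thesis
      using svd_compact_op[OF svd_diag_op[OF z(2)]] singular_numbers_diag_op[OF z(2)] z(1) by (simp add: J_def)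
  qed
  have add: "(\<lambda>x. A x + B x) \<in> J" if "A \<in> J" "B \<in> J" for A B
  proof -
    have A: "compact_op A" "singular_numbers A \<in> S" and B: "compact_op B" "singular_numbers B \<in> S"
      using that by (auto simp: J_def)
    have "\<forall>\<xi>\<in>S. \<forall>\<eta>\<in>S. (\<lambda>n. \<xi> n + \<eta> n) \<in> S" "\<forall>\<xi>\<in>S. (\<lambda>n. \<xi> (n div 2)) \<in> S"
      using S unfolding characteristic_cone_def by blast+
    from this(2)[rule_format, OF this(1)[rule_format, OF A(2) B(2)]]
    have "(\<lambda>n. singular_numbers A (n div 2) + singular_numbers B (n div 2)) \<in> S" .
    then have "singular_numbers (\<lambda>x. A x + B x) \<in> S"
      by (rule Sher[of _ _ 1, OF _ singular_numbers_c0_star[OF compact_op_add[OF A(1) B(1)]]])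
        (simp add: singular_numbers_add_le[OF A(1) B(1)])
    then show ?thesis using compact_op_add[OF A(1) B(1)] by (simp add: J_def)
  qed
  have mult: "A \<circ> B \<in> J \<and> B \<circ> A \<in> J" if "A \<in> J" "B \<in> bounded_ops" for A B
  proof -
    have A: "compact_op A" "singular_numbers A \<in> S" using that by (auto simp: J_def)
    note C = compact_op_comp[OF A(1) that(2)]
    obtain K L where K: "\<And>n. singular_numbers (B \<circ> A) n \<le> K * singular_numbers A n"
      and L: "\<And>n. singular_numbers (A \<circ> B) n \<le> L * singular_numbers A n" using C(3,4) by blast
    have "singular_numbers (B \<circ> A) \<in> S" "singular_numbers (A \<circ> B) \<in> S"
      by (rule Sher[of _ _ K, OF A(2) singular_numbers_c0_star[OF C(1)]], rule K)
        (rule Sher[of _ _ L, OF A(2) singular_numbers_c0_star[OF C(2)]], rule L)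
    then show ?thesis using C by (simp add: J_def)
  qed
  have "(\<lambda>x. x) \<notin> J" using not_compact_op_id by (simp add: J_def)
  moreover have "J \<subseteq> bounded_ops" by (auto simp: J_def compact_op_def)
  ultimately have "J \<subset> bounded_ops" using bounded_ops_id by blast
  then show ?thesis unfolding proper_ideal_def using zero add mult by blast
qed

lemma char_set_compact_ideal: "char_set J = S"
proof (rule equalityI)
  show "char_set J \<subseteq> S" by (auto simp: char_set_def J_def)
  show "S \<subseteq> char_set J"
  proof
    fix \<xi> assume x: "\<xi> \<in> S"
    then have "\<xi> \<in> c0_star" using S unfolding characteristic_cone_def by blast
    then show "\<xi> \<in> char_set J"
      unfolding char_set_iff[OF proper_ideal_compact_ideal]
      using x by (simp add: J_def singular_numbers_diag_op svd_compact_op[OF svd_diag_op])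
  qed
qed

lemma ideal_of_char_set_eq: "ideal_of_char_set S = J"
  unfolding ideal_of_char_set_def
proof (rule the_equality)
  show "proper_ideal J \<and> char_set J = S" using proper_ideal_compact_ideal char_set_compact_ideal by blast
next
  fix J' :: "('a \<Rightarrow> 'a) set" assume J': "proper_ideal J' \<and> char_set J' = S"
  then have "X \<in> J' \<longleftrightarrow> X \<in> J" for X
    using proper_ideal_iff_singular_numbers[of J' X] by (simp add: J_def)
  then show "J' = J" by blast
qed

end

end

section \<open>Arithmetic means\<close>

lemma arith_mean_add: "arith_mean (\<lambda>n. \<xi> n + \<eta> n) n = arith_mean \<xi> n + arith_mean \<eta> n"
  by (simp add: arith_mean_def sum.distrib add_divide_distrib)

lemma arith_mean_le_iff:
  "arith_mean \<xi> n \<le> C * arith_mean \<eta> n \<longleftrightarrow> (\<Sum>j\<le>n. \<xi> j) \<le> C * (\<Sum>j\<le>n. \<eta> j)"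
  by (simp add: arith_mean_def divide_le_cancel)

lemma arith_mean_c0_star:
  assumes x: "\<xi> \<in> c0_star"
  shows "arith_mean \<xi> \<in> c0_star"
proof -
  note x0 = c0_starD(1)[OF x] and dec = c0_starD(2)[OF x]
  have pos: "0 \<le> arith_mean \<xi> n" for n by (simp add: arith_mean_def sum_nonneg x0)
  have "arith_mean \<xi> (Suc n) \<le> arith_mean \<xi> n" for n
  proof -
    have "real (n + 1) * \<xi> (Suc n) = (\<Sum>j\<le>n. \<xi> (Suc n))" by simp
    also have "\<dots> \<le> (\<Sum>j\<le>n. \<xi> j)" by (intro sum_mono dec) simp
    finally show ?thesis by (simp add: arith_mean_def field_simps)
  qed
  then have "decseq (arith_mean \<xi>)" by (simp add: decseq_Suc_iff)
  moreover have "arith_mean \<xi> \<longlonglongrightarrow> 0"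
  proof (rule LIMSEQ_I)
    fix r :: real assume r: "r > 0"
    then obtain N where "norm (\<xi> N - 0) < r / 2" using LIMSEQ_D[OF c0_starD(3)[OF x], of "r / 2"] by auto
    then have N: "\<xi> N < r / 2" by simp
    \<comment> \<open>From \<open>M\<close> on, the first N terms, together at most
      \<open>N * \<xi> 0\<close>, contribute less than r / 2 to the mean; the others are at most
      \<open>\<xi> N\<close>.\<close>
    obtain M where M: "real M > 2 * (real N * \<xi> 0) / r" using reals_Archimedean2 by blast
    have "arith_mean \<xi> n < r" if n: "n \<ge> M" for n
    proof -
      have "(\<Sum>j\<le>n. \<xi> j) \<le> (\<Sum>j\<le>n. (if j < N then \<xi> 0 else 0) + \<xi> N)"
        using x0 by (intro sum_mono) (auto intro!: dec add_increasing2)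
      also have "\<dots> = (\<Sum>j\<le>n. if j < N then \<xi> 0 else 0) + real (n + 1) * \<xi> N"
        by (simp add: sum.distrib)
      also have "(\<Sum>j\<le>n. if j < N then \<xi> 0 else 0) = (\<Sum>j\<in>{..n} \<inter> {..<N}. \<xi> 0)"
        by (intro sum.mono_neutral_cong_right) auto
      also have "\<dots> \<le> (\<Sum>j<N. \<xi> 0)" using x0 by (intro sum_mono2) auto
      finally have "(\<Sum>j\<le>n. \<xi> j) \<le> real N * \<xi> 0 + real (n + 1) * \<xi> N" by simp
      also have "real N * \<xi> 0 < r / 2 * real (n + 1)"
      proof -
        have "2 * (real N * \<xi> 0) < real M * r" using M r by (simp add: pos_divide_less_eq)
        also have "\<dots> \<le> real (n + 1) * r" using n r by (intro mult_right_mono) auto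
        finally show ?thesis by (simp add: mult.commute)
      qed
      also have "r / 2 * real (n + 1) + real (n + 1) * \<xi> N \<le> r / 2 * real (n + 1) + real (n + 1) * (r / 2)"
        using N by (intro add_left_mono mult_left_mono) auto
      finally show ?thesis by (simp add: arith_mean_def pos_divide_less_eq algebra_simps)
    qed
    then show "\<exists>no. \<forall>n\<ge>no. norm (arith_mean \<xi> n - 0) < r" using pos by auto
  qed
  ultimately show ?thesis using pos by (simp add: c0_star_def)
qed

lemma c0_star_dilate:
  assumes x: "\<xi> \<in> c0_star"
  shows "(\<lambda>n. \<xi> (n div 2)) \<in> c0_star"
proof -
  have "filterlim (\<lambda>n::nat. n div 2) sequentially sequentially"
    unfolding filterlim_at_top eventually_sequentially
  proof (intro allI exI impI)
    show "Z \<le> n div 2" if "2 * Z \<le> n" for Z n :: nat using that by linarith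
  qed
  from filterlim_compose[OF c0_starD(3)[OF x] this] show ?thesis
    using c0_starD(1,2)[OF x] by (auto simp: c0_star_def decseq_def div_le_mono)
qed

lemma sum_dilate_le:
  assumes x: "\<xi> \<in> c0_star"
  shows "(\<Sum>j\<le>n. \<xi> (j div 2)) \<le> 2 * (\<Sum>j\<le>n. \<xi> j)"
proof -
  have "(\<Sum>j<2 * m. \<xi> (j div 2)) = 2 * (\<Sum>j<m. \<xi> j)" for m
    by (induction m) auto
  from this[of "Suc n"] have "2 * (\<Sum>j\<le>n. \<xi> j) = (\<Sum>j<2 * Suc n. \<xi> (j div 2))"
    by (simp add: lessThan_Suc_atMost)
  moreover have "(\<Sum>j\<le>n. \<xi> (j div 2)) \<le> (\<Sum>j<2 * Suc n. \<xi> (j div 2))"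
    by (intro sum_mono2) (auto simp: c0_starD(1)[OF x])
  ultimately show ?thesis by simp
qed

lemma arith_mean_dilate_le:
  assumes x: "\<xi> \<in> c0_star"
  shows "arith_mean \<xi> (n div 2) \<le> 2 * arith_mean \<xi> n"
proof -
  have s: "(\<Sum>j\<le>n div 2. \<xi> j) \<le> (\<Sum>j\<le>n. \<xi> j)"
    by (intro sum_mono2) (auto simp: c0_starD(1)[OF x])
  have "n + 1 \<le> 2 * (n div 2 + 1)" by presburger
  then have "real (n + 1) \<le> real (2 * (n div 2 + 1))" by (simp only: of_nat_le_iff)
  then have "real (n + 1) \<le> 2 * real (n div 2 + 1)" by simp
  then have "(\<Sum>j\<le>n div 2. \<xi> j) * real (n + 1) \<le> (\<Sum>j\<le>n. \<xi> j) * (2 * real (n div 2 + 1))"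
    using s by (intro mult_mono) (auto simp: sum_nonneg c0_starD(1)[OF x])
  then show ?thesis by (simp add: arith_mean_def divide_simps algebra_simps)
qed

text \<open>Ensures that the definite description in \<open>pre_am_ideal\<close> denotes. Means are
  additive, and dilation at most doubles them, which heredity of \<open>S\<close> absorbs.\<close>

lemma characteristic_cone_pre_am:
  assumes S: "characteristic_cone S"
  shows "characteristic_cone {\<xi> \<in> c0_star. arith_mean \<xi> \<in> S}"
proof -
  note S' = S[unfolded characteristic_cone_def]
  have her: "\<xi> \<in> S" if "\<eta> \<in> S" "\<xi> \<in> c0_star" "\<forall>n. \<xi> n \<le> C * \<eta> n" for \<xi> \<eta> C
    using S' that by blast
  have "arith_mean (\<lambda>_. 0) = (\<lambda>_. 0)" by (rule ext) (simp add: arith_mean_def)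
  then have "(\<lambda>_. 0) \<in> {\<xi> \<in> c0_star. arith_mean \<xi> \<in> S}" using S' by (auto simp: c0_star_def)
  moreover have "(\<lambda>n. \<xi> n + \<eta> n) \<in> {\<xi> \<in> c0_star. arith_mean \<xi> \<in> S}"
    if "\<xi> \<in> {\<xi> \<in> c0_star. arith_mean \<xi> \<in> S}" "\<eta> \<in> {\<xi> \<in> c0_star. arith_mean \<xi> \<in> S}" for \<xi> \<eta>
  proof -
    have "arith_mean (\<lambda>n. \<xi> n + \<eta> n) = (\<lambda>n. arith_mean \<xi> n + arith_mean \<eta> n)"
      by (rule ext) (rule arith_mean_add)
    then show ?thesis using that S' by (simp add: c0_star_add)
  qed
  moreover have "\<xi> \<in> {\<xi> \<in> c0_star. arith_mean \<xi> \<in> S}"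
    if eta: "\<eta> \<in> {\<xi> \<in> c0_star. arith_mean \<xi> \<in> S}" and xi: "\<xi> \<in> c0_star" and le: "\<forall>n. \<xi> n \<le> C * \<eta> n"
    for \<xi> \<eta> C
  proof -
    have "\<forall>n. arith_mean \<xi> n \<le> C * arith_mean \<eta> n"
      unfolding arith_mean_le_iff sum_distrib_left using le by (simp add: sum_mono)
    then show ?thesis using her[of "arith_mean \<eta>"] eta xi arith_mean_c0_star[OF xi] by blast
  qed
  moreover have "(\<lambda>n. \<xi> (n div 2)) \<in> {\<xi> \<in> c0_star. arith_mean \<xi> \<in> S}"
    if xi: "\<xi> \<in> {\<xi> \<in> c0_star. arith_mean \<xi> \<in> S}" for \<xi>
  proof -
    have x: "\<xi> \<in> c0_star" "arith_mean \<xi> \<in> S" using xi by auto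
    have "\<forall>n. arith_mean (\<lambda>n. \<xi> (n div 2)) n \<le> 2 * arith_mean \<xi> n"
      unfolding arith_mean_le_iff using sum_dilate_le[OF x(1)] by blast
    then show ?thesis using her[OF x(2) arith_mean_c0_star[OF c0_star_dilate[OF x(1)]]]
      c0_star_dilate[OF x(1)] by blast
  qed
  ultimately show ?thesis unfolding characteristic_cone_def by blast
qed

section \<open>The am-closure in terms of partial sums\<close>

context
  fixes e :: "nat \<Rightarrow> 'a::complex_hilbert_space" and I :: "('a \<Rightarrow> 'a) set"
  assumes e: "orthonormal_basis e" and I: "proper_ideal I"
begin

lemma char_set_c0_star: "\<eta> \<in> char_set I \<Longrightarrow> \<eta> \<in> c0_star"
  using char_set_iff[OF e I] by blast

lemma characteristic_cone_am:
  "characteristic_cone {\<xi> \<in> c0_star. \<exists>\<eta>\<in>char_set I. \<exists>C. \<forall>n. \<xi> n \<le> C * arith_mean \<eta> n}"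
  (is "characteristic_cone ?S")
proof -
  have am0: "0 \<le> arith_mean \<eta> n" if "\<eta> \<in> char_set I" for \<eta> n
    using c0_starD(1)[OF arith_mean_c0_star[OF char_set_c0_star[OF that]]] .
  \<comment> \<open>Enlarging and multiplying constants below requires \<open>C \<ge> 0\<close>; as
    means are nonnegative, the absolute value of any constant serves.\<close>
  have mem: "\<exists>\<eta>\<in>char_set I. \<exists>C\<ge>0. \<forall>n. \<xi> n \<le> C * arith_mean \<eta> n" if xi: "\<xi> \<in> ?S" for \<xi>
  proof -
    obtain \<eta> C where eta: "\<eta> \<in> char_set I" "\<forall>n. \<xi> n \<le> C * arith_mean \<eta> n" using xi by blast
    have "\<xi> n \<le> \<bar>C\<bar> * arith_mean \<eta> n" for n
      using eta(2) mult_right_mono[OF abs_ge_self[of C] am0[OF eta(1), of n]] by (meson order_trans)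
    then show ?thesis using eta(1) abs_ge_zero[of C] by blast
  qed
  have "(\<lambda>_. 0) \<in> ?S"
    using char_set_zero[OF e I] by (auto simp: c0_star_def intro!: bexI[of _ "\<lambda>_. 0"] exI[of _ 0])
  moreover have "(\<lambda>n. \<xi> n + \<xi>' n) \<in> ?S" if xi: "\<xi> \<in> ?S" "\<xi>' \<in> ?S" for \<xi> \<xi>'
  proof -
    obtain \<eta> C where eta: "\<eta> \<in> char_set I" "C \<ge> 0" "\<forall>n. \<xi> n \<le> C * arith_mean \<eta> n"
      using mem[OF xi(1)] by blast
    obtain \<eta>' C' where eta': "\<eta>' \<in> char_set I" "C' \<ge> 0" "\<forall>n. \<xi>' n \<le> C' * arith_mean \<eta>' n"
      using mem[OF xi(2)] by blast
    have "\<xi> n + \<xi>' n \<le> max C C' * arith_mean (\<lambda>n. \<eta> n + \<eta>' n) n" for n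
    proof -
      have "\<xi> n \<le> max C C' * arith_mean \<eta> n"
        using eta(3) mult_right_mono[OF max.cobounded1 am0[OF eta(1)]] by (meson order_trans)
      moreover have "\<xi>' n \<le> max C C' * arith_mean \<eta>' n"
        using eta'(3) mult_right_mono[OF max.cobounded2 am0[OF eta'(1)]] by (meson order_trans)
      ultimately show ?thesis by (simp add: arith_mean_add distrib_left)
    qed
    then show ?thesis using xi char_set_add[OF e I eta(1) eta'(1)] c0_star_add by blast
  qed
  moreover have "\<xi>' \<in> ?S"
    if xi: "\<xi> \<in> ?S" and xi': "\<xi>' \<in> c0_star" and le: "\<forall>n. \<xi>' n \<le> D * \<xi> n" for \<xi> \<xi>' D
  proof -
    obtain \<eta> C where eta: "\<eta> \<in> char_set I" "C \<ge> 0" "\<forall>n. \<xi> n \<le> C * arith_mean \<eta> n"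
      using mem[OF xi] by blast
    have "\<xi>' n \<le> \<bar>D\<bar> * C * arith_mean \<eta> n" for n
    proof -
      have x0: "0 \<le> \<xi> n" using xi c0_starD(1)[of \<xi> n] by simp
      have "\<xi>' n \<le> \<bar>D\<bar> * \<xi> n"
        using le[rule_format, of n] mult_right_mono[OF abs_ge_self[of D] x0] by linarith
      also have "\<dots> \<le> \<bar>D\<bar> * (C * arith_mean \<eta> n)" using eta(3) by (intro mult_left_mono) auto
      finally show ?thesis by (simp add: mult.assoc)
    qed
    then show ?thesis using xi' eta(1) by blast
  qed
  moreover have "(\<lambda>n. \<xi> (n div 2)) \<in> ?S" if xi: "\<xi> \<in> ?S" for \<xi>
  proof -
    obtain \<eta> C where eta: "\<eta> \<in> char_set I" "C \<ge> 0" "\<forall>n. \<xi> n \<le> C * arith_mean \<eta> n"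
      using mem[OF xi] by blast
    have "\<xi> (n div 2) \<le> C * 2 * arith_mean \<eta> n" for n
    proof -
      have "\<xi> (n div 2) \<le> C * arith_mean \<eta> (n div 2)" using eta(3) by blast
      also have "\<dots> \<le> C * (2 * arith_mean \<eta> n)"
        by (intro mult_left_mono eta(2) arith_mean_dilate_le[OF char_set_c0_star[OF eta(1)]])
      finally show ?thesis by (simp add: mult.assoc)
    qed
    moreover have "(\<lambda>n. \<xi> (n div 2)) \<in> c0_star" using xi c0_star_dilate by blast
    ultimately show ?thesis using eta(1) by blast
  qed
  ultimately show ?thesis unfolding characteristic_cone_def by blast
qed

text \<open>Both definite descriptions are resolved here: what remains of the am-closure is
  domination of partial sums up to a constant.\<close>

lemma am_closure_iff:
  "X \<in> am_closure I \<longleftrightarrow> compact_op X \<and>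
     (\<exists>\<eta>\<in>char_set I. \<exists>C. \<forall>n. arith_mean (singular_numbers X) n \<le> C * arith_mean \<eta> n)"
proof -
  define S where "S = {\<xi> \<in> c0_star. \<exists>\<eta>\<in>char_set I. \<exists>C. \<forall>n. \<xi> n \<le> C * arith_mean \<eta> n}"
  have S: "characteristic_cone S" unfolding S_def by (rule characteristic_cone_am)
  have "am_ideal I = {X :: 'a \<Rightarrow> 'a. compact_op X \<and> singular_numbers X \<in> S}"
    unfolding am_ideal_def S_def[symmetric] by (rule ideal_of_char_set_eq[OF e S refl])
  then have "char_set (am_ideal I) = S" using char_set_compact_ideal[OF e S refl] by simp
  then have "am_closure I = {X :: 'a \<Rightarrow> 'a. compact_op X \<and> singular_numbers X \<in> {\<xi> \<in> c0_star. arith_mean \<xi> \<in> S}}"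
    unfolding am_closure_def pre_am_ideal_def
    using ideal_of_char_set_eq[OF e characteristic_cone_pre_am[OF S] refl] by simp
  then show ?thesis
    using singular_numbers_c0_star[OF e] arith_mean_c0_star by (auto simp: S_def)
qed

end

section \<open>Diagonals are majorized by singular numbers\<close>

text \<open>The part \<open>R\<close> costs at most c for each index in J. A rank-one term costs at
  most \<open>cmod (b k)\<close> in total, whatever J is, by 2ab \<le> a^2 + b^2 and Bessel's
  inequality for x and for y. Splitting an operator at a level c in this way leads to Ky Fan's
  inequality.\<close>

lemma sum_cinner_le:
  fixes x y u w :: "nat \<Rightarrow> 'a::complex_hilbert_space"
  assumes x: "bessel x" and y: "bessel y" and u: "bessel u" and w: "bessel w"
    and F: "finite F" and J: "finite J"
    and T: "\<And>z. T z = R z + (\<Sum>k\<in>F. (b k * cinner z (u k)) *\<^sub>C w k)"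
    and R: "\<And>z. norm (R z) \<le> c * norm z" and c: "0 \<le> c"
  shows "(\<Sum>j\<in>J. cmod (cinner (T (x j)) (y j))) \<le> real (card J) * c + (\<Sum>k\<in>F. cmod (b k))"
proof -
  have sq: "(norm (v k))\<^sup>2 \<le> 1" if "bessel v" for v :: "nat \<Rightarrow> 'a" and k
    using bessel_norm_le[OF that, of k] by (simp add: power_le_one)
  have single: "cmod (cinner (T (x j)) (y j))
      \<le> c + (\<Sum>k\<in>F. cmod (b k) * (cmod (cinner (x j) (u k)) * cmod (cinner (w k) (y j))))" for j
  proof -
    have "cmod (cinner (R (x j)) (y j)) \<le> norm (R (x j)) * norm (y j)" by (rule cinner_cauchy_schwarz)
    also have "\<dots> \<le> (c * 1) * 1"
      using R[of "x j"] mult_left_mono[OF bessel_norm_le[OF x, of j] c] c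
      by (intro mult_mono bessel_norm_le[OF y]) auto
    finally have "cmod (cinner (R (x j)) (y j)) \<le> c" by simp
    moreover have "cmod (\<Sum>k\<in>F. b k * cinner (x j) (u k) * cinner (w k) (y j))
        \<le> (\<Sum>k\<in>F. cmod (b k) * (cmod (cinner (x j) (u k)) * cmod (cinner (w k) (y j))))"
      by (rule order_trans[OF norm_sum]) (simp add: norm_mult mult.assoc)
    ultimately show ?thesis
      unfolding T cinner.add_left cinner.sum_left cinner_scaleC_left
      using norm_triangle_mono by blast
  qed
  have pair: "(\<Sum>j\<in>J. cmod (cinner (x j) (u k)) * cmod (cinner (w k) (y j))) \<le> 1" for k
  proof -
    have "(\<Sum>j\<in>J. cmod (cinner (x j) (u k)) * cmod (cinner (w k) (y j)))
        \<le> (\<Sum>j\<in>J. ((cmod (cinner (u k) (x j)))\<^sup>2 + (cmod (cinner (w k) (y j)))\<^sup>2) / 2)"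
    proof (rule sum_mono)
      fix j
      show "cmod (cinner (x j) (u k)) * cmod (cinner (w k) (y j))
          \<le> ((cmod (cinner (u k) (x j)))\<^sup>2 + (cmod (cinner (w k) (y j)))\<^sup>2) / 2"
        using sum_squares_bound[of "cmod (cinner (u k) (x j))" "cmod (cinner (w k) (y j))"]
        by (simp add: cmod_cinner_commute[of "x j"])
    qed
    also have "\<dots> = ((\<Sum>j\<in>J. (cmod (cinner (u k) (x j)))\<^sup>2) + (\<Sum>j\<in>J. (cmod (cinner (w k) (y j)))\<^sup>2)) / 2"
      by (simp add: sum.distrib sum_divide_distrib add_divide_distrib)
    also have "\<dots> \<le> (1 + 1) / 2"
      by (intro divide_right_mono add_mono order_trans[OF besselD[OF x J] sq[OF u]]
          order_trans[OF besselD[OF y J] sq[OF w]]) simp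
    finally show ?thesis by simp
  qed
  have "(\<Sum>j\<in>J. cmod (cinner (T (x j)) (y j)))
      \<le> (\<Sum>j\<in>J. c + (\<Sum>k\<in>F. cmod (b k) * (cmod (cinner (x j) (u k)) * cmod (cinner (w k) (y j)))))"
    by (rule sum_mono) (rule single)
  also have "\<dots> = real (card J) * c
      + (\<Sum>k\<in>F. cmod (b k) * (\<Sum>j\<in>J. cmod (cinner (x j) (u k)) * cmod (cinner (w k) (y j))))"
    unfolding sum.distrib sum_distrib_left by (subst sum.swap) simp
  also have "\<dots> \<le> real (card J) * c + (\<Sum>k\<in>F. cmod (b k) * 1)"
    by (intro add_left_mono sum_mono mult_left_mono pair) simp
  finally show ?thesis by simp
qed

text \<open>Cutting the singular numbers at the level \<open>s n\<close> leaves n rank-one terms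
  with weights \<open>s k - s n\<close>. If J has n elements, the bound is the Ky Fan sum
  \<open>\<Sum>k<n. s k\<close>; the size of J is left free because J will be the set of large
  diagonal entries.\<close>

lemma sum_diagonal_le:
  assumes svd: "svd X s f g" and x: "bessel x" and J: "finite J"
  shows "(\<Sum>j\<in>J. cmod (cinner (X (x j)) (x j))) \<le> real (card J) * s n + (\<Sum>k<n. s k - s n)"
proof -
  note D = svdD[OF svd] and s0 = c0_starD(1)[OF svdD(1)[OF svd]]
    and dec = c0_starD(2)[OF svdD(1)[OF svd]]
  let ?m = "\<lambda>k. complex_of_real (min (s k) (s n))"
  have m: "\<forall>k. cmod (?m k) \<le> s n" using s0 by (simp add: min_def)
  define b where "b = (\<lambda>k. complex_of_real (s k) - ?m k)"
  have bz: "b k = 0" if "k \<notin> {..<n}" for k using that dec[of n k] by (simp add: b_def min_def)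
  have T: "X z = weighted_op ?m f g z + (\<Sum>k\<in>{..<n}. (b k * cinner z (f k)) *\<^sub>C g k)" for z
  proof -
    have "weighted_op b f g z = X z - weighted_op ?m f g z"
      unfolding b_def D(8) by (rule weighted_op_diff[OF D(4,5) c0_starD(4)[OF D(1)] m])
    moreover have "weighted_op b f g z = (\<Sum>k\<in>{..<n}. (b k * cinner z (f k)) *\<^sub>C g k)"
      by (rule weighted_op_finite[OF finite_lessThan bz])
    ultimately show ?thesis by simp
  qed
  have "(\<Sum>j\<in>J. cmod (cinner (X (x j)) (x j))) \<le> real (card J) * s n + (\<Sum>k\<in>{..<n}. cmod (b k))"
    by (rule sum_cinner_le[OF x x D(4,5) finite_lessThan J T weighted_op_norm_le[OF D(4,5) m] s0])
  also have "(\<Sum>k\<in>{..<n}. cmod (b k)) = (\<Sum>k<n. s k - s n)"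
  proof (rule sum.cong)
    fix k assume "k \<in> {..<n}"
    then have "b k = complex_of_real (s k - s n)" "s n \<le> s k"
      using dec[of k n] by (auto simp: b_def min_def)
    then show "cmod (b k) = s k - s n" by (simp only: norm_of_real)
  qed simp
  finally show ?thesis .
qed

text \<open>The diagonal entries are never sorted. The singular systems of the diagonal D are tested
  against D cut at a level c, and \<open>sum_diagonal_le\<close> bounds the excess of the entries
  over c.\<close>

lemma diagonal_majorized:
  fixes e :: "nat \<Rightarrow> 'a::complex_hilbert_space" and X :: "'a \<Rightarrow> 'a"
  assumes e: "orthonormal_basis e" and X: "compact_op X"
  shows "compact_op (diag_expectation e X)"
    and "(\<Sum>j<n. singular_numbers (diag_expectation e X) j) \<le> (\<Sum>j<n. singular_numbers X j)"
proof -
  note be = orthonormal_basisD(4,5)[OF e]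
  define s where "s = singular_numbers X"
  obtain f g where svd: "svd X s f g" using compact_op_svd_obtain[OF e X] unfolding s_def by blast
  note s0 = c0_starD(1)[OF svdD(1)[OF svd]] and s_lim = c0_starD(3)[OF svdD(1)[OF svd]]
  define d where "d = (\<lambda>k. cinner (X (e k)) (e k))"
  define D where "D = diag_expectation e X"
  have D_eq: "D = weighted_op d e e" by (simp add: D_def d_def diag_expectation_def weighted_op_def)
  have sum_d: "(\<Sum>j\<in>J. cmod (d j)) \<le> real (card J) * s n + (\<Sum>k<n. s k - s n)" if "finite J" for J n
    unfolding d_def by (rule sum_diagonal_le[OF svd be(2) that])
  have db: "\<forall>k. cmod (d k) \<le> s 0" using sum_d[of "{k}" 0 for k] by auto
  \<comment> \<open>With \<open>s n < c / 2\<close>, each entry above c exceeds its share of the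
    bound by more than c / 2, which limits their number.\<close>
  have fin: "finite {k. c < cmod (d k)}" if c: "c > 0" for c
  proof -
    obtain n where n: "norm (s n - 0) < c / 2" using LIMSEQ_D[OF s_lim, of "c / 2"] c by auto
    define B where "B = (\<Sum>k<n. s k - s n)"
    have "card J \<le> nat \<lceil>2 * B / c\<rceil>" if J: "J \<subseteq> {k. c < cmod (d k)}" "finite J" for J
    proof -
      have "(\<Sum>j\<in>J. c) \<le> (\<Sum>j\<in>J. cmod (d j))" by (intro sum_mono) (use J(1) in auto)
      then have "real (card J) * c \<le> (\<Sum>j\<in>J. cmod (d j))" by simp
      also have "\<dots> \<le> real (card J) * s n + B" unfolding B_def by (rule sum_d[OF J(2)])
      also have "\<dots> \<le> real (card J) * (c / 2) + B" using n by (intro add_right_mono mult_left_mono) auto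
      finally have "real (card J) \<le> 2 * B / c" using c by (simp add: pos_le_divide_eq)
      then show ?thesis by linarith
    qed
    then show ?thesis using finite_if_finite_subsets_card_bdd[of "{k. c < cmod (d k)}"] by blast
  qed
  \<comment> \<open>\<open>m c\<close> cuts the modulus of an entry at c and keeps its
    phase.\<close>
  define m where "m = (\<lambda>c k. if c < cmod (d k) then complex_of_real (c / cmod (d k)) * d k else d k)"
  have mb: "\<forall>k. cmod (m c k) \<le> c" if "c > 0" for c
    using that by (auto simp: m_def norm_mult norm_divide)
  have split: "D z = weighted_op (m c) e e z
      + (\<Sum>k\<in>{k. c < cmod (d k)}. ((d k - m c k) * cinner z (e k)) *\<^sub>C e k)" if c: "c > 0" for c z
  proof -
    have "weighted_op (\<lambda>k. d k - m c k) e e z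
        = (\<Sum>k\<in>{k. c < cmod (d k)}. ((d k - m c k) * cinner z (e k)) *\<^sub>C e k)"
      by (rule weighted_op_finite[OF fin[OF c]]) (simp add: m_def)
    then show ?thesis
      using weighted_op_diff[OF be(2) be(2) db mb[OF c], of z] by (simp add: D_eq algebra_simps)
  qed
  have Dc: "compact_op D"
    unfolding compact_op_def
  proof (intro conjI allI impI)
    show "D \<in> bounded_ops" unfolding D_eq by (rule weighted_op_bounded[OF be(2,2) db])
    fix c :: real assume c: "c > 0"
    have "norm (D z) \<le> c * norm z" if "\<forall>v\<in>e ` {k. c < cmod (d k)}. cinner z v = 0" for z
      using weighted_op_norm_le[OF be(2,2) mb[OF c], of z] split[OF c, of z] that
      by (simp add: scaleC.zero_left)
    then show "\<exists>n. codim_bound D n c" unfolding codim_bound_def using fin[OF c] by blast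
  qed
  then show "compact_op (diag_expectation e X)" by (simp add: D_def)
  define \<delta> where "\<delta> = singular_numbers D"
  obtain p q where dsvd: "svd D \<delta> p q" using compact_op_svd_obtain[OF e Dc] unfolding \<delta>_def by blast
  note DD = svdD[OF dsvd]
  have dq: "cmod (cinner (D (p j)) (q j)) = \<delta> j" for j
  proof -
    have "D (p j) = complex_of_real (\<delta> j) *\<^sub>C q j"
      unfolding DD(8) weighted_op_apply[OF DD(2)] DD(10) ..
    then show ?thesis by (simp add: cinner_scaleC_left DD(11) c0_starD(1)[OF DD(1)])
  qed
  have "(\<Sum>j<n. \<delta> j) \<le> (\<Sum>j<n. s j) + r" if r: "r > 0" for r
  proof -
    \<comment> \<open>The level lies slightly above \<open>s n\<close>, since for
      \<open>s n = 0\<close> infinitely many entries might exceed it. The denominator n + 1 makes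
      the total excess n * r / (n + 1) at most r, also for n = 0.\<close>
    define c where "c = s n + r / real (n + 1)"
    define F where "F = {k. c < cmod (d k)}"
    have cs: "s n \<le> c" "c > 0" using r s0[of n] by (simp_all add: c_def add_nonneg_pos)
    have "(\<Sum>j<n. \<delta> j) = (\<Sum>j\<in>{..<n}. cmod (cinner (D (p j)) (q j)))" by (simp add: dq)
    also have "\<dots> \<le> real (card {..<n}) * c + (\<Sum>k\<in>F. cmod (d k - m c k))"
      unfolding F_def
      by (rule sum_cinner_le[OF DD(4,5) be(2,2) fin[OF cs(2)] finite_lessThan split[OF cs(2)]
            weighted_op_norm_le[OF be(2,2) mb[OF cs(2)]] less_imp_le[OF cs(2)]])
    also have "(\<Sum>k\<in>F. cmod (d k - m c k)) = (\<Sum>k\<in>F. cmod (d k) - c)"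
    proof (rule sum.cong)
      fix k assume "k \<in> F"
      then have k: "c < cmod (d k)" by (simp add: F_def)
      then have "d k - m c k = complex_of_real (1 - c / cmod (d k)) * d k"
        by (simp add: m_def algebra_simps)
      moreover have nn: "0 \<le> 1 - c / cmod (d k)" using k cs(2) by (simp add: divide_le_eq)
      ultimately have "cmod (d k - m c k) = (1 - c / cmod (d k)) * cmod (d k)"
        using nn by (simp only: norm_mult norm_of_real abs_of_nonneg)
      moreover have "cmod (d k) \<noteq> 0" using k cs(2) by linarith
      ultimately show "cmod (d k - m c k) = cmod (d k) - c" by (simp add: left_diff_distrib)
    qed simp
    also have "\<dots> = (\<Sum>k\<in>F. cmod (d k)) - real (card F) * c" by (simp add: sum_subtractf)
    also have "(\<Sum>k\<in>F. cmod (d k)) \<le> real (card F) * s n + (\<Sum>k<n. s k - s n)"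
      unfolding F_def by (rule sum_d[OF fin[OF cs(2)]])
    \<comment> \<open>The unknown size of F drops out: its contribution
      \<open>card F * (s n - c)\<close> is nonpositive.\<close>
    also have "real (card {..<n}) * c + (real (card F) * s n + (\<Sum>k<n. s k - s n) - real (card F) * c)
        \<le> real n * c + (\<Sum>k<n. s k - s n)"
      using mult_left_mono[OF cs(1), of "real (card F)"] by simp
    also have "\<dots> = (\<Sum>j<n. s j) + real n * (r / real (n + 1))"
      by (simp add: c_def sum_subtractf algebra_simps)
    also have "real n * (r / real (n + 1)) \<le> r" using r by (simp add: field_simps)
    finally show ?thesis by simp
  qed
  then show "(\<Sum>j<n. singular_numbers (diag_expectation e X) j) \<le> (\<Sum>j<n. singular_numbers X j)"
    using field_le_epsilon by (metis \<delta>_def s_def D_def)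
qed

lemma diag_expectation_mem_am_closure:
  fixes e :: "nat \<Rightarrow> 'a::complex_hilbert_space" and I :: "('a \<Rightarrow> 'a) set"
  assumes e: "orthonormal_basis e" and I: "proper_ideal I" and X: "X \<in> I"
  shows "diag_expectation e X \<in> am_closure I"
proof -
  have Xc: "compact_op X" by (rule proper_ideal_compact[OF e I X])
  have "singular_numbers X \<in> char_set I" using X by (simp add: char_set_def)
  moreover have "arith_mean (singular_numbers (diag_expectation e X)) n \<le> 1 * arith_mean (singular_numbers X) n" for n
    unfolding arith_mean_le_iff
    using diagonal_majorized(2)[OF e Xc, of "Suc n"] by (simp add: lessThan_Suc_atMost)
  ultimately show ?thesis
    unfolding am_closure_iff[OF e I] using diagonal_majorized(1)[OF e Xc] by blast
qed

section \<open>Discrete Fourier transform\<close>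

definition unity_root :: "nat \<Rightarrow> nat \<Rightarrow> complex" where
  "unity_root N m = exp (2 * of_real pi * \<i> * of_nat m / of_nat N)"

lemma cmod_unity_root [simp]: "cmod (unity_root N m) = 1"
  by (simp add: unity_root_def norm_exp_eq_Re)

lemma sum_unity_root:
  assumes "m < N" "m' < N"
  shows "(\<Sum>i<N. unity_root N m ^ i * cnj (unity_root N m' ^ i)) = (if m = m' then of_nat N else 0)"
proof -
  have N: "N \<noteq> 0" "1 \<le> N" using assms by auto
  \<comment> \<open>On the unit circle conjugation is inversion, so \<open>z\<close> is the quotient
    of the two roots and the sum is geometric.\<close>
  define z where "z = unity_root N m * cnj (unity_root N m')"
  have u: "unity_root N k * cnj (unity_root N k) = 1" for k
    using complex_norm_square[of "unity_root N k"] by simp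
  have pow: "unity_root N k ^ N = 1" for k
    unfolding unity_root_def by (rule complex_root_unity[OF N(1)])
  have eq: "(\<Sum>i<N. unity_root N m ^ i * cnj (unity_root N m' ^ i)) = (\<Sum>i<N. z ^ i)"
    by (simp add: z_def power_mult_distrib)
  show ?thesis
  proof (cases "m = m'")
    case True
    then show ?thesis unfolding eq by (simp add: z_def u)
  next
    case False
    then have "unity_root N m \<noteq> unity_root N m'"
      unfolding unity_root_def using complex_root_unity_eq[OF N(2), of m m'] assms by simp
    moreover have "unity_root N m = unity_root N m'" if "z = 1"
    proof -
      have "unity_root N m = unity_root N m * (unity_root N m' * cnj (unity_root N m'))" by (simp add: u)
      also have "\<dots> = z * unity_root N m'" by (simp add: z_def)
      finally show ?thesis using that by simp
    qed
    ultimately have "z \<noteq> 1" by blast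
    moreover have "z ^ N = 1"
      by (simp add: z_def power_mult_distrib pow complex_cnj_power[symmetric])
    ultimately have "(\<Sum>i<N. z ^ i) = 0" by (simp add: geometric_sum)
    then show ?thesis unfolding eq using False by simp
  qed
qed

lemma parseval_unity_root:
  "(\<Sum>i<N. (cmod (\<Sum>m<N. c m * unity_root N m ^ i))\<^sup>2) = real N * (\<Sum>m<N. (cmod (c m))\<^sup>2)"
proof -
  have "complex_of_real (\<Sum>i<N. (cmod (\<Sum>m<N. c m * unity_root N m ^ i))\<^sup>2)
      = (\<Sum>i<N. (\<Sum>m<N. c m * unity_root N m ^ i) * cnj (\<Sum>m<N. c m * unity_root N m ^ i))"
    unfolding of_real_sum complex_norm_square ..
  also have "\<dots> = (\<Sum>i<N. \<Sum>m<N. \<Sum>m'<N. c m * cnj (c m') * (unity_root N m ^ i * cnj (unity_root N m' ^ i)))"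
    by (simp add: sum_product ac_simps)
  also have "\<dots> = (\<Sum>m<N. \<Sum>m'<N. \<Sum>i<N. c m * cnj (c m') * (unity_root N m ^ i * cnj (unity_root N m' ^ i)))"
    by (subst sum.swap, rule sum.cong[OF refl], rule sum.swap)
  also have "\<dots> = (\<Sum>m<N. \<Sum>m'<N. if m' = m then c m * cnj (c m) * of_nat N else 0)"
    unfolding sum_distrib_left[symmetric] by (intro sum.cong refl, subst sum_unity_root) auto
  also have "\<dots> = (\<Sum>m<N. c m * cnj (c m) * of_nat N)" by (intro sum.cong refl) simp
  also have "\<dots> = complex_of_real (real N * (\<Sum>m<N. (cmod (c m))\<^sup>2))"
    unfolding of_real_mult of_real_sum complex_norm_square by (simp add: sum_distrib_left mult.commute)
  finally show ?thesis using of_real_eq_iff by blast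
qed

section \<open>Operators with prescribed diagonal\<close>

text \<open>With \<open>Suc n\<close> in place of n, block k consists of the 2^k indices from 2^k -
  1 to 2^(k+1) - 2; index 0 alone forms block 0.\<close>

definition dyadic_block :: "nat \<Rightarrow> nat" where
  "dyadic_block n = floor_log (Suc n)"

lemma dyadic_block_bounds: "2 ^ dyadic_block n \<le> Suc n" "Suc n < 2 * 2 ^ dyadic_block n"
  unfolding dyadic_block_def by (rule floor_log_exp2_le, simp, rule floor_log_exp2_gt)

lemma dyadic_block_eq: "i < 2 ^ k \<Longrightarrow> dyadic_block (2 ^ k - 1 + i) = k"
proof -
  assume i: "i < (2::nat) ^ k"
  have s: "Suc (2 ^ k - 1 + i) = 2 ^ k + i" by simp
  show ?thesis unfolding dyadic_block_def s by (rule floor_log_eqI) (use i in auto)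
qed

text \<open>The index \<open>n\<close> runs through the blocks of \<open>2 ^ k\<close> elements starting at \<open>2 ^ k - 1\<close>; on block
  \<open>k\<close> the vectors are the rows of the Fourier matrix of order \<open>2 ^ k\<close>, with column \<open>m\<close> scaled by
  the square root of \<open>p m k\<close>.\<close>

definition fourier_vector :: "(nat \<Rightarrow> 'a::complex_hilbert_space) \<Rightarrow> (nat \<Rightarrow> nat \<Rightarrow> real) \<Rightarrow> nat \<Rightarrow> nat \<Rightarrow> 'a" where
  "fourier_vector e p k i =
     (\<Sum>m<2 ^ k. (complex_of_real (sqrt (p m k / 2 ^ k)) * cnj (unity_root (2 ^ k) m ^ i)) *\<^sub>C e m)"

definition block_vector :: "(nat \<Rightarrow> 'a::complex_hilbert_space) \<Rightarrow> (nat \<Rightarrow> nat \<Rightarrow> real) \<Rightarrow> nat \<Rightarrow> 'a" where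
  "block_vector e p n = fourier_vector e p (dyadic_block n) (Suc n - 2 ^ dyadic_block n)"

context
  fixes e :: "nat \<Rightarrow> 'a::complex_hilbert_space" and p :: "nat \<Rightarrow> nat \<Rightarrow> real"
  assumes e: "orthonormal_basis e"
    and p0: "\<And>m k. 0 \<le> p m k" and p1: "\<And>m K. (\<Sum>k<K. p m k) \<le> 1"
begin

lemma cinner_fourier_vector:
  "cinner (fourier_vector e p k i) (e m) =
     (if m < 2 ^ k then complex_of_real (sqrt (p m k / 2 ^ k)) * cnj (unity_root (2 ^ k) m ^ i) else 0)"
proof -
  have "cinner (fourier_vector e p k i) (e m) = (\<Sum>l<2 ^ k. if l = m then
      complex_of_real (sqrt (p m k / 2 ^ k)) * cnj (unity_root (2 ^ k) m ^ i) else 0)"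
    unfolding fourier_vector_def cinner.sum_left cinner_scaleC_left orthonormal_basisD(1)[OF e]
    by (intro sum.cong) auto
  then show ?thesis by simp
qed

text \<open>Parseval's identity removes the phases: in squared norm, block k acts on the first 2^k
  coordinates as the diagonal matrix of the weights \<open>p m k\<close>.\<close>

lemma sum_cinner_fourier_vector:
  "(\<Sum>i<2 ^ k. (cmod (cinner x (fourier_vector e p k i)))\<^sup>2)
     = (\<Sum>m<2 ^ k. p m k * (cmod (cinner x (e m)))\<^sup>2)"
proof -
  have "cinner x (fourier_vector e p k i)
      = (\<Sum>m<2 ^ k. (complex_of_real (sqrt (p m k / 2 ^ k)) * cinner x (e m)) * unity_root (2 ^ k) m ^ i)" for i
    unfolding fourier_vector_def cinner.sum_right cinner_scaleC_right
    by (intro sum.cong) (auto simp: ac_simps)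
  then have "(\<Sum>i<2 ^ k. (cmod (cinner x (fourier_vector e p k i)))\<^sup>2)
      = real (2 ^ k) * (\<Sum>m<2 ^ k. (cmod (complex_of_real (sqrt (p m k / 2 ^ k)) * cinner x (e m)))\<^sup>2)"
    by (simp only: parseval_unity_root)
  also have "\<dots> = (\<Sum>m<2 ^ k. p m k * (cmod (cinner x (e m)))\<^sup>2)"
    unfolding sum_distrib_left by (intro sum.cong) (simp_all add: norm_mult power_mult_distrib p0)
  finally show ?thesis .
qed

text \<open>Over complete blocks, the square of the m-th coordinate is counted with a total weight
  of at most \<open>\<Sum>k<K. p m k\<close>, hence at most once.\<close>

lemma bessel_block_vector: "bessel (block_vector e p)"
  unfolding bessel_def
proof (intro allI impI)
  fix x :: 'a and F :: "nat set" assume F: "finite F"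
  let ?h = "\<lambda>n. (cmod (cinner x (block_vector e p n)))\<^sup>2"
  let ?x = "\<lambda>m. (cmod (cinner x (e m)))\<^sup>2"
  have shift: "(\<Sum>n<a + b. f n) = (\<Sum>n<a. f n) + (\<Sum>i<b. f (a + i))" for f :: "nat \<Rightarrow> real" and a b
    by (induction b) (auto simp: algebra_simps)
  have blocks: "(\<Sum>n<2 ^ K - 1. ?h n) = (\<Sum>k<K. \<Sum>m<2 ^ k. p m k * ?x m)" for K
  proof (induction K)
    case (Suc K)
    have "(2::nat) ^ Suc K - 1 = (2 ^ K - 1) + 2 ^ K" by simp
    then have "(\<Sum>n<2 ^ Suc K - 1. ?h n) = (\<Sum>n<2 ^ K - 1. ?h n) + (\<Sum>i<2 ^ K. ?h (2 ^ K - 1 + i))"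
      by (simp only: shift)
    also have "(\<Sum>i<2 ^ K. ?h (2 ^ K - 1 + i)) = (\<Sum>i<2 ^ K. (cmod (cinner x (fourier_vector e p K i)))\<^sup>2)"
    proof (rule sum.cong)
      fix i :: nat assume "i \<in> {..<2 ^ K}"
      then have "dyadic_block (2 ^ K - 1 + i) = K" by (intro dyadic_block_eq) simp
      moreover have "Suc (2 ^ K - 1 + i) - 2 ^ K = i" by simp
      ultimately have "block_vector e p (2 ^ K - 1 + i) = fourier_vector e p K i"
        by (simp only: block_vector_def)
      then show "?h (2 ^ K - 1 + i) = (cmod (cinner x (fourier_vector e p K i)))\<^sup>2" by simp
    qed simp
    finally show ?case by (simp only: Suc.IH sum_cinner_fourier_vector sum.lessThan_Suc)
  qed simp
  obtain K where K: "F \<subseteq> {..<K}" using finite_nat_iff_bounded F by blast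
  have "K \<le> 2 ^ K - 1" using less_exp[of K] by linarith
  then have "(\<Sum>n\<in>F. ?h n) \<le> (\<Sum>n<2 ^ K - 1. ?h n)"
    using K by (intro sum_mono2) auto
  also have "\<dots> = (\<Sum>k<K. \<Sum>m<2 ^ k. p m k * ?x m)" by (rule blocks)
  also have "\<dots> \<le> (\<Sum>k<K. \<Sum>m<2 ^ K. p m k * ?x m)"
  proof (intro sum_mono sum_mono2)
    fix k assume "k \<in> {..<K}"
    then have "(2::nat) ^ k \<le> 2 ^ K" by (intro power_increasing) auto
    then show "{..<(2::nat) ^ k} \<subseteq> {..<2 ^ K}" by auto
  qed (auto simp: p0)
  also have "\<dots> = (\<Sum>m<2 ^ K. (\<Sum>k<K. p m k) * ?x m)"
    by (subst sum.swap) (simp add: sum_distrib_right)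
  also have "\<dots> \<le> (\<Sum>m<2 ^ K. 1 * ?x m)" by (intro sum_mono mult_right_mono p1) simp
  also have "\<dots> \<le> (norm x)\<^sup>2" using besselD[OF orthonormal_basisD(5)[OF e]] by simp
  finally show "(\<Sum>n\<in>F. ?h n) \<le> (norm x)\<^sup>2" .
qed

text \<open>\<open>W\<close> is the adjoint of \<open>V\<close>, so the n-th diagonal entry of
  \<open>A\<close> is the quadratic form of \<open>diag_op e \<eta>\<close> at the n-th block
  vector. The m-th coordinate of that vector has squared modulus \<open>p m k / 2 ^ k\<close>
  throughout block k for m < 2^k, which makes the entry the average named in the hypothesis.\<close>

lemma block_diagonal_mem:
  fixes I :: "('a \<Rightarrow> 'a) set"
  assumes I: "proper_ideal I" and inv: "diag_expectation e ` I \<subseteq> I" and eta: "\<eta> \<in> char_set I"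
    and xi: "\<xi> \<in> c0_star"
    and le: "\<And>n. \<xi> n \<le> C * ((\<Sum>m<2 ^ dyadic_block n. \<eta> m * p m (dyadic_block n)) / 2 ^ dyadic_block n)"
  shows "\<xi> \<in> char_set I"
proof -
  note be = orthonormal_basisD(4,5)[OF e] and bh = bessel_block_vector
  have eta': "\<eta> \<in> c0_star" "diag_op e \<eta> \<in> I" using eta unfolding char_set_iff[OF e I] by auto
  have 1: "\<forall>n::nat. cmod (1::complex) \<le> 1" by simp
  define h where "h = block_vector e p"
  define V where "V = weighted_op (\<lambda>_. 1) e h"
  define W where "W = weighted_op (\<lambda>_. 1) h e"
  have Vb: "V \<in> bounded_ops" and Wb: "W \<in> bounded_ops"
    unfolding V_def W_def h_def by (rule weighted_op_bounded[OF be(2) bh 1], rule weighted_op_bounded[OF bh be(2) 1])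
  define A where "A = W \<circ> (diag_op e \<eta> \<circ> V)"
  have AI: "A \<in> I" unfolding A_def by (intro proper_idealD(4,5)[OF I] eta'(2) Vb Wb)
  define d where "d = (\<lambda>n. (\<Sum>m<2 ^ dyadic_block n. \<eta> m * p m (dyadic_block n)) / 2 ^ dyadic_block n)"
  have "cinner (A (e n)) (e n) = complex_of_real (d n)" for n
  proof -
    let ?k = "dyadic_block n"
    have "V (e n) = h n"
      unfolding V_def by (simp add: weighted_op_apply[OF be(1)] orthonormal_basisD(1)[OF e])
    moreover have "cinner (W z) (e n) = cinner z (V (e n))" for z
      unfolding V_def W_def h_def using weighted_op_adjoint[OF bh be(2) 1, of z "e n"] by simp
    ultimately have "cinner (A (e n)) (e n) = cinner (diag_op e \<eta> (h n)) (h n)"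
      by (simp add: A_def)
    moreover have "(\<lambda>m. complex_of_real (\<eta> m) * cinner (h n) (e m) * cinner (e m) (h n))
        sums cinner (diag_op e \<eta> (h n)) (h n)"
      unfolding diag_op_def by (rule cinner_weighted_op_sums[OF be(2,2) c0_starD(4)[OF eta'(1)]])
    moreover have "complex_of_real (\<eta> m) * cinner (h n) (e m) * cinner (e m) (h n)
        = (if m \<in> {..<2 ^ ?k} then complex_of_real (\<eta> m * (p m ?k / 2 ^ ?k)) else 0)" for m
    proof -
      have "cinner (h n) (e m) * cinner (e m) (h n) = complex_of_real ((cmod (cinner (h n) (e m)))\<^sup>2)"
        unfolding complex_norm_square by (simp add: cinner_commute[of "e m"])
      also have "(cmod (cinner (h n) (e m)))\<^sup>2 = (if m \<in> {..<2 ^ ?k} then p m ?k / 2 ^ ?k else 0)"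
        unfolding h_def block_vector_def cinner_fourier_vector
        by (simp add: norm_mult norm_power power_mult_distrib p0)
      finally show ?thesis by (simp add: mult.assoc)
    qed
    ultimately have "(\<lambda>m. if m \<in> {..<2 ^ ?k} then complex_of_real (\<eta> m * (p m ?k / 2 ^ ?k)) else 0)
        sums cinner (A (e n)) (e n)" by simp
    moreover have "(\<lambda>m. if m \<in> {..<2 ^ ?k} then complex_of_real (\<eta> m * (p m ?k / 2 ^ ?k)) else 0)
        sums (\<Sum>m<2 ^ ?k. complex_of_real (\<eta> m * (p m ?k / 2 ^ ?k)))"
      by (rule sums_If_finite_set) simp
    ultimately have "cinner (A (e n)) (e n) = (\<Sum>m<2 ^ ?k. complex_of_real (\<eta> m * (p m ?k / 2 ^ ?k)))"
      by (rule sums_unique2)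
    then show ?thesis by (simp add: d_def sum_divide_distrib)
  qed
  then have D: "weighted_op (\<lambda>n. complex_of_real (d n)) e e \<in> I"
    using inv AI unfolding diag_expectation_def weighted_op_def by force
  obtain K where K: "K > 0" "\<And>x. norm (A x) \<le> K * norm x"
    using bounded_ops_bound[OF proper_idealD(1)[OF I AI]] by blast
  have db: "\<forall>n. cmod (complex_of_real (d n)) \<le> K"
  proof
    fix n
    have "cmod (cinner (A (e n)) (e n)) \<le> norm (A (e n)) * norm (e n)" by (rule cinner_cauchy_schwarz)
    also have "\<dots> \<le> K" using K(2)[of "e n"] by (simp add: orthonormal_basisD(3)[OF e])
    finally show "cmod (complex_of_real (d n)) \<le> K"
      using \<open>cinner (A (e n)) (e n) = complex_of_real (d n)\<close> by simp
  qed
  have d0: "0 \<le> d n" for n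
    unfolding d_def by (intro divide_nonneg_nonneg sum_nonneg mult_nonneg_nonneg c0_starD(1)[OF eta'(1)] p0) simp
  have "\<xi> n \<le> C * d n" for n unfolding d_def by (rule le)
  then have "weighted_op (\<lambda>n. complex_of_real (\<xi> n)) e e \<in> I"
    by (intro diag_ideal_hereditary[OF e I db D, of _ C])
      (simp only: norm_of_real abs_of_nonneg[OF d0] abs_of_nonneg[OF c0_starD(1)[OF xi]])
  then show ?thesis unfolding char_set_iff[OF e I] diag_op_def using xi by simp
qed

end

text \<open>The intervals of lengths \<open>\<eta> m\<close> laid end to end, and likewise the intervals carrying the mass
  of \<open>\<xi>\<close> on the dyadic blocks, tile half-lines; \<open>p m k\<close> is the fraction of the \<open>m\<close>-th interval of
  the first kind covered by the \<open>k\<close>-th of the second. Majorization forces the latter to lie to the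
  left of the end point of the former with index \<open>2 ^ k\<close>.\<close>

lemma transport_weights:
  assumes xi: "\<xi> \<in> c0_star" and eta: "\<eta> \<in> c0_star"
    and le: "\<And>n. (\<Sum>j<n. \<xi> j) \<le> (\<Sum>j<n. \<eta> j)"
  shows "\<exists>p. (\<forall>m k. 0 \<le> p m k) \<and> (\<forall>m K. (\<Sum>k<K. p m k) \<le> 1) \<and>
    (\<forall>n. \<xi> n \<le> 2 * ((\<Sum>m<2 ^ dyadic_block n. \<eta> m * p m (dyadic_block n)) / 2 ^ dyadic_block n))"
proof -
  note x0 = c0_starD(1)[OF xi] and y0 = c0_starD(1)[OF eta]
  define S where "S = (\<lambda>m. \<Sum>j<m. \<eta> j)"
  \<comment> \<open>\<open>T k\<close> is the mass assigned to the blocks before k. As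
    \<open>T (Suc k)\<close> stops at 2^k terms, majorization bounds it by \<open>S (2 ^ k)\<close>,
    and only columns m < 2^k of block k are needed.\<close>
  define T where "T = (\<lambda>k. case k of 0 \<Rightarrow> 0 | Suc k' \<Rightarrow> \<Sum>j<2 ^ k'. \<xi> j)"
  have T0: "T 0 = 0" and TS: "T (Suc k) = (\<Sum>j<2 ^ k. \<xi> j)" for k by (simp_all add: T_def)
  have Tpos: "0 \<le> T k" for k by (cases k) (simp_all add: T0 TS sum_nonneg x0)
  have Tmono: "T k \<le> T (Suc k)" for k
  proof (cases k)
    case 0
    then show ?thesis using Tpos T0 by simp
  next
    case (Suc k')
    then show ?thesis unfolding Suc TS by (intro sum_mono2) (auto simp: x0)
  qed
  have SS: "S (Suc m) = S m + \<eta> m" for m by (simp add: S_def)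
  have S0: "S 0 = 0" and Spos: "0 \<le> S m" for m by (simp_all add: S_def sum_nonneg y0)
  \<comment> \<open>The length of the intersection of the intervals from \<open>S m\<close> to
    \<open>S (Suc m)\<close> and from \<open>T k\<close> to \<open>T (Suc k)\<close>, written as a
    mixed difference of minima so that sums over k and over m both telescope.\<close>
  define w where "w = (\<lambda>m k. (min (T (Suc k)) (S (Suc m)) - min (T (Suc k)) (S m))
      - (min (T k) (S (Suc m)) - min (T k) (S m)))"
  have w0: "0 \<le> w m k" for m k using Tmono[of k] y0[of m] by (simp add: w_def SS min_def)
  have wk: "(\<Sum>k<K. w m k) \<le> \<eta> m" for m K
  proof -
    have "(\<Sum>k<K. w m k) = (min (T K) (S (Suc m)) - min (T K) (S m)) - (min (T 0) (S (Suc m)) - min (T 0) (S m))"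
      unfolding w_def by (rule sum_lessThan_telescope[of "\<lambda>k. min (T k) (S (Suc m)) - min (T k) (S m)"])
    then show ?thesis using Spos[of m] Spos[of "Suc m"] y0[of m] by (simp add: T0 SS min_def split: if_splits)
  qed
  \<comment> \<open>An interval of length 0 carries no mass, so the default value of the division in
    \<open>p\<close> is harmless.\<close>
  have wz: "w m k = 0" if "\<eta> m = 0" for m k using that by (simp add: w_def SS)
  define p where "p = (\<lambda>m k. w m k / \<eta> m)"
  have pw: "\<eta> m * p m k = w m k" for m k using wz by (simp add: p_def)
  have "0 \<le> p m k" for m k by (simp add: p_def w0 y0)
  moreover have "(\<Sum>k<K. p m k) \<le> 1" for m K
    using wk[where m = m and K = K] y0[of m] unfolding p_def sum_divide_distrib[symmetric]
    by (cases "\<eta> m = 0") (simp_all add: divide_le_eq_1)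
  moreover have "\<xi> n \<le> 2 * ((\<Sum>m<2 ^ dyadic_block n. \<eta> m * p m (dyadic_block n)) / 2 ^ dyadic_block n)" for n
  proof -
    let ?k = "dyadic_block n"
    have "(\<Sum>m<2 ^ ?k. w m ?k) = (\<Sum>m<2 ^ ?k. (min (T (Suc ?k)) (S (Suc m)) - min (T ?k) (S (Suc m)))
        - (min (T (Suc ?k)) (S m) - min (T ?k) (S m)))"
      by (intro sum.cong) (auto simp: w_def)
    also have "\<dots> = (min (T (Suc ?k)) (S (2 ^ ?k)) - min (T ?k) (S (2 ^ ?k)))
        - (min (T (Suc ?k)) (S 0) - min (T ?k) (S 0))"
      by (rule sum_lessThan_telescope[of "\<lambda>m. min (T (Suc ?k)) (S m) - min (T ?k) (S m)"])
    also have "\<dots> = T (Suc ?k) - T ?k"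
    proof -
      have "T (Suc ?k) \<le> S (2 ^ ?k)" unfolding TS S_def by (rule le)
      then show ?thesis using Tmono[of ?k] Tpos[of ?k] Tpos[of "Suc ?k"] by (simp add: S0 min_def)
    qed
    finally have sum_w: "(\<Sum>m<2 ^ ?k. w m ?k) = T (Suc ?k) - T ?k" .
    have "2 ^ ?k * \<xi> n \<le> 2 * (T (Suc ?k) - T ?k)"
    proof (cases ?k)
      case 0
      then have "n = 0" using dyadic_block_bounds(2)[of n] by simp
      then show ?thesis using 0 x0[of 0] by (simp add: TS T0)
    next
      case (Suc k')
      \<comment> \<open>\<open>A\<close> is half as long as the block, and all its indices are at
        most n; monotonicity of \<xi> gives the bound with the factor 2.\<close>
      define A where "A = {..<(2::nat) ^ ?k} - {..<2 ^ k'}"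
      have A: "T (Suc ?k) - T ?k = (\<Sum>j\<in>A. \<xi> j)"
        unfolding A_def Suc TS by (subst sum_diff) auto
      have "card A = 2 ^ k'" unfolding A_def Suc by (subst card_Diff_subset) auto
      then have "2 ^ k' * \<xi> n = (\<Sum>j\<in>A. \<xi> n)" by simp
      also have "\<dots> \<le> (\<Sum>j\<in>A. \<xi> j)"
        using dyadic_block_bounds(1)[of n] by (intro sum_mono c0_starD(2)[OF xi]) (auto simp: A_def)
      finally have "2 ^ k' * \<xi> n \<le> T (Suc ?k) - T ?k" by (simp only: A)
      then show ?thesis unfolding Suc by simp
    qed
    then show ?thesis unfolding pw sum_w by (simp add: pos_le_divide_eq mult.commute)
  qed
  ultimately show ?thesis by blast
qed

section \<open>From diagonal invariance to am-closedness\<close>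

lemma am_closure_subset:
  fixes e :: "nat \<Rightarrow> 'a::complex_hilbert_space" and I :: "('a \<Rightarrow> 'a) set"
  assumes e: "orthonormal_basis e" and I: "proper_ideal I" and inv: "diag_expectation e ` I \<subseteq> I"
  shows "am_closure I \<subseteq> I"
proof
  fix X assume "X \<in> am_closure I"
  then obtain \<eta> C where X: "compact_op X" and eta: "\<eta> \<in> char_set I"
    and am: "\<And>n. arith_mean (singular_numbers X) n \<le> C * arith_mean \<eta> n"
    unfolding am_closure_iff[OF e I] by blast
  define \<xi> where "\<xi> = singular_numbers X"
  have xi: "\<xi> \<in> c0_star" unfolding \<xi>_def by (rule singular_numbers_c0_star[OF e X])
  have eta': "\<eta> \<in> c0_star" by (rule char_set_c0_star[OF e I eta])
  \<comment> \<open>The transport needs domination with constant 1, so C moves into the sequence;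
    its absolute value keeps the sequence nonnegative.\<close>
  define \<eta>' where "\<eta>' = (\<lambda>n. \<bar>C\<bar> * \<eta> n)"
  have c0: "\<eta>' \<in> c0_star"
    using c0_starD(1,2)[OF eta'] tendsto_mult_right_zero[OF c0_starD(3)[OF eta'], of "\<bar>C\<bar>"]
    by (auto simp: \<eta>'_def c0_star_def decseq_def intro: mult_left_mono)
  then have eta'_mem: "\<eta>' \<in> char_set I"
    by (rule char_set_hereditary[OF e I eta, of _ "\<bar>C\<bar>"]) (simp add: \<eta>'_def)
  have "(\<Sum>j<n. \<xi> j) \<le> (\<Sum>j<n. \<eta>' j)" for n
  proof (cases n)
    case (Suc m)
    have "(\<Sum>j\<le>m. \<xi> j) \<le> C * (\<Sum>j\<le>m. \<eta> j)"
      using am[of m] unfolding arith_mean_le_iff \<xi>_def .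
    also have "\<dots> \<le> \<bar>C\<bar> * (\<Sum>j\<le>m. \<eta> j)"
      by (intro mult_right_mono abs_ge_self sum_nonneg c0_starD(1)[OF eta'])
    finally show ?thesis by (simp add: Suc lessThan_Suc_atMost \<eta>'_def sum_distrib_left)
  qed simp
  from transport_weights[OF xi c0 this] obtain p where p: "\<And>m k. 0 \<le> p m k" "\<And>m K. (\<Sum>k<K. p m k) \<le> 1"
    "\<And>n. \<xi> n \<le> 2 * ((\<Sum>m<2 ^ dyadic_block n. \<eta>' m * p m (dyadic_block n)) / 2 ^ dyadic_block n)"
    by blast
  have "\<xi> \<in> char_set I"
    by (rule block_diagonal_mem[where p = p and C = 2, OF e _ _ I inv eta'_mem xi]) (fact p)+
  then show "X \<in> I" using X unfolding proper_ideal_iff_singular_numbers[OF e I] \<xi>_def by blast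
qed

theorem theorem4p5:
  fixes e :: "nat \<Rightarrow> 'a::complex_hilbert_space"
    and I :: "('a \<Rightarrow> 'a) set"
  assumes "orthonormal_basis e"
    and "proper_ideal I"
  shows "am_closed I \<longleftrightarrow> diag_expectation e ` I \<subseteq> I"
proof
  assume "am_closed I"
  then show "diag_expectation e ` I \<subseteq> I"
    using diag_expectation_mem_am_closure[OF assms] unfolding am_closed_def by blast
next
  assume "diag_expectation e ` I \<subseteq> I"
  then have "am_closure I \<subseteq> I" by (rule am_closure_subset[OF assms])
  moreover have "I \<subseteq> am_closure I"
  proof
    fix X assume "X \<in> I"
    then have "compact_op X" "singular_numbers X \<in> char_set I"
      using proper_ideal_iff_singular_numbers[OF assms] by auto
    moreover have "\<forall>n. arith_mean (singular_numbers X) n \<le> 1 * arith_mean (singular_numbers X) n" by simp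
    ultimately show "X \<in> am_closure I" unfolding am_closure_iff[OF assms] by blast
  qed
  ultimately show "am_closed I" unfolding am_closed_def by blast
qed

end
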